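(* Let $c\in\mathbb R$ with $|c|<1$ and let $\pi_c=(c-x_3)\pi$ be the corresponding "necklace" Poisson structure on $S^2$, where $\pi$ is the standard rotation-invariant symplectic Poisson structure. Then the Poisson cohomology of $(S^2,\pi_c)$ is $$H^0_{\pi_c}(S^2)=\mathbb R=\operatorname{span}\{1\},\qquad H^1_{\pi_c}(S^2)=\mathbb R=\operatorname{span}\{\Delta_\omega\},\qquad H^2_{\pi_c}(S^2)=\mathbb R^2=\operatorname{span}\{\pi_c,\pi\},$$ where $\Delta_\omega$ is the modular vector field of $\pi_c$ with respect to the standard rotation-invariant area form $\omega$ (the inverse of $\pi$), and the spans are of the corresponding cohomology classes.
   Context: $S^2\subset\mathbb R^3$ is the unit sphere with coordinates $(x_1,x_2,x_3)$. Let $w=x+iy$ be the stereographic coordinate on $S^2$ with $x_3=\frac{1-x^2-y^2}{1+x^2+y^2}$ (covering all of $S^2$ but one point). In it, $$\pi=\tfrac14(1+x^2+y^2)^2\,\partial_x\wedge\partial_y,\qquad \pi_c=(c-x_3)\pi=\tfrac14(1+x^2+y^2)\big((c+1)(x^2+y^2)+c-1\big)\,\partial_x\wedge\partial_y.$$ The $\pi_c$ ($c\in\mathbb R$) are the $SU(2)$-covariant Poisson structures on $S^2=SU(2)/U(1)$. For $|c|<1$, $\pi_c$ vanishes exactly on the circle $\{x_3=c\}$. The Poisson cohomology $H^\star_{\pi}(P)$ of a Poisson manifold $(P,\pi)$ is the cohomology of the complex of smooth multivector fields on $P$ with differential $d_\pi=[\pi,\cdot]$ (Schouten bracket). The modular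 vector field $\Delta_\omega$ with respect to a volume form $\omega$ is the vector field sending $f$ to the divergence, with respect to $\omega$, of its Hamiltonian vector field $X_f$, where $X_f\cdot g=\{g,f\}$. For all $\pi_c$ and the standard $\omega$ one has $\Delta_\omega=x\partial_y-y\partial_x$. *)

theory Defs
  imports "HOL-Analysis.Analysis" "HOL-Library.Function_Algebras"
begin

subsection \<open>Smooth functions on the sphere\<close>

primrec Ck_on :: "nat \<Rightarrow> ('a::real_normed_vector \<Rightarrow> real) \<Rightarrow> 'a set \<Rightarrow> bool" where
  "Ck_on 0 F U \<longleftrightarrow> continuous_on U F"
| "Ck_on (Suc k) F U \<longleftrightarrow>
     F differentiable_on U \<and> (\<forall>v. Ck_on k (\<lambda>x. frechet_derivative F (at x) v) U)"

definition smooth_on :: "('a::real_normed_vector \<Rightarrow> real) \<Rightarrow> 'a set \<Rightarrow> bool" where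
  "smooth_on F U \<longleftrightarrow> open U \<and> (\<forall>k. Ck_on k F U)"

typedef S2 = "sphere (0::real^3) 1"
proof -
  have "axis 1 1 \<in> sphere (0::real^3) 1" by simp
  then show ?thesis by blast
qed

text \<open>A function on the unit sphere in \<open>real^3\<close> is smooth iff it locally extends to a smooth
  function on an open subset of \<open>real^3\<close>.\<close>

definition smooth_S2 :: "(S2 \<Rightarrow> real) set" where
  "smooth_S2 = {f. \<forall>p. \<exists>U F. Rep_S2 p \<in> U \<and> smooth_on F U \<and>
                   (\<forall>q. Rep_S2 q \<in> U \<longrightarrow> f q = F (Rep_S2 q))}"


subsection \<open>Multivector fields and the Schouten bracket\<close>

text \<open>For a manifold \<open>M\<close> with algebra of smooth functions \<open>C\<close>, the smooth \<open>k\<close>-vector fields on \<open>M\<close>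
  are the alternating \<open>k\<close>-derivations of \<open>C\<close>, i.e. \<open>P [f\<^sub>1, \<dots>, f\<^sub>k] = P(df\<^sub>1, \<dots>, df\<^sub>k)\<close>.
  They are represented as functions on lists that vanish on all lists other than those consisting of
  \<open>k\<close> elements of \<open>C\<close>, so that equality of multivector fields is equality in HOL.  For \<open>k = 0\<close> the
  only argument is \<open>[]\<close> and one gets the functions themselves, see \<open>of_function\<close>.\<close>

type_synonym 'm multivector = "('m \<Rightarrow> real) list \<Rightarrow> 'm \<Rightarrow> real"

definition smooth_args :: "('m \<Rightarrow> real) set \<Rightarrow> nat \<Rightarrow> ('m \<Rightarrow> real) list \<Rightarrow> bool" where
  "smooth_args C k Fs \<longleftrightarrow> length Fs = k \<and> set Fs \<subseteq> C"

definition multivector_fields :: "('m \<Rightarrow> real) set \<Rightarrow> nat \<Rightarrow> 'm multivector set" where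
  "multivector_fields C k = {P.
     (\<forall>Fs. smooth_args C k Fs \<longrightarrow> P Fs \<in> C) \<and>
     (\<forall>Fs. \<not> smooth_args C k Fs \<longrightarrow> P Fs = 0) \<and>
     (\<forall>Fs. \<not> distinct Fs \<longrightarrow> P Fs = 0) \<and>
     (\<forall>Fs Gs. \<forall>f\<in>C. \<forall>g\<in>C. smooth_args C k (Fs @ f # Gs) \<longrightarrow>
        P (Fs @ (f + g) # Gs) = P (Fs @ f # Gs) + P (Fs @ g # Gs) \<and>
        P (Fs @ (f * g) # Gs) = f * P (Fs @ g # Gs) + g * P (Fs @ f # Gs) \<and>
        (\<forall>a. P (Fs @ (\<lambda>x. a * f x) # Gs) = (\<lambda>x. a * P (Fs @ f # Gs) x)))}"

definition of_function :: "('m \<Rightarrow> real) \<Rightarrow> 'm multivector" where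
  "of_function f = (\<lambda>Fs. if Fs = [] then f else 0)"

definition shuffle_perms :: "nat \<Rightarrow> nat \<Rightarrow> (nat \<Rightarrow> nat) set" where
  "shuffle_perms k l =
     {\<sigma>. \<sigma> permutes {..<k + l} \<and> strict_mono_on {..<k} \<sigma> \<and> strict_mono_on {k..<k + l} \<sigma>}"

text \<open>Insertion of the \<open>q\<close>-vector field \<open>Q\<close> into the first slot of the \<open>p\<close>-vector field \<open>P\<close>,
  antisymmetrised over \<open>(q, p - 1)\<close>-shuffles.\<close>

definition insertion :: "nat \<Rightarrow> nat \<Rightarrow> 'm multivector \<Rightarrow> 'm multivector \<Rightarrow> 'm multivector" where
  "insertion p q P Q Fs =
     (if p = 0 then 0
      else (\<lambda>x. \<Sum>\<sigma>\<in>shuffle_perms q (p - 1). of_int (sign \<sigma>) *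
             P (Q (map (\<lambda>i. Fs ! \<sigma> i) [0..<q]) # map (\<lambda>i. Fs ! \<sigma> i) [q..<q + (p - 1)]) x))"

text \<open>The Schouten bracket of \<open>P \<in> multivector_fields C p\<close> and \<open>Q \<in> multivector_fields C q\<close>, a
  \<open>(p + q - 1)\<close>-vector field.  The exponent \<open>(p + 1) (q + 1)\<close> has the parity of
  \<open>(p - 1) (q - 1)\<close>, but avoids truncated subtraction.\<close>

definition schouten ::
  "('m \<Rightarrow> real) set \<Rightarrow> nat \<Rightarrow> nat \<Rightarrow> 'm multivector \<Rightarrow> 'm multivector \<Rightarrow> 'm multivector" where
  "schouten C p q P Q Fs =
     (if smooth_args C (p + q - 1) Fs
      then (\<lambda>x. insertion p q P Q Fs x - (-1) ^ ((p + 1) * (q + 1)) * insertion q p Q P Fs x)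
      else 0)"


subsection \<open>Poisson cohomology\<close>

definition poisson_diff ::
  "('m \<Rightarrow> real) set \<Rightarrow> 'm multivector \<Rightarrow> nat \<Rightarrow> 'm multivector \<Rightarrow> 'm multivector" where
  "poisson_diff C \<pi> k P = schouten C 2 k \<pi> P"

definition poisson_cocycles ::
  "('m \<Rightarrow> real) set \<Rightarrow> 'm multivector \<Rightarrow> nat \<Rightarrow> 'm multivector set" where
  "poisson_cocycles C \<pi> k = {P \<in> multivector_fields C k. poisson_diff C \<pi> k P = 0}"

definition poisson_coboundaries ::
  "('m \<Rightarrow> real) set \<Rightarrow> 'm multivector \<Rightarrow> nat \<Rightarrow> 'm multivector set" where
  "poisson_coboundaries C \<pi> k =
     (case k of 0 \<Rightarrow> {0} | Suc j \<Rightarrow> poisson_diff C \<pi> j ` multivector_fields C j)"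

definition cohomologous ::
  "('m \<Rightarrow> real) set \<Rightarrow> 'm multivector \<Rightarrow> nat \<Rightarrow> ('m multivector \<times> 'm multivector) set" where
  "cohomologous C \<pi> k = {(P, Q). P \<in> poisson_cocycles C \<pi> k \<and> Q \<in> poisson_cocycles C \<pi> k \<and>
                                P - Q \<in> poisson_coboundaries C \<pi> k}"

definition poisson_cohomology ::
  "('m \<Rightarrow> real) set \<Rightarrow> 'm multivector \<Rightarrow> nat \<Rightarrow> 'm multivector set set" where
  "poisson_cohomology C \<pi> k = poisson_cocycles C \<pi> k // cohomologous C \<pi> k"

definition poisson_class ::
  "('m \<Rightarrow> real) set \<Rightarrow> 'm multivector \<Rightarrow> nat \<Rightarrow> 'm multivector \<Rightarrow> 'm multivector set" where
  "poisson_class C \<pi> k P = cohomologous C \<pi> k `` {P}"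

text \<open>The vector space structure on the quotient.\<close>

definition class_add ::
  "('m \<Rightarrow> real) set \<Rightarrow> 'm multivector \<Rightarrow> nat \<Rightarrow>
   'm multivector set \<Rightarrow> 'm multivector set \<Rightarrow> 'm multivector set" where
  "class_add C \<pi> k A B = (\<Union>P\<in>A. \<Union>Q\<in>B. poisson_class C \<pi> k (P + Q))"

definition class_scale ::
  "('m \<Rightarrow> real) set \<Rightarrow> 'm multivector \<Rightarrow> nat \<Rightarrow>
   real \<Rightarrow> 'm multivector set \<Rightarrow> 'm multivector set" where
  "class_scale C \<pi> k a A = (\<Union>P\<in>A. poisson_class C \<pi> k (\<lambda>Fs x. a * P Fs x))"


subsection \<open>Divergence and the modular vector field\<close>

text \<open>The divergence of \<open>X\<close> is the function \<open>h\<close> such that the Lie derivative of the volume form \<open>\<eta>\<close>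
  along \<open>X\<close> is \<open>h \<eta>\<close>.  Differential 2-forms are regarded as functions of two vector fields.\<close>

type_synonym 'm two_form = "'m multivector \<Rightarrow> 'm multivector \<Rightarrow> 'm \<Rightarrow> real"

definition lie_derivative ::
  "('m \<Rightarrow> real) set \<Rightarrow> 'm multivector \<Rightarrow> 'm two_form \<Rightarrow> 'm two_form" where
  "lie_derivative C X \<eta> Y Z = X [\<eta> Y Z] - \<eta> (schouten C 1 1 X Y) Z - \<eta> Y (schouten C 1 1 X Z)"

definition divergence ::
  "('m \<Rightarrow> real) set \<Rightarrow> 'm two_form \<Rightarrow> 'm multivector \<Rightarrow> 'm \<Rightarrow> real" where
  "divergence C \<eta> X = (THE h. h \<in> C \<and>
     (\<forall>Y\<in>multivector_fields C 1. \<forall>Z\<in>multivector_fields C 1.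
        lie_derivative C X \<eta> Y Z = h * \<eta> Y Z))"

definition hamiltonian_field ::
  "('m \<Rightarrow> real) set \<Rightarrow> 'm multivector \<Rightarrow> ('m \<Rightarrow> real) \<Rightarrow> 'm multivector" where
  "hamiltonian_field C \<pi> f = (\<lambda>Gs. if smooth_args C 1 Gs then \<pi> [hd Gs, f] else 0)"

definition modular_field ::
  "('m \<Rightarrow> real) set \<Rightarrow> 'm multivector \<Rightarrow> 'm two_form \<Rightarrow> 'm multivector" where
  "modular_field C \<pi> \<eta> =
     (\<lambda>Fs. if smooth_args C 1 Fs then divergence C \<eta> (hamiltonian_field C \<pi> (hd Fs)) else 0)"


subsection \<open>The Poisson structures on the sphere\<close>

definition S2_extend :: "(S2 \<Rightarrow> real) \<Rightarrow> real^3 \<Rightarrow> real" where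
  "S2_extend f x = f (Abs_S2 (x /\<^sub>R norm x))"

definition S2_grad :: "(S2 \<Rightarrow> real) \<Rightarrow> S2 \<Rightarrow> real^3" where
  "S2_grad f p = (\<chi> i. frechet_derivative (S2_extend f) (at (Rep_S2 p)) (axis i 1))"

definition S2_coord :: "3 \<Rightarrow> S2 \<Rightarrow> real" where
  "S2_coord i p = Rep_S2 p $ i"

text \<open>The bracket \<open>{f, g}(p) = det (p, \<nabla>f(p), \<nabla>g(p))\<close>; its expression in the stereographic
  coordinate is \<open>std_poisson_stereographic\<close> below.\<close>

definition std_poisson :: "S2 multivector" where
  "std_poisson Fs =
     (if smooth_args smooth_S2 2 Fs
      then (\<lambda>p. Rep_S2 p \<bullet> cross3 (S2_grad (Fs ! 0) p) (S2_grad (Fs ! 1) p))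
      else 0)"

definition necklace_poisson :: "real \<Rightarrow> S2 multivector" where
  "necklace_poisson c Fs = (\<lambda>p. (c - S2_coord 3 p) * std_poisson Fs p)"

text \<open>The area form \<open>\<omega>\<^sub>p(u, v) = det (p, u, v)\<close>, where the derivation \<open>X\<close> corresponds to the tangent
  vector \<open>(X x\<^sub>1, X x\<^sub>2, X x\<^sub>3)\<close>.  It is the inverse of \<open>std_poisson\<close> by \<open>std_area_hamiltonian\<close>.\<close>

definition S2_vector :: "S2 multivector \<Rightarrow> S2 \<Rightarrow> real^3" where
  "S2_vector X p = (\<chi> i. X [S2_coord i] p)"

definition std_area :: "S2 two_form" where
  "std_area X Y p = Rep_S2 p \<bullet> cross3 (S2_vector X p) (S2_vector Y p)"


subsection \<open>The standard Poisson structure in the stereographic coordinate\<close>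

definition stereographic :: "real \<Rightarrow> real \<Rightarrow> S2" where
  "stereographic x y = Abs_S2 (vector [2 * x / (1 + x\<^sup>2 + y\<^sup>2), 2 * y / (1 + x\<^sup>2 + y\<^sup>2),
                                 (1 - x\<^sup>2 - y\<^sup>2) / (1 + x\<^sup>2 + y\<^sup>2)])"

lemma Rep_stereographic:
  "Rep_S2 (stereographic x y) =
     vector [2 * x / (1 + x\<^sup>2 + y\<^sup>2), 2 * y / (1 + x\<^sup>2 + y\<^sup>2), (1 - x\<^sup>2 - y\<^sup>2) / (1 + x\<^sup>2 + y\<^sup>2)]"
proof -
  define s where "s = 1 + x\<^sup>2 + y\<^sup>2"
  have s: "s > 0" by (simp add: s_def add_pos_nonneg)
  have "(2 * x)\<^sup>2 + (2 * y)\<^sup>2 + (1 - x\<^sup>2 - y\<^sup>2)\<^sup>2 = s\<^sup>2"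
    by (simp add: s_def power2_eq_square algebra_simps)
  then have "(2 * x / s)\<^sup>2 + (2 * y / s)\<^sup>2 + ((1 - x\<^sup>2 - y\<^sup>2) / s)\<^sup>2 = 1"
    using s by (simp add: power_divide add_divide_distrib [symmetric])
  then have "norm (vector [2 * x / s, 2 * y / s, (1 - x\<^sup>2 - y\<^sup>2) / s] :: real^3) = 1"
    by (simp add: norm_vec_def L2_set_def sum_3)
  then show ?thesis
    by (simp add: stereographic_def s_def Abs_S2_inverse)
qed

lemma S2_extend_differentiable:
  assumes "f \<in> smooth_S2"
  shows "S2_extend f differentiable (at (Rep_S2 p))"
proof -
  from assms obtain U G where p: "Rep_S2 p \<in> U" and G: "smooth_on G U"
    and eq: "\<And>q. Rep_S2 q \<in> U \<Longrightarrow> f q = G (Rep_S2 q)"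
    by (auto simp: smooth_S2_def) metis
  define r where "r = (\<lambda>x::real^3. x /\<^sub>R norm x)"
  have np: "norm (Rep_S2 p) = 1" using Rep_S2 [of p] by simp
  then have p0: "Rep_S2 p \<noteq> 0" by auto
  have rp: "r (Rep_S2 p) = Rep_S2 p" by (simp add: r_def np)
  have U: "open U" using G by (simp add: smooth_on_def)
  have "Ck_on (Suc 0) G U" using G unfolding smooth_on_def by blast
  then have "G differentiable_on U" by simp
  then have Gd: "G differentiable (at (r (Rep_S2 p)))"
    using p U rp by (simp add: differentiable_on_eq_differentiable_at)
  have rd: "r differentiable (at (Rep_S2 p))"
    unfolding r_def using p0
    by (intro differentiable_scaleR differentiable_inverse differentiable_norm_at
        differentiable_ident) auto
  have "continuous (at (Rep_S2 p)) r"
    using rd differentiable_imp_continuous_within by blast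
  then have "eventually (\<lambda>x. r x \<in> U) (at (Rep_S2 p))"
    using p U rp unfolding continuous_at by (metis topological_tendstoD)

  moreover have "eventually (\<lambda>x. x \<noteq> 0) (at (Rep_S2 p))"
    using eventually_neq_at_within by blast
  ultimately have ev: "eventually (\<lambda>x. (G \<circ> r) x = S2_extend f x) (at (Rep_S2 p))"
  proof eventually_elim
    case (elim x)
    then have "norm (r x) = 1" by (simp add: r_def)
    then have "Rep_S2 (Abs_S2 (r x)) = r x" by (simp add: Abs_S2_inverse)
    then show ?case using eq [of "Abs_S2 (r x)"] elim by (simp add: S2_extend_def r_def)
  qed
  have "(G \<circ> r) differentiable (at (Rep_S2 p))"
    using rd Gd by (intro differentiable_chain_at) auto
  then obtain D where D: "((G \<circ> r) has_derivative D) (at (Rep_S2 p))"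
    by (auto simp: differentiable_def)
  have "(G \<circ> r) (Rep_S2 p) = S2_extend f (Rep_S2 p)"
    using eq [of p] p rp by (simp add: S2_extend_def Rep_S2_inverse np)
  then have "(S2_extend f has_derivative D) (at (Rep_S2 p))"
    using has_derivative_transform_eventually [OF D ev] by simp
  then show ?thesis by (auto simp: differentiable_def)
qed

lemma S2_grad_chain:
  assumes f: "f \<in> smooth_S2" and g: "\<And>t. Rep_S2 (g t) = \<gamma> t"
    and d: "(\<gamma> has_vector_derivative v) (at t)"
  shows "deriv (\<lambda>t. f (g t)) t = S2_grad f (g t) \<bullet> v"
proof -
  let ?F = "S2_extend f"
  have n: "norm (\<gamma> t) = 1" for t using Rep_S2 [of "g t"] g by simp
  have e: "f (g t) = ?F (\<gamma> t)" for t
    by (simp add: S2_extend_def n) (metis Rep_S2_inverse g)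
  have F: "(?F has_derivative frechet_derivative ?F (at (\<gamma> t))) (at (\<gamma> t))"
    using S2_extend_differentiable [OF f, of "g t"] g by (simp add: frechet_derivative_works)
  then have lin: "linear (frechet_derivative ?F (at (\<gamma> t)))"
    using has_derivative_linear by blast
  have "frechet_derivative ?F (at (\<gamma> t)) v
      = frechet_derivative ?F (at (\<gamma> t)) (\<Sum>i\<in>UNIV. v $ i *\<^sub>R axis i 1)"
    by (simp add: basis_expansion scalar_mult_eq_scaleR [symmetric])
  also have "\<dots> = S2_grad f (g t) \<bullet> v"
    using lin g by (simp add: linear_sum linear_cmul S2_grad_def inner_vec_def mult.commute)
  finally have v: "frechet_derivative ?F (at (\<gamma> t)) v = S2_grad f (g t) \<bullet> v" .
  have "((?F \<circ> \<gamma>) has_derivative (frechet_derivative ?F (at (\<gamma> t)) \<circ> (\<lambda>s. s *\<^sub>R v))) (at t)"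
    using F d unfolding has_vector_derivative_def by (intro diff_chain_at)
  moreover have "frechet_derivative ?F (at (\<gamma> t)) \<circ> (\<lambda>s. s *\<^sub>R v) = (*) (S2_grad f (g t) \<bullet> v)"
    using linear_cmul [OF lin] v by (auto simp: fun_eq_iff)
  moreover have "?F \<circ> \<gamma> = (\<lambda>t. f (g t))" by (simp add: fun_eq_iff e)
  ultimately have "((\<lambda>t. f (g t)) has_field_derivative (S2_grad f (g t) \<bullet> v)) (at t)"
    by (simp add: has_field_derivative_def)
  then show ?thesis by (rule DERIV_imp_deriv)
qed

lemma vector3_has_vector_derivative:
  assumes "(a has_real_derivative a') (at t)" "(b has_real_derivative b') (at t)"
    "(c has_real_derivative c') (at t)"
  shows "((\<lambda>t. vector [a t, b t, c t] :: real^3) has_vector_derivative vector [a', b', c']) (at t)"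
proof -
  have eq: "vector [p, q, r] = p *\<^sub>R axis 1 1 + q *\<^sub>R axis 2 1 + r *\<^sub>R (axis 3 1 :: real^3)"
    for p q r :: real
    by (simp add: vec_eq_iff forall_3 axis_def)
  show ?thesis
    unfolding eq using assms
    by (intro has_vector_derivative_add)
       (auto intro!: derivative_eq_intros simp: has_real_derivative_iff_has_vector_derivative)
qed

lemma std_poisson_stereographic:
  assumes f: "f \<in> smooth_S2" and g: "g \<in> smooth_S2"
  shows "std_poisson [f, g] (stereographic x y) =
    (1 + x\<^sup>2 + y\<^sup>2)\<^sup>2 / 4 *
      (deriv (\<lambda>s. f (stereographic s y)) x * deriv (\<lambda>t. g (stereographic x t)) y
     - deriv (\<lambda>t. f (stereographic x t)) y * deriv (\<lambda>s. g (stereographic s y)) x)"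
proof -
  define s where "s = 1 + x\<^sup>2 + y\<^sup>2"
  define u :: "real^3" where
    "u = vector [2 * (1 - x\<^sup>2 + y\<^sup>2) / s\<^sup>2, - (4 * x * y) / s\<^sup>2, - (4 * x) / s\<^sup>2]"
  define v :: "real^3" where
    "v = vector [- (4 * x * y) / s\<^sup>2, 2 * (1 + x\<^sup>2 - y\<^sup>2) / s\<^sup>2, - (4 * y) / s\<^sup>2]"
  define P where "P = Rep_S2 (stereographic x y)"
  have s: "s > 0" by (simp add: s_def add_pos_nonneg)
  have s': "1 + x\<^sup>2 + y\<^sup>2 \<noteq> 0" using s by (simp add: s_def)
  have u: "((\<lambda>x. Rep_S2 (stereographic x y)) has_vector_derivative u) (at x)"
    unfolding Rep_stereographic u_def using s'
    by (intro vector3_has_vector_derivative; auto intro!: derivative_eq_intros simp: s_def;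
        simp add: power2_eq_square divide_simps; simp add: algebra_simps)
  have v: "((\<lambda>y. Rep_S2 (stereographic x y)) has_vector_derivative v) (at y)"
    unfolding Rep_stereographic v_def using s'
    by (intro vector3_has_vector_derivative; auto intro!: derivative_eq_intros simp: s_def;
        simp add: power2_eq_square divide_simps; simp add: algebra_simps)
  have P: "P = (s\<^sup>2 / 4) *\<^sub>R cross3 u v"
  proof -
    define k where "k = 4 / s\<^sup>2"
    have k: "s\<^sup>2 / 4 = 1 / k" "k \<noteq> 0" using s by (auto simp: k_def)
    have u': "u $ 1 = k * ((1 - x\<^sup>2 + y\<^sup>2) / 2)" "u $ 2 = - k * (x * y)" "u $ 3 = - k * x"
      using s by (simp_all add: u_def k_def field_simps)
    have v': "v $ 1 = - k * (x * y)" "v $ 2 = k * ((1 + x\<^sup>2 - y\<^sup>2) / 2)" "v $ 3 = - k * y"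
      using s by (simp_all add: v_def k_def field_simps)
    have c: "1 / k * (k * (k * (s / 2 * w))) = 2 * w / s" "1 / k * (k * (k * (s / 4 * w))) = w / s" for w
      using s by (simp_all add: k_def power2_eq_square field_simps)
    have "u $ 2 * v $ 3 - u $ 3 * v $ 2 = k * (k * (s / 2 * x))"
      unfolding u' v' s_def by (simp add: power2_eq_square field_simps)
    moreover have "u $ 3 * v $ 1 - u $ 1 * v $ 3 = k * (k * (s / 2 * y))"
      unfolding u' v' s_def by (simp add: power2_eq_square field_simps)
    moreover have "u $ 1 * v $ 2 - u $ 2 * v $ 1 = k * (k * (s / 4 * (1 - x\<^sup>2 - y\<^sup>2)))"
      unfolding u' v' s_def by (simp add: power2_eq_square field_simps)
    moreover have "P $ 1 = 2 * x / s" "P $ 2 = 2 * y / s" "P $ 3 = (1 - x\<^sup>2 - y\<^sup>2) / s"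
      unfolding P_def Rep_stereographic s_def by simp_all
    ultimately show ?thesis
      unfolding vec_eq_iff forall_3 cross3_def k(1) by (simp only: vector_scaleR_component vector_3 real_scaleR_def c)
  qed
  have lagrange: "cross3 u v \<bullet> cross3 F G = (F \<bullet> u) * (G \<bullet> v) - (F \<bullet> v) * (G \<bullet> u)" for F G
    unfolding dot_cross by (simp only: inner_commute mult.commute)
  have fg: "smooth_args smooth_S2 2 [f, g]" using f g by (simp add: smooth_args_def)
  note chain_x = S2_grad_chain [where g = "\<lambda>s. stereographic s y", OF _ refl u]
  note chain_y = S2_grad_chain [where g = "\<lambda>t. stereographic x t", OF _ refl v]
  have "std_poisson [f, g] (stereographic x y)
      = s\<^sup>2 / 4 * (cross3 u v \<bullet> cross3 (S2_grad f (stereographic x y)) (S2_grad g (stereographic x y)))"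
    using fg unfolding std_poisson_def
    by (simp only: P [unfolded P_def] inner_scaleR_left if_True nth_Cons_0 One_nat_def nth_Cons_Suc)
  then show ?thesis
    unfolding lagrange chain_x [OF f] chain_x [OF g] chain_y [OF f] chain_y [OF g] s_def .
qed

lemma S2_coord_3_stereographic:
  "S2_coord 3 (stereographic x y) = (1 - x\<^sup>2 - y\<^sup>2) / (1 + x\<^sup>2 + y\<^sup>2)"
  by (simp add: S2_coord_def Rep_stereographic)


subsection \<open>The area form is inverse to the standard Poisson structure\<close>

lemma Ck_on_const: "Ck_on k (\<lambda>x. a) U"
  by (induction k arbitrary: a) (auto simp: frechet_derivative_const)

lemma S2_coord_smooth: "S2_coord i \<in> smooth_S2"
proof -
  have d: "((\<lambda>x::real^3. x $ i) has_derivative (\<lambda>v. v $ i)) (at x within S)" for x S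
    by (rule bounded_linear_imp_has_derivative) (rule bounded_linear_vec_nth)
  have "Ck_on k (\<lambda>x::real^3. x $ i) UNIV" for k
  proof (cases k)
    case 0
    then show ?thesis by (simp add: continuous_on_component)
  next
    case (Suc j)
    have "frechet_derivative (\<lambda>x::real^3. x $ i) (at x) = (\<lambda>v. v $ i)" for x
      using frechet_derivative_at [OF d] by simp
    then show ?thesis
      using d Suc by (auto simp: Ck_on_const differentiable_on_def differentiable_def)
  qed
  then have "smooth_on (\<lambda>x::real^3. x $ i) UNIV" by (simp add: smooth_on_def)
  then show ?thesis by (auto simp: smooth_S2_def S2_coord_def)
qed

lemma S2_grad_coord: "S2_grad (S2_coord i) p = axis i 1 - Rep_S2 p $ i *\<^sub>R Rep_S2 p"
proof -
  let ?p = "Rep_S2 p"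
  have np: "norm ?p = 1" using Rep_S2 [of p] by simp
  then have p0: "?p \<noteq> 0" by auto
  have d: "((\<lambda>x::real^3. x $ i) has_derivative (\<lambda>v. v $ i)) (at x)" for x
    by (rule bounded_linear_imp_has_derivative) (rule bounded_linear_vec_nth)
  have D: "((\<lambda>x::real^3. x $ i / norm x) has_derivative (\<lambda>v. v $ i - ?p $ i * (?p \<bullet> v))) (at ?p)"
    using p0 np
    by (auto intro!: derivative_eq_intros d has_derivative_norm
        simp: sgn_div_norm inner_commute)
  have "eventually (\<lambda>x. x \<noteq> 0) (at ?p)"
    using eventually_neq_at_within by blast
  then have "eventually (\<lambda>x. x $ i / norm x = S2_extend (S2_coord i) x) (at ?p)"
    by eventually_elim (simp add: S2_extend_def S2_coord_def Abs_S2_inverse divide_inverse_commute)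
  then have "(S2_extend (S2_coord i) has_derivative (\<lambda>v. v $ i - ?p $ i * (?p \<bullet> v))) (at ?p)"
    using p0
    by (intro has_derivative_transform_eventually [OF D])
       (auto simp: S2_extend_def S2_coord_def Rep_S2_inverse np)
  then have "frechet_derivative (S2_extend (S2_coord i)) (at ?p) = (\<lambda>v. v $ i - ?p $ i * (?p \<bullet> v))"
    by (rule frechet_derivative_at [symmetric])
  then show ?thesis
    by (simp add: S2_grad_def vec_eq_iff inner_axis) (auto simp: axis_def)
qed

lemma std_area_hamiltonian:
  assumes f: "f \<in> smooth_S2" and g: "g \<in> smooth_S2"
  shows "std_area (hamiltonian_field smooth_S2 std_poisson f)
           (hamiltonian_field smooth_S2 std_poisson g) = std_poisson [f, g]"
proof
  fix p
  let ?p = "Rep_S2 p"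
  have pp: "?p \<bullet> ?p = 1" using Rep_S2 [of p] by (simp add: dot_square_norm)
  have vec: "S2_vector (hamiltonian_field smooth_S2 std_poisson h) p = cross3 (S2_grad h p) ?p"
    if h: "h \<in> smooth_S2" for h
  proof -
    have "S2_vector (hamiltonian_field smooth_S2 std_poisson h) p $ i
        = ?p \<bullet> cross3 (axis i 1 - ?p $ i *\<^sub>R ?p) (S2_grad h p)" for i
      using h S2_coord_smooth
      by (simp add: S2_vector_def hamiltonian_field_def smooth_args_def std_poisson_def S2_grad_coord)
    also have "?p \<bullet> cross3 (axis i 1 - ?p $ i *\<^sub>R ?p) (S2_grad h p) = cross3 (S2_grad h p) ?p $ i" for i
    proof -
      have "?p \<bullet> cross3 a (S2_grad h p) = cross3 (S2_grad h p) ?p \<bullet> a" for a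
        using cross_triple [of a "S2_grad h p" ?p] by (simp add: inner_commute)
      then show ?thesis
        by (simp add: inner_diff_right dot_cross_self inner_axis)
    qed
    finally show ?thesis by (simp add: vec_eq_iff)
  qed
  have "?p \<bullet> cross3 (cross3 F ?p) (cross3 G ?p) = ?p \<bullet> cross3 F G" for F G
  proof -
    have "cross3 (cross3 F ?p) (cross3 G ?p) = (cross3 F ?p \<bullet> ?p) *\<^sub>R G - (cross3 F ?p \<bullet> G) *\<^sub>R ?p"
      by (rule Lagrange)
    then have "?p \<bullet> cross3 (cross3 F ?p) (cross3 G ?p) = - (cross3 F ?p \<bullet> G)"
      by (simp add: dot_cross_self inner_diff_right pp)
    also have "\<dots> = ?p \<bullet> cross3 F G"
      using cross_triple [of G F ?p] cross_skew [of F G] by (simp add: inner_commute)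
    finally show ?thesis .
  qed
  then show "std_area (hamiltonian_field smooth_S2 std_poisson f)
           (hamiltonian_field smooth_S2 std_poisson g) p = std_poisson [f, g] p"
    using f g by (simp add: std_area_def vec pp std_poisson_def smooth_args_def)
qed

end

theory Submission
  imports Defs
begin

text \<open>
  Write \<open>z = x3\<close> and \<open>\<phi> = c - z\<close>, let \<open>{f, g}\<close> be the bracket of the standard structure, and let
  \<open>D\<^sub>i\<close> be the gradient fields of the three ambient coordinates. Two commuting fields carry the
  geometry: \<open>E = D\<^sub>3\<close>, the gradient of the height, and \<open>R = {_, z}\<close>, the rotation about the axis,
  which is the modular field. They span every tangent plane except at the poles, so after
  multiplication by \<open>1 - z\<^sup>2\<close> each field, divergence and bracket can be written with \<open>E\<close> and \<open>R\<close> alone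
  (\<open>derivation_decompose\<close>, \<open>S2_div_decompose\<close>, \<open>S2_bracket_decompose\<close>).

  A derivation of the smooth functions is a linear combination of the \<open>D\<^sub>i\<close> (\<open>derivation_eq\<close>), and
  a bivector field is a multiple of the standard structure (\<open>biderivation_eq\<close>). The complex therefore
  consists of functions, tangent fields and functions again; its first differential is
  \<open>f \<mapsto> \<phi> {f, _}\<close> and its second is the operator \<open>X \<mapsto> X z + \<phi> div X\<close>, called
  \<open>twisted_div\<close> below.

  Averaging over the rotations splits the smooth functions into the kernel of \<open>R\<close> and the image of \<open>R\<close>
  (\<open>rot_decomposition\<close>, \<open>rot_square_zero\<close>). The image of \<open>R\<close> contributes nothing to the cohomology:
  \<open>\<phi> R k\<close> is the twisted divergence of \<open>k R\<close>, the twisted divergence of \<open>u E\<close> is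
  \<open>(1 - z\<^sup>2) u\<close> modulo such terms, and \<open>\<phi>\<close> and \<open>1 - z\<^sup>2\<close> have no common zero because \<open>\<bar>c\<bar> < 1\<close>.

  For invariant functions the problem is an ordinary differential equation in the height. An invariant
  field has a height component \<open>G(z)\<close> that vanishes at \<open>z = 1\<close> and \<open>z = -1\<close>, and its twisted divergence
  is \<open>G + (c - z) G'\<close>. The image of \<open>G \<mapsto> G + (c - z) G'\<close> on all smooth \<open>G\<close> consists of the functions whose
  derivative vanishes at \<open>c\<close>, and its kernel is spanned by \<open>c - z\<close>. With one free constant and two
  boundary values, the cokernel becomes two-dimensional, spanned by \<open>\<phi>\<close> and \<open>1\<close>, and the kernel
  becomes zero. This gives the second cohomology (\<open>twisted_div_surjective\<close>, \<open>twisted_div_injective\<close>).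
  It also shows that a Poisson field has no invariant height component; such a field is a Hamiltonian
  field plus \<open>b(z) R\<close>, and \<open>b(z) R\<close> is Hamiltonian exactly when \<open>b\<close> vanishes on the circle
  \<open>z = c\<close>, where \<open>\<phi>\<close> does. This gives the first cohomology (\<open>twisted_div_kernel\<close>).

  The equation has to be solved by functions that are smooth on the sphere and not only in
  \<open>z\<close> between the poles. The three facts that achieve this are division by \<open>\<phi>\<close>
  (\<open>invariant_divide_height\<close>), integration in the height (\<open>invariant_primitive\<close>) and division by
  \<open>1 - z\<^sup>2\<close> (\<open>invariant_divide_poles\<close>).
\<close>

section \<open>Calculus of smooth functions on open sets\<close>

lemma Ck_on_cong:
  assumes "open U" "\<And>x. x \<in> U \<Longrightarrow> F x = G x"
  shows "Ck_on k F U \<longleftrightarrow> Ck_on k G U"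
  using assms(2)
proof (induction k arbitrary: F G)
  case 0
  then show ?case by (simp cong: continuous_on_cong)
next
  case (Suc k)
  have D: "(F has_derivative D) (at x) \<longleftrightarrow> (G has_derivative D) (at x)" if "x \<in> U" for D x
    using that Suc.prems has_derivative_transform_within_open [OF _ \<open>open U\<close> that] by metis
  then have "frechet_derivative F (at x) = frechet_derivative G (at x)" if "x \<in> U" for x
    using that by (simp add: frechet_derivative_def)
  moreover have "F differentiable_on U \<longleftrightarrow> G differentiable_on U"
    using D by (simp add: differentiable_on_eq_differentiable_at [OF \<open>open U\<close>] differentiable_def)
  ultimately show ?case using Suc.IH by (metis (no_types, lifting) Ck_on.simps(2))
qed

text \<open>Any explicitly known derivative may replace the one selected by \<open>frechet_derivative\<close>. The closure
  properties below are inductions on \<open>k\<close> that use this form.\<close>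

lemma Ck_on_Suc_iff:
  assumes "open U"
  shows "Ck_on (Suc k) F U \<longleftrightarrow>
    (\<exists>F'. (\<forall>x\<in>U. (F has_derivative F' x) (at x)) \<and> (\<forall>v. Ck_on k (\<lambda>x. F' x v) U))"
proof
  assume "Ck_on (Suc k) F U"
  then show "\<exists>F'. (\<forall>x\<in>U. (F has_derivative F' x) (at x)) \<and> (\<forall>v. Ck_on k (\<lambda>x. F' x v) U)"
    by (intro exI [of _ "\<lambda>x. frechet_derivative F (at x)"])
       (simp add: differentiable_on_eq_differentiable_at [OF assms] flip: frechet_derivative_works)
next
  assume "\<exists>F'. (\<forall>x\<in>U. (F has_derivative F' x) (at x)) \<and> (\<forall>v. Ck_on k (\<lambda>x. F' x v) U)"
  then obtain F' where d: "\<And>x. x \<in> U \<Longrightarrow> (F has_derivative F' x) (at x)"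
    and c: "\<And>v. Ck_on k (\<lambda>x. F' x v) U" by blast
  have "frechet_derivative F (at x) v = F' x v" if "x \<in> U" for x v
    using frechet_derivative_at [OF d [OF that]] by simp
  then have "Ck_on k (\<lambda>x. frechet_derivative F (at x) v) U" for v
    using c Ck_on_cong [OF assms, of "\<lambda>x. frechet_derivative F (at x) v" "\<lambda>x. F' x v"] by blast
  then show "Ck_on (Suc k) F U"
    using d by (auto simp: differentiable_on_eq_differentiable_at [OF assms] differentiable_def)
qed

lemma Ck_on_SucI:
  assumes "open U" "\<And>x. x \<in> U \<Longrightarrow> (F has_derivative F' x) (at x)"
    "\<And>v. Ck_on k (\<lambda>x. F' x v) U"
  shows "Ck_on (Suc k) F U"
  using Ck_on_Suc_iff [OF assms(1)] assms by blast

lemma Ck_on_SucE: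
  assumes "Ck_on (Suc k) F U" "open U"
  obtains F' where "\<And>x. x \<in> U \<Longrightarrow> (F has_derivative F' x) (at x)"
    "\<And>v. Ck_on k (\<lambda>x. F' x v) U"
  using assms Ck_on_Suc_iff by metis

lemma Ck_on_Suc_imp: "Ck_on (Suc k) F U \<Longrightarrow> Ck_on k F U"
  by (induction k arbitrary: F) (auto simp: differentiable_imp_continuous_on)

lemma Ck_on_add:
  assumes "open U" "Ck_on k F U" "Ck_on k G U"
  shows "Ck_on k (\<lambda>x. F x + G x) U"
  using assms(2,3)
proof (induction k arbitrary: F G)
  case 0
  then show ?case by (simp add: continuous_on_add)
next
  case (Suc k)
  obtain F' where F: "\<And>x. x \<in> U \<Longrightarrow> (F has_derivative F' x) (at x)" "\<And>v. Ck_on k (\<lambda>x. F' x v) U"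
    using Ck_on_SucE [OF Suc.prems(1) assms(1)] by metis
  obtain G' where G: "\<And>x. x \<in> U \<Longrightarrow> (G has_derivative G' x) (at x)" "\<And>v. Ck_on k (\<lambda>x. G' x v) U"
    using Ck_on_SucE [OF Suc.prems(2) assms(1)] by metis
  show ?case
    by (rule Ck_on_SucI [OF assms(1), where F' = "\<lambda>x v. F' x v + G' x v"])
       (auto intro: has_derivative_add F G Suc.IH)
qed

lemma Ck_on_mult:
  assumes "open U" "Ck_on k F U" "Ck_on k G U"
  shows "Ck_on k (\<lambda>x. F x * G x) U"
  using assms(2,3)
proof (induction k arbitrary: F G)
  case 0
  then show ?case by (simp add: continuous_on_mult)
next
  case (Suc k)
  obtain F' where F: "\<And>x. x \<in> U \<Longrightarrow> (F has_derivative F' x) (at x)" "\<And>v. Ck_on k (\<lambda>x. F' x v) U"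
    using Ck_on_SucE [OF Suc.prems(1) assms(1)] by metis
  obtain G' where G: "\<And>x. x \<in> U \<Longrightarrow> (G has_derivative G' x) (at x)" "\<And>v. Ck_on k (\<lambda>x. G' x v) U"
    using Ck_on_SucE [OF Suc.prems(2) assms(1)] by metis
  have "Ck_on k F U" "Ck_on k G U" using Suc.prems Ck_on_Suc_imp by blast+
  then have "Ck_on k (\<lambda>x. F x * G' x v + F' x v * G x) U" for v
    by (intro Ck_on_add [OF assms(1)] Suc.IH F G)
  then show ?case
    by (intro Ck_on_SucI [OF assms(1), where F' = "\<lambda>x v. F x * G' x v + F' x v * G x"]
        has_derivative_mult F G)
qed

lemma Ck_on_sum:
  assumes "open U" "\<And>i. i \<in> I \<Longrightarrow> Ck_on k (F i) U"
  shows "Ck_on k (\<lambda>x. \<Sum>i\<in>I. F i x) U"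
  using assms(2)
  by (induction I rule: infinite_finite_induct) (auto intro: Ck_on_add [OF assms(1)] Ck_on_const)

text \<open>The derivative of \<open>1 / F\<close> is a product of \<open>1 / F\<close>, \<open>1 / F\<close> and the derivative of \<open>F\<close>, so the induction
  hypothesis applies to the same function. The square root behaves in the same way.\<close>

lemma Ck_on_inverse:
  assumes "open U" "Ck_on k F U" "\<And>x. x \<in> U \<Longrightarrow> F x \<noteq> 0"
  shows "Ck_on k (\<lambda>x. inverse (F x)) U"
  using assms(2)
proof (induction k)
  case 0
  then show ?case using assms(3) by (simp add: continuous_on_inverse)
next
  case (Suc k)
  obtain F' where F: "\<And>x. x \<in> U \<Longrightarrow> (F has_derivative F' x) (at x)" "\<And>v. Ck_on k (\<lambda>x. F' x v) U"
    using Ck_on_SucE [OF Suc.prems(1) assms(1)] by metis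
  have i: "Ck_on k (\<lambda>x. inverse (F x)) U" using Suc Ck_on_Suc_imp by blast
  show ?case
  proof (rule Ck_on_SucI [OF assms(1)])
    fix x assume x: "x \<in> U"
    show "((\<lambda>x. inverse (F x)) has_derivative
            (\<lambda>v. (- 1) * (inverse (F x) * F' x v * inverse (F x)))) (at x)"
      using Deriv.has_derivative_inverse [OF assms(3) [OF x] F(1) [OF x]] by simp
  next
    show "Ck_on k (\<lambda>x. (- 1) * (inverse (F x) * F' x v * inverse (F x))) U" for v
      by (intro Ck_on_mult [OF assms(1)] Ck_on_const i F)
  qed
qed

lemma Ck_on_sqrt:
  assumes "open U" "Ck_on k F U" "\<And>x. x \<in> U \<Longrightarrow> F x > 0"
  shows "Ck_on k (\<lambda>x. sqrt (F x)) U"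
  using assms(2)
proof (induction k)
  case 0
  then show ?case by (simp add: continuous_on_real_sqrt)
next
  case (Suc k)
  obtain F' where F: "\<And>x. x \<in> U \<Longrightarrow> (F has_derivative F' x) (at x)" "\<And>v. Ck_on k (\<lambda>x. F' x v) U"
    using Ck_on_SucE [OF Suc.prems(1) assms(1)] by metis
  have i: "Ck_on k (\<lambda>x. inverse (sqrt (F x))) U"
    using Suc Ck_on_Suc_imp assms(3) by (intro Ck_on_inverse [OF assms(1)]) force+
  show ?case
  proof (rule Ck_on_SucI [OF assms(1)])
    fix x assume x: "x \<in> U"
    show "((\<lambda>x. sqrt (F x)) has_derivative (\<lambda>v. 1 / 2 * (inverse (sqrt (F x)) * F' x v))) (at x)"
      using assms(3) [OF x] by (auto intro!: derivative_eq_intros F(1) [OF x] simp: field_simps)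
  next
    show "Ck_on k (\<lambda>x. 1 / 2 * (inverse (sqrt (F x)) * F' x v)) U" for v
      by (intro Ck_on_mult [OF assms(1)] Ck_on_const i F)
  qed
qed

text \<open>By the chain rule, a derivative of the composite is a sum of products of a derivative of a component of
  \<open>G\<close> with the composite of a derivative of \<open>F\<close>; the latter is covered by the induction hypothesis for
  other \<open>F\<close>.\<close>

lemma Ck_on_compose:
  fixes G :: "'a::real_normed_vector \<Rightarrow> 'b::euclidean_space"
  assumes U: "open U" and V: "open V" and GV: "G ` U \<subseteq> V"
    and F: "Ck_on k F V" and G: "\<And>b. b \<in> Basis \<Longrightarrow> Ck_on k (\<lambda>x. G x \<bullet> b) U"
  shows "Ck_on k (\<lambda>x. F (G x)) U"
  using F G
proof (induction k arbitrary: F)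
  case 0
  then have "continuous_on U (\<lambda>x. G x)"
    by (subst continuous_on_componentwise) simp
  then show ?case using continuous_on_compose2 [of V F U G] 0 GV by simp
next
  case (Suc k)
  obtain F' where F: "\<And>x. x \<in> V \<Longrightarrow> (F has_derivative F' x) (at x)" "\<And>v. Ck_on k (\<lambda>x. F' x v) V"
    using Ck_on_SucE [OF Suc.prems(1) V] by metis
  have "\<exists>G'. (\<forall>x\<in>U. ((\<lambda>x. G x \<bullet> b) has_derivative G' x) (at x)) \<and> (\<forall>v. Ck_on k (\<lambda>x. G' x v) U)"
    if "b \<in> Basis" for b
    using Suc.prems(2) [OF that] Ck_on_Suc_iff [OF U] by blast
  then obtain G' where G: "\<And>b x. b \<in> Basis \<Longrightarrow> x \<in> U \<Longrightarrow> ((\<lambda>x. G x \<bullet> b) has_derivative G' b x) (at x)"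
      "\<And>b v. b \<in> Basis \<Longrightarrow> Ck_on k (\<lambda>x. G' b x v) U"
    by metis
  have Gd: "(G has_derivative (\<lambda>v. \<Sum>b\<in>Basis. G' b x v *\<^sub>R b)) (at x)" if "x \<in> U" for x
    using has_derivative_componentwise_within [of G "\<lambda>v. \<Sum>b\<in>Basis. G' b x v *\<^sub>R b" x UNIV] G(1) that
    by (simp cong: ball_cong)
  have IH: "Ck_on k (\<lambda>x. H (G x)) U" if "Ck_on k H V" for H
    using Suc.IH that Suc.prems(2) Ck_on_Suc_imp by blast
  show ?case
  proof (rule Ck_on_SucI [OF U])
    fix x assume x: "x \<in> U"
    then have Fx: "(F has_derivative F' (G x)) (at (G x))" using F(1) GV by blast
    have lin: "linear (F' (G x))" using Fx has_derivative_linear by blast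
    show "((\<lambda>x. F (G x)) has_derivative (\<lambda>v. \<Sum>b\<in>Basis. G' b x v * F' (G x) b)) (at x)"
      using has_derivative_compose [OF Gd [OF x] Fx] lin
      by (simp add: linear_sum linear_cmul)
  next
    show "Ck_on k (\<lambda>x. \<Sum>b\<in>Basis. G' b x v * F' (G x) b) U" for v
      by (intro Ck_on_sum [OF U] Ck_on_mult [OF U] G IH F)
  qed
qed

lemma Ck_on_local:
  assumes "open U" "\<And>x. x \<in> U \<Longrightarrow> \<exists>V. open V \<and> x \<in> V \<and> Ck_on k F V"
  shows "Ck_on k F U"
  using assms(2)
proof (induction k arbitrary: F)
  case 0
  then show ?case
    by (metis Ck_on.simps(1) assms(1) continuous_on_eq_continuous_at)
next
  case (Suc k)
  have "F differentiable (at x)" if "x \<in> U" for x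
    using Suc.prems [OF that] differentiable_on_eq_differentiable_at by auto
  moreover have "Ck_on k (\<lambda>x. frechet_derivative F (at x) v) U" for v
    by (intro Suc.IH) (metis Ck_on.simps(2) Suc.prems)
  ultimately show ?case by (simp add: differentiable_on_eq_differentiable_at [OF assms(1)])
qed

lemma Ck_on_subset: "Ck_on k F U \<Longrightarrow> V \<subseteq> U \<Longrightarrow> Ck_on k F V"
proof (induction k arbitrary: F)
  case 0
  then show ?case using continuous_on_subset by auto
next
  case (Suc k)
  then show ?case using differentiable_on_subset by auto
qed

subsection \<open>The class of smooth functions\<close>

lemma smooth_on_imp_open: "smooth_on F U \<Longrightarrow> open U"
  by (simp add: smooth_on_def)

lemma smooth_on_cong:
  assumes "\<And>x. x \<in> U \<Longrightarrow> F x = G x"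
  shows "smooth_on F U \<longleftrightarrow> smooth_on G U"
  using Ck_on_cong [of U F G] assms by (auto simp: smooth_on_def)

lemma smooth_on_has_derivative:
  assumes "smooth_on F U" "x \<in> U"
  shows "(F has_derivative frechet_derivative F (at x)) (at x)"
proof -
  have "Ck_on (Suc 0) F U" using assms(1) unfolding smooth_on_def by blast
  then show ?thesis
    using assms by (simp add: smooth_on_def differentiable_on_eq_differentiable_at flip: frechet_derivative_works)
qed

lemma smooth_on_derivative: "smooth_on F U \<Longrightarrow> smooth_on (\<lambda>x. frechet_derivative F (at x) v) U"
  unfolding smooth_on_def by (metis Ck_on.simps(2))

lemma smooth_on_imp_continuous_on: "smooth_on F U \<Longrightarrow> continuous_on U F"
  by (metis Ck_on.simps(1) smooth_on_def)

lemma smooth_on_const: "open U \<Longrightarrow> smooth_on (\<lambda>x. a) U"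
  by (simp add: smooth_on_def Ck_on_const)

lemma smooth_on_linear:
  assumes "bounded_linear F" "open U"
  shows "smooth_on F U"
proof -
  have "Ck_on k F U" for k
  proof (cases k)
    case 0
    then show ?thesis by (simp add: linear_continuous_on assms)
  next
    case (Suc j)
    then show ?thesis
      unfolding Suc
      by (intro Ck_on_SucI [OF assms(2) bounded_linear_imp_has_derivative [OF assms(1)]] Ck_on_const)
  qed
  then show ?thesis by (simp add: smooth_on_def assms)
qed

lemma smooth_on_ident: "open U \<Longrightarrow> smooth_on (\<lambda>x. x) U"
  by (simp add: smooth_on_linear)

lemma smooth_on_inner_const: "open U \<Longrightarrow> smooth_on (\<lambda>x. x \<bullet> b) U"
  by (simp add: smooth_on_linear bounded_linear_inner_left)

lemma smooth_on_add: "smooth_on F U \<Longrightarrow> smooth_on G U \<Longrightarrow> smooth_on (\<lambda>x. F x + G x) U"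
  by (simp add: smooth_on_def Ck_on_add)

lemma smooth_on_mult: "smooth_on F U \<Longrightarrow> smooth_on G U \<Longrightarrow> smooth_on (\<lambda>x. F x * G x) U"
  by (simp add: smooth_on_def Ck_on_mult)

lemma smooth_on_diff:
  assumes "smooth_on F U" "smooth_on G U"
  shows "smooth_on (\<lambda>x. F x - G x) U"
proof -
  have "smooth_on (\<lambda>x. F x + (- 1) * G x) U"
    by (intro smooth_on_add smooth_on_mult smooth_on_const assms smooth_on_imp_open [OF assms(1)])
  then show ?thesis by simp
qed

lemma smooth_on_power2: "smooth_on F U \<Longrightarrow> smooth_on (\<lambda>x. (F x)\<^sup>2) U"
  by (simp add: power2_eq_square smooth_on_mult)

lemma smooth_on_sum:
  "open U \<Longrightarrow> (\<And>i. i \<in> I \<Longrightarrow> smooth_on (F i) U) \<Longrightarrow> smooth_on (\<lambda>x. \<Sum>i\<in>I. F i x) U"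
  by (simp add: smooth_on_def Ck_on_sum)

lemma smooth_on_inverse:
  "smooth_on F U \<Longrightarrow> (\<And>x. x \<in> U \<Longrightarrow> F x \<noteq> 0) \<Longrightarrow> smooth_on (\<lambda>x. inverse (F x)) U"
  by (simp add: smooth_on_def Ck_on_inverse)

lemma smooth_on_divide:
  "smooth_on F U \<Longrightarrow> smooth_on G U \<Longrightarrow> (\<And>x. x \<in> U \<Longrightarrow> G x \<noteq> 0) \<Longrightarrow> smooth_on (\<lambda>x. F x / G x) U"
  by (simp add: divide_inverse smooth_on_mult smooth_on_inverse)

lemma smooth_on_sqrt:
  "smooth_on F U \<Longrightarrow> (\<And>x. x \<in> U \<Longrightarrow> F x > 0) \<Longrightarrow> smooth_on (\<lambda>x. sqrt (F x)) U"
  by (simp add: smooth_on_def Ck_on_sqrt)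

lemma smooth_on_norm:
  fixes U :: "'a::euclidean_space set"
  assumes "open U" "0 \<notin> U"
  shows "smooth_on norm U"
proof -
  have "smooth_on (\<lambda>x. sqrt (\<Sum>b\<in>Basis. (x \<bullet> b)\<^sup>2)) U"
    using assms
    by (intro smooth_on_sqrt smooth_on_sum smooth_on_power2 smooth_on_inner_const)
       (auto simp: power2_eq_square simp flip: euclidean_inner)
  moreover have "(\<lambda>x::'a. sqrt (\<Sum>b\<in>Basis. (x \<bullet> b)\<^sup>2)) = norm"
    by (simp add: fun_eq_iff norm_eq_sqrt_inner power2_eq_square flip: euclidean_inner)
  ultimately show ?thesis by simp
qed

lemma smooth_on_compose:
  fixes G :: "'a::real_normed_vector \<Rightarrow> 'b::euclidean_space"
  assumes "smooth_on F V" "open U" "\<And>x. x \<in> U \<Longrightarrow> G x \<in> V"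
    "\<And>b. b \<in> Basis \<Longrightarrow> smooth_on (\<lambda>x. G x \<bullet> b) U"
  shows "smooth_on (\<lambda>x. F (G x)) U"
  unfolding smooth_on_def
proof (intro conjI allI)
  fix k
  have "open V" "Ck_on k F V" using assms(1) by (simp_all add: smooth_on_def)
  moreover have "Ck_on k (\<lambda>x. G x \<bullet> b) U" if "b \<in> Basis" for b
    using assms(4) [OF that] by (simp add: smooth_on_def)
  moreover have "G ` U \<subseteq> V" using assms(3) by blast
  ultimately show "Ck_on k (\<lambda>x. F (G x)) U" using Ck_on_compose \<open>open U\<close> by blast
qed (rule assms(2))

lemma smooth_on_compose_real:
  fixes G :: "'a::real_normed_vector \<Rightarrow> real"
  assumes "smooth_on F V" "smooth_on G U" "\<And>x. x \<in> U \<Longrightarrow> G x \<in> V"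
  shows "smooth_on (\<lambda>x. F (G x)) U"
  using smooth_on_compose [OF assms(1) smooth_on_imp_open [OF assms(2)], of G] assms by simp

lemma smooth_on_local:
  assumes "open U" "\<And>x. x \<in> U \<Longrightarrow> \<exists>V. x \<in> V \<and> smooth_on F V"
  shows "smooth_on F U"
  unfolding smooth_on_def using assms(1) Ck_on_local [OF assms(1)] assms(2)
  by (metis smooth_on_def)

lemma smooth_on_subset: "smooth_on F U \<Longrightarrow> open V \<Longrightarrow> V \<subseteq> U \<Longrightarrow> smooth_on F V"
  unfolding smooth_on_def by (metis Ck_on_subset)

text \<open>A family of functions whose derivatives stay in the family is smooth. This suits functions given by
  one formula with a varying ingredient, such as an integral over a varying integrand.\<close>

lemma smooth_on_coinduct:
  assumes "F \<in> S" "open U"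
    and S: "\<And>G. G \<in> S \<Longrightarrow> \<exists>G'. (\<forall>x\<in>U. (G has_derivative G' x) (at x)) \<and> (\<forall>v. (\<lambda>x. G' x v) \<in> S)"
  shows "smooth_on F U"
proof -
  have "\<forall>F\<in>S. Ck_on k F U" for k
  proof (induction k)
    case 0
    show ?case
    proof
      fix F assume "F \<in> S"
      then have "isCont F x" if "x \<in> U" for x
        using S that has_derivative_continuous by metis
      then show "Ck_on 0 F U" by (simp add: continuous_at_imp_continuous_on)
    qed
  next
    case (Suc k)
    then show ?case using S Ck_on_Suc_iff [OF \<open>open U\<close>] by metis
  qed
  then show ?thesis using assms by (simp add: smooth_on_def)
qed

subsection \<open>Integrals depending smoothly on a parameter\<close>

text \<open>The library rule for differentiation under the integral asks for the derivative as a continuous map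
  into the bounded linear functions. It is assembled here from the partial derivatives in the directions
  of a basis.\<close>

lemma has_derivative_integral_parameter:
  fixes F :: "real \<times> 'a::euclidean_space \<Rightarrow> real"
  assumes F: "smooth_on F W" and V: "open V" and VW: "{a..b} \<times> V \<subseteq> W" and x0: "x0 \<in> V"
  shows "((\<lambda>x. integral {a..b} (\<lambda>t. F (t, x))) has_derivative
          (\<lambda>v. integral {a..b} (\<lambda>t. frechet_derivative F (at (t, x0)) (0, v)))) (at x0)"
proof -
  define D where "D = (\<lambda>p v. frechet_derivative F (at p) (0, v))"
  define B where "B = (\<lambda>x t. \<Sum>b\<in>Basis. D (t, x) b *\<^sub>R blinfun_inner_left (b::'a))"
  obtain e where e: "e > 0" "ball x0 e \<subseteq> V" using V x0 openE by blast
  have W: "(t, x) \<in> W" if "x \<in> ball x0 e" "t \<in> {a..b}" for x t using that e VW by blast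
  have Bapply: "blinfun_apply (B x t) v = D (t, x) v" if "x \<in> ball x0 e" "t \<in> {a..b}" for x t v
  proof -
    have "linear (D (t, x))"
      using has_derivative_linear [OF smooth_on_has_derivative [OF F W [OF that]]]
      unfolding D_def linear_iff by (metis add_Pair add.right_neutral scaleR_Pair scaleR_zero_right)
    then have "D (t, x) (\<Sum>b\<in>Basis. (v \<bullet> b) *\<^sub>R b) = (\<Sum>b\<in>Basis. (v \<bullet> b) * D (t, x) b)"
      by (simp add: linear_sum linear_cmul)
    then have "D (t, x) v = (\<Sum>b\<in>Basis. (v \<bullet> b) * D (t, x) b)"
      by (simp only: euclidean_representation)
    then show ?thesis
      by (simp add: B_def blinfun.sum_left blinfun.scaleR_left inner_commute mult.commute)
  qed
  have contF: "continuous_on W F" using F by (rule smooth_on_imp_continuous_on)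
  have cont: "continuous_on (ball x0 e \<times> cbox a b) (\<lambda>(x, t). B x t)"
  proof -
    have "continuous_on (ball x0 e \<times> cbox a b) (\<lambda>(x, t). D (t, x) v)" for v
    proof -
      have "continuous_on W (\<lambda>p. D p v)"
        unfolding D_def by (rule smooth_on_imp_continuous_on [OF smooth_on_derivative [OF F]])
      then have "continuous_on (ball x0 e \<times> cbox a b) (\<lambda>q. D (snd q, fst q) v)"
        by (rule continuous_on_compose2) (use W in \<open>auto intro!: continuous_intros\<close>)
      then show ?thesis by (simp add: split_def)
    qed
    then show ?thesis
      unfolding B_def split_def by (auto intro!: continuous_intros)
  qed
  have "((\<lambda>x. integral (cbox a b) (\<lambda>t. F (t, x))) has_derivative
           blinfun_apply (integral (cbox a b) (B x0))) (at x0 within ball x0 e)"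
  proof (rule leibniz_rule [OF _ _ cont])
    fix x t assume xt: "x \<in> ball x0 e" "t \<in> cbox a b"
    have "((\<lambda>x. (t, x)) has_derivative (\<lambda>v. (0, v))) (at x)"
      by (auto intro!: derivative_eq_intros)
    moreover have "(F has_derivative frechet_derivative F (at (t, x))) (at (t, x))"
      using smooth_on_has_derivative [OF F W] xt by simp
    ultimately have "((\<lambda>x. F (t, x)) has_derivative (\<lambda>v. D (t, x) v)) (at x)"
      unfolding D_def by (rule has_derivative_compose)
    moreover have "blinfun_apply (B x t) = D (t, x)" using Bapply xt by (simp add: fun_eq_iff)
    ultimately show "((\<lambda>x. F (t, x)) has_derivative blinfun_apply (B x t)) (at x within ball x0 e)"
      using has_derivative_at_withinI by simp
  next
    fix x assume x: "x \<in> ball x0 e"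
    show "(\<lambda>t. F (t, x)) integrable_on cbox a b"
      by (rule integrable_continuous, rule continuous_on_compose2 [OF contF])
         (use W x in \<open>auto intro!: continuous_intros\<close>)
  qed (use e in auto)
  moreover have "blinfun_apply (integral (cbox a b) (B x0)) v = integral {a..b} (\<lambda>t. D (t, x0) v)" for v
  proof -
    have "continuous_on (cbox a b) (\<lambda>t. (x0, t))" by (intro continuous_intros)
    moreover have "(\<lambda>t. (x0, t)) ` cbox a b \<subseteq> ball x0 e \<times> cbox a b" using e by force
    ultimately have "continuous_on (cbox a b) (\<lambda>t. B x0 t)"
      using continuous_on_compose2 [OF cont] by force
    then have "B x0 integrable_on cbox a b" by (rule integrable_continuous)
    then have "integral (cbox a b) ((\<lambda>f. blinfun_apply f v) \<circ> B x0) =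
        blinfun_apply (integral (cbox a b) (B x0)) v"
      by (rule integral_linear) (rule blinfun.bounded_linear_left)
    moreover have "integral (cbox a b) ((\<lambda>f. blinfun_apply f v) \<circ> B x0)
        = integral (cbox a b) (\<lambda>t. D (t, x0) v)"
      by (rule integral_cong) (use Bapply e in auto)
    ultimately show ?thesis by simp
  qed
  then have "blinfun_apply (integral (cbox a b) (B x0)) = (\<lambda>v. integral {a..b} (\<lambda>t. D (t, x0) v))"
    by (rule ext)
  ultimately show ?thesis
    using e at_within_open [of x0 "ball x0 e"] by (simp add: D_def)
qed

lemma smooth_on_integral_parameter:
  fixes F :: "real \<times> 'a::euclidean_space \<Rightarrow> real"
  assumes F: "smooth_on F W" and V: "open V" and VW: "{a..b} \<times> V \<subseteq> W"
  shows "smooth_on (\<lambda>x. integral {a..b} (\<lambda>t. F (t, x))) V"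
proof (rule smooth_on_coinduct [OF _ V])
  let ?S = "{\<lambda>x. integral {a..b} (\<lambda>t. F (t, x)) | F. smooth_on F W}"
  show "(\<lambda>x. integral {a..b} (\<lambda>t. F (t, x))) \<in> ?S" using F by blast
  fix G assume "G \<in> ?S"
  then obtain H where H: "smooth_on H W" "G = (\<lambda>x. integral {a..b} (\<lambda>t. H (t, x)))" by blast
  have "(\<lambda>x. integral {a..b} (\<lambda>t. frechet_derivative H (at (t, x)) (0, v))) \<in> ?S" for v
    using smooth_on_derivative [OF H(1)]
    by (intro CollectI exI [of _ "\<lambda>p. frechet_derivative H (at p) (0, v)"]) simp
  then show "\<exists>G'. (\<forall>x\<in>V. (G has_derivative G' x) (at x)) \<and> (\<forall>v. (\<lambda>x. G' x v) \<in> ?S)"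
    using has_derivative_integral_parameter [OF H(1) V VW] H(2)
    by (intro exI [of _ "\<lambda>x v. integral {a..b} (\<lambda>t. frechet_derivative H (at (t, x)) (0, v))"]) blast
qed

subsection \<open>A smooth function that is flat at the origin\<close>

text \<open>The quotients \<open>flat_exp t / t ^ n\<close> are closed under differentiation up to linear combinations. At
  \<open>t = 0\<close> they have the value \<open>0\<close> by convention, which is also their limit since the exponential decays faster
  than any power grows.\<close>

definition flat_exp :: "real \<Rightarrow> real" where
  "flat_exp t = (if t > 0 then exp (- (1 / t)) else 0)"

lemma flat_exp_has_derivative:
  "((\<lambda>t. flat_exp t / t ^ n) has_real_derivative
      flat_exp t / t ^ (n + 2) - n * (flat_exp t / t ^ (n + 1))) (at t)"
proof -
  consider "t > 0" | "t < 0" | "t = 0" by linarith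
  then show ?thesis
  proof cases
    case 1
    have "((\<lambda>t. exp (- (1 / t)) / t ^ n) has_real_derivative
        exp (- (1 / t)) / t ^ (n + 2) - n * (exp (- (1 / t)) / t ^ (n + 1))) (at t)"
    proof (cases n)
      case 0
      then show ?thesis
        using 1 by (auto intro!: derivative_eq_intros simp: field_simps power2_eq_square)
    next
      case (Suc m)
      have p: "t ^ (Suc m - Suc 0) = t ^ m" by simp
      show ?thesis
        unfolding Suc using 1
        by (auto intro!: derivative_eq_intros simp del: power_Suc diff_Suc_Suc simp: p)
           (simp add: field_simps power2_eq_square)
    qed
    then have "((\<lambda>t. flat_exp t / t ^ n) has_real_derivative
        exp (- (1 / t)) / t ^ (n + 2) - n * (exp (- (1 / t)) / t ^ (n + 1))) (at t)"
      by (rule DERIV_cong_ev [THEN iffD1, rotated -1, OF _ refl _ refl])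
         (use 1 in \<open>auto simp: flat_exp_def eventually_nhds intro!: exI [of _ "{0<..}"]\<close>)
    then show ?thesis using 1 by (simp add: flat_exp_def)
  next
    case 2
    have "((\<lambda>t::real. 0::real) has_real_derivative 0) (at t)" by simp
    then have "((\<lambda>t. flat_exp t / t ^ n) has_real_derivative 0) (at t)"
      by (rule DERIV_cong_ev [THEN iffD1, rotated -1, OF _ refl _ refl])
         (use 2 in \<open>auto simp: flat_exp_def eventually_nhds intro!: exI [of _ "{..<0}"]\<close>)
    then show ?thesis using 2 by (simp add: flat_exp_def)
  next
    case 3
    \<comment> \<open>the difference quotient at the origin; from the right substitute \<open>1 / t\<close>\<close>
    have "((\<lambda>t. flat_exp t / t ^ n / t) \<longlongrightarrow> 0) (at 0)"
    proof (rule filterlim_split_at)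
      have "filterlim (\<lambda>t::real. 1 / t) at_top (at_right 0)"
        using filterlim_inverse_at_top_right by (simp add: inverse_eq_divide)
      then have "((\<lambda>t. (1 / t) ^ (n + 1) / exp (1 / t)) \<longlongrightarrow> (0::real)) (at_right 0)"
        by (rule filterlim_compose [OF tendsto_power_div_exp_0])
      then show "((\<lambda>t. flat_exp t / t ^ n / t) \<longlongrightarrow> 0) (at_right 0)"
        by (rule Lim_transform_eventually)
           (auto simp: eventually_at_filter flat_exp_def exp_minus power_divide field_simps)
      show "((\<lambda>t. flat_exp t / t ^ n / t) \<longlongrightarrow> 0) (at_left 0)"
        by (rule Lim_transform_eventually [OF tendsto_const])
           (auto simp: eventually_at_filter flat_exp_def)
    qed
    then have "((\<lambda>h. (flat_exp (0 + h) / (0 + h) ^ n - flat_exp 0 / 0 ^ n) / h) \<longlongrightarrow> 0) (at 0)"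
      by (simp add: flat_exp_def)
    then have "((\<lambda>t. flat_exp t / t ^ n) has_real_derivative 0) (at 0)"
      by (simp only: DERIV_def)
    then show ?thesis using 3 by (simp add: flat_exp_def)
  qed
qed

lemma smooth_on_flat_exp: "smooth_on flat_exp UNIV"
proof -
  have "Ck_on k (\<lambda>t. flat_exp t / t ^ n) UNIV" for k n
  proof (induction k arbitrary: n)
    case 0
    show ?case
      using flat_exp_has_derivative [of n] DERIV_isCont
      by (auto intro!: continuous_at_imp_continuous_on)
  next
    case (Suc k)
    show ?case
    proof (rule Ck_on_SucI [OF open_UNIV])
      show "((\<lambda>t. flat_exp t / t ^ n) has_derivative
          (\<lambda>v. (flat_exp t / t ^ (n + 2) + (- n) * (flat_exp t / t ^ (n + 1))) * v)) (at t)" for t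
        using flat_exp_has_derivative [of n t] by (simp add: has_field_derivative_def)
      show "Ck_on k (\<lambda>t. (flat_exp t / t ^ (n + 2) + (- n) * (flat_exp t / t ^ (n + 1))) * v) UNIV" for v
        by (intro Ck_on_mult Ck_on_add Ck_on_const Suc.IH open_UNIV)
    qed
  qed
  from this [of _ 0] show ?thesis by (simp add: smooth_on_def)
qed

section \<open>Smooth functions on the sphere and the tangential gradient\<close>

lemma norm_Rep_S2 [simp]: "norm (Rep_S2 p) = 1"
  using Rep_S2 [of p] by simp

lemma Rep_S2_nonzero [simp]: "Rep_S2 p \<noteq> 0"
  using norm_Rep_S2 [of p] by (metis norm_zero zero_neq_one)

lemma inner_Rep_S2 [simp]: "Rep_S2 p \<bullet> Rep_S2 p = 1"
  by (simp add: dot_square_norm)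

lemma S2_coord_sq: "(S2_coord 1 p)\<^sup>2 + (S2_coord 2 p)\<^sup>2 + (S2_coord 3 p)\<^sup>2 = 1"
  using inner_Rep_S2 [of p] by (simp add: inner_vec_def sum_3 S2_coord_def power2_eq_square)

lemma Rep_Abs_normalize: "x \<noteq> 0 \<Longrightarrow> Rep_S2 (Abs_S2 (x /\<^sub>R norm x)) = x /\<^sub>R norm x"
  by (simp add: Abs_S2_inverse)

lemma S2_extend_Rep [simp]: "S2_extend f (Rep_S2 p) = f p"
  by (simp add: S2_extend_def Rep_S2_inverse)

text \<open>Composing the local extensions with the radial projection turns them into one global extension, which
  is homogeneous of degree zero. It makes every smooth function on the sphere a smooth function on the
  complement of the origin.\<close>

lemma smooth_on_S2_extend:
  assumes "f \<in> smooth_S2"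
  shows "smooth_on (S2_extend f) (- {0})"
proof (rule smooth_on_local)
  show "open (- {0::real^3})" by auto
  fix x0 :: "real^3" assume x0: "x0 \<in> - {0}"
  define r where "r = (\<lambda>x::real^3. x /\<^sub>R norm x)"
  obtain U F where U: "Rep_S2 (Abs_S2 (r x0)) \<in> U" and F: "smooth_on F U"
    and eq: "\<And>q. Rep_S2 q \<in> U \<Longrightarrow> f q = F (Rep_S2 q)"
    using assms by (auto simp: smooth_S2_def) metis
  define V where "V = {x \<in> - {0}. r x \<in> U}"
  have "continuous_on (- {0}) r"
    unfolding r_def by (intro continuous_intros) auto
  then have V: "open V"
    using continuous_open_preimage [of "- {0}" r U] smooth_on_imp_open [OF F]
    by (auto simp: V_def Int_def vimage_def)
  have rb: "smooth_on (\<lambda>x. r x \<bullet> b) V" for b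
  proof -
    have "smooth_on (\<lambda>x. inverse (norm x) * (x \<bullet> b)) V"
      using V by (intro smooth_on_mult smooth_on_inverse smooth_on_norm smooth_on_inner_const)
        (auto simp: V_def)
    then show ?thesis by (simp add: r_def)
  qed
  have "smooth_on (\<lambda>x. F (r x)) V"
    by (rule smooth_on_compose [OF F V _ rb]) (simp add: V_def)
  moreover have "F (r x) = S2_extend f x" if "x \<in> V" for x
    using that eq [of "Abs_S2 (r x)"] Rep_Abs_normalize [of x] by (simp add: V_def S2_extend_def r_def)
  ultimately have "smooth_on (S2_extend f) V"
    using smooth_on_cong [of V "\<lambda>x. F (r x)" "S2_extend f"] by simp
  moreover have "x0 \<in> V"
    using U x0 Rep_Abs_normalize [of x0] by (simp add: V_def r_def)
  ultimately show "\<exists>V. x0 \<in> V \<and> smooth_on (S2_extend f) V" by blast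
qed

lemma smooth_S2I:
  assumes "smooth_on F U" "\<And>q. Rep_S2 q \<in> U" "\<And>q. f q = F (Rep_S2 q)"
  shows "f \<in> smooth_S2"
  using assms by (auto simp: smooth_S2_def)

lemma smooth_S2_const [simp]: "(\<lambda>p. a) \<in> smooth_S2"
  by (rule smooth_S2I [of "\<lambda>x. a" UNIV]) (simp_all add: smooth_on_const)

lemma smooth_S2_one [simp]: "1 \<in> smooth_S2"
  using smooth_S2_const [of 1] by (simp add: one_fun_def)

lemma smooth_S2_zero [simp]: "0 \<in> smooth_S2"
  using smooth_S2_const [of 0] by (simp add: zero_fun_def)

lemma smooth_S2_add [simp]: "f \<in> smooth_S2 \<Longrightarrow> g \<in> smooth_S2 \<Longrightarrow> f + g \<in> smooth_S2"
  by (rule smooth_S2I [OF smooth_on_add [OF smooth_on_S2_extend smooth_on_S2_extend]]) auto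

lemma smooth_S2_mult [simp]: "f \<in> smooth_S2 \<Longrightarrow> g \<in> smooth_S2 \<Longrightarrow> f * g \<in> smooth_S2"
  by (rule smooth_S2I [OF smooth_on_mult [OF smooth_on_S2_extend smooth_on_S2_extend]]) auto

lemma smooth_S2_diff [simp]: "f \<in> smooth_S2 \<Longrightarrow> g \<in> smooth_S2 \<Longrightarrow> f - g \<in> smooth_S2"
  by (rule smooth_S2I [OF smooth_on_diff [OF smooth_on_S2_extend smooth_on_S2_extend]]) auto

lemma smooth_S2_uminus [simp]: "f \<in> smooth_S2 \<Longrightarrow> - f \<in> smooth_S2"
  using smooth_S2_diff [of 0 f] by simp

lemma smooth_S2_scale [simp]: "f \<in> smooth_S2 \<Longrightarrow> (\<lambda>p. a * f p) \<in> smooth_S2"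
  using smooth_S2_mult [of "\<lambda>p. a" f] by (simp add: times_fun_def)

lemmas S2_coord_smooth [simp]

subsection \<open>Partial derivatives of the homogeneous extension\<close>

text \<open>The gradient of the homogeneous extension is the tangential gradient, so \<open>S2_D i\<close> is the gradient field
  of the \<open>i\<close>-th coordinate function, regarded as a derivation.\<close>

definition S2_D :: "3 \<Rightarrow> (S2 \<Rightarrow> real) \<Rightarrow> S2 \<Rightarrow> real" where
  "S2_D i f p = S2_grad f p $ i"

lemma S2_D_eq: "S2_D i f p = frechet_derivative (S2_extend f) (at (Rep_S2 p)) (axis i 1)"
  by (simp add: S2_D_def S2_grad_def)

lemma S2_D_smooth [simp]:
  assumes "f \<in> smooth_S2"
  shows "S2_D i f \<in> smooth_S2"
  by (rule smooth_S2I [OF smooth_on_derivative [OF smooth_on_S2_extend [OF assms]]])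
     (auto simp: S2_D_eq)

lemma S2_extend_has_derivative:
  assumes "f \<in> smooth_S2"
  shows "(S2_extend f has_derivative (\<lambda>v. S2_grad f p \<bullet> v)) (at (Rep_S2 p))"
proof -
  have d: "(S2_extend f has_derivative frechet_derivative (S2_extend f) (at (Rep_S2 p))) (at (Rep_S2 p))"
    by (rule smooth_on_has_derivative [OF smooth_on_S2_extend [OF assms]]) simp
  then have lin: "linear (frechet_derivative (S2_extend f) (at (Rep_S2 p)))"
    using has_derivative_linear by blast
  have "frechet_derivative (S2_extend f) (at (Rep_S2 p)) v = S2_grad f p \<bullet> v" for v
  proof -
    have "frechet_derivative (S2_extend f) (at (Rep_S2 p)) v
        = frechet_derivative (S2_extend f) (at (Rep_S2 p)) (\<Sum>i\<in>UNIV. v $ i *\<^sub>R axis i 1)"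
      by (simp add: basis_expansion scalar_mult_eq_scaleR [symmetric])
    also have "\<dots> = S2_grad f p \<bullet> v"
      using lin by (simp add: linear_sum linear_cmul S2_grad_def inner_vec_def mult.commute)
    finally show ?thesis .
  qed
  then have "frechet_derivative (S2_extend f) (at (Rep_S2 p)) = (\<lambda>v. S2_grad f p \<bullet> v)" by (rule ext)
  then show ?thesis using d by simp
qed

lemma S2_grad_eqI:
  assumes "(S2_extend f has_derivative (\<lambda>v. w \<bullet> v)) (at (Rep_S2 p))"
  shows "S2_grad f p = w"
  using frechet_derivative_at [OF assms, symmetric]
  by (simp add: S2_grad_def vec_eq_iff inner_axis)

lemma S2_grad_add:
  assumes "f \<in> smooth_S2" "g \<in> smooth_S2"
  shows "S2_grad (f + g) p = S2_grad f p + S2_grad g p"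
proof (rule S2_grad_eqI)
  have "S2_extend (f + g) = (\<lambda>x. S2_extend f x + S2_extend g x)"
    by (simp add: S2_extend_def fun_eq_iff)
  then show "(S2_extend (f + g) has_derivative (\<bullet>) (S2_grad f p + S2_grad g p)) (at (Rep_S2 p))"
    using has_derivative_add [OF S2_extend_has_derivative [OF assms(1)] S2_extend_has_derivative [OF assms(2)]]
    by (simp add: inner_add_left [abs_def])
qed

lemma S2_grad_mult:
  assumes "f \<in> smooth_S2" "g \<in> smooth_S2"
  shows "S2_grad (f * g) p = f p *\<^sub>R S2_grad g p + g p *\<^sub>R S2_grad f p"
proof (rule S2_grad_eqI)
  have "S2_extend (f * g) = (\<lambda>x. S2_extend f x * S2_extend g x)"
    by (simp add: S2_extend_def fun_eq_iff)
  then show "(S2_extend (f * g) has_derivative (\<bullet>) (f p *\<^sub>R S2_grad g p + g p *\<^sub>R S2_grad f p))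
      (at (Rep_S2 p))"
    using has_derivative_mult [OF S2_extend_has_derivative [OF assms(1)] S2_extend_has_derivative [OF assms(2)]]
    by (simp add: inner_add_left [abs_def] mult.commute)
qed

lemma S2_grad_const: "S2_grad (\<lambda>p. a) p = 0"
proof (rule S2_grad_eqI)
  have "S2_extend (\<lambda>p. a) = (\<lambda>x. a)" by (simp add: S2_extend_def fun_eq_iff)
  then show "(S2_extend (\<lambda>p. a) has_derivative (\<bullet>) 0) (at (Rep_S2 p))"
    by (simp add: inner_zero_left [abs_def])
qed

lemma S2_D_add [simp]: "f \<in> smooth_S2 \<Longrightarrow> g \<in> smooth_S2 \<Longrightarrow> S2_D i (f + g) = S2_D i f + S2_D i g"
  by (simp add: fun_eq_iff S2_D_def S2_grad_add)

lemma S2_D_mult [simp]: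
  "f \<in> smooth_S2 \<Longrightarrow> g \<in> smooth_S2 \<Longrightarrow> S2_D i (f * g) = f * S2_D i g + g * S2_D i f"
  by (simp add: fun_eq_iff S2_D_def S2_grad_mult)

lemma S2_D_const [simp]: "S2_D i (\<lambda>p. a) = 0"
  by (simp add: fun_eq_iff S2_D_def S2_grad_const)

lemma S2_D_scale [simp]: "f \<in> smooth_S2 \<Longrightarrow> S2_D i (\<lambda>p. a * f p) = (\<lambda>p. a * S2_D i f p)"
  using S2_D_mult [of "\<lambda>p. a" f i] by (simp add: fun_eq_iff times_fun_def)

lemma S2_D_uminus [simp]: "f \<in> smooth_S2 \<Longrightarrow> S2_D i (- f) = - S2_D i f"
  using S2_D_scale [of f i "- 1"] by (simp add: fun_Compl_def)

lemma S2_D_diff [simp]: "f \<in> smooth_S2 \<Longrightarrow> g \<in> smooth_S2 \<Longrightarrow> S2_D i (f - g) = S2_D i f - S2_D i g"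
  using S2_D_add [of f "- g" i] by simp

lemma S2_D_one [simp]: "S2_D i 1 = 0" and S2_D_zero [simp]: "S2_D i 0 = 0"
  using S2_D_const [of i 1] S2_D_const [of i 0] by (simp_all add: one_fun_def zero_fun_def)

lemma S2_D_coord: "S2_D i (S2_coord j) = (\<lambda>p. (if i = j then 1 else 0) - S2_coord i p * S2_coord j p)"
  by (auto simp: fun_eq_iff S2_D_def S2_grad_coord S2_coord_def axis_def)

lemma S2_chain_rule:
  assumes f: "f \<in> smooth_S2" and g: "\<And>t. Rep_S2 (g t) = \<gamma> t"
    and d: "(\<gamma> has_vector_derivative v) (at t)"
  shows "((\<lambda>t. f (g t)) has_real_derivative S2_grad f (g t) \<bullet> v) (at t)"
proof -
  have "(S2_extend f has_derivative (\<lambda>v. S2_grad f (g t) \<bullet> v)) (at (\<gamma> t))"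
    using S2_extend_has_derivative [OF f, of "g t"] by (simp add: g)
  with d have "((\<lambda>t. S2_extend f (\<gamma> t)) has_derivative (\<lambda>s. S2_grad f (g t) \<bullet> (s *\<^sub>R v))) (at t)"
    unfolding has_vector_derivative_def by (rule has_derivative_compose)
  then show ?thesis
    by (simp add: has_field_derivative_def g [symmetric] mult_commute_abs)
qed

lemma S2_grad_tangent: 
  assumes f: "f \<in> smooth_S2"
  shows "S2_grad f p \<bullet> Rep_S2 p = 0"
proof -
  have "((\<lambda>t. t *\<^sub>R Rep_S2 p) has_derivative (\<lambda>s. s *\<^sub>R Rep_S2 p)) (at 1)"
    by (auto intro!: derivative_eq_intros)
  moreover have "(S2_extend f has_derivative (\<lambda>v. S2_grad f p \<bullet> v)) (at (1 *\<^sub>R Rep_S2 p))"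
    using S2_extend_has_derivative [OF f] by simp
  ultimately have "((\<lambda>t. S2_extend f (t *\<^sub>R Rep_S2 p)) has_derivative (\<lambda>s. S2_grad f p \<bullet> (s *\<^sub>R Rep_S2 p))) (at 1)"
    by (rule has_derivative_compose)
  moreover have "S2_extend f (t *\<^sub>R Rep_S2 p) = f p" if "t \<in> {0<..}" for t
    using that by (simp add: S2_extend_def Rep_S2_inverse)
  then have "((\<lambda>t. S2_extend f (t *\<^sub>R Rep_S2 p)) has_derivative (\<lambda>s. 0)) (at 1)"
    by (intro has_derivative_transform_within_open [OF has_derivative_const, where s = "{0<..}"]) auto
  ultimately have "(\<lambda>s. S2_grad f p \<bullet> (s *\<^sub>R Rep_S2 p)) = (\<lambda>s::real. 0)"
    by (rule has_derivative_unique)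
  from fun_cong [OF this, of 1] show ?thesis by simp
qed

lemma S2_D_tangent:
  assumes f: "f \<in> smooth_S2"
  shows "S2_coord 1 p * S2_D 1 f p + S2_coord 2 p * S2_D 2 f p + S2_coord 3 p * S2_D 3 f p = 0"
  using S2_grad_tangent [OF assms, of p]
  by (simp add: inner_vec_def sum_3 S2_D_def S2_coord_def mult.commute)

subsection \<open>Derivations are determined by their values on the coordinates\<close>

definition derivation :: "((S2 \<Rightarrow> real) \<Rightarrow> S2 \<Rightarrow> real) \<Rightarrow> bool" where
  "derivation X \<longleftrightarrow> (\<forall>f\<in>smooth_S2. X f \<in> smooth_S2) \<and>
     (\<forall>f\<in>smooth_S2. \<forall>g\<in>smooth_S2. X (f + g) = X f + X g \<and> X (f * g) = f * X g + g * X f \<and>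
        (\<forall>a. X (\<lambda>p. a * f p) = (\<lambda>p. a * X f p)))"

lemma derivation_S2_D: "derivation (S2_D i)"
  by (simp add: derivation_def)

lemma derivation_const:
  assumes "derivation X"
  shows "X (\<lambda>p. a) = 0"
proof -
  have "X (1 * 1) = 1 * X 1 + 1 * X 1"
    using assms smooth_S2_one unfolding derivation_def by blast
  then have "X 1 = 0" by simp
  moreover have "X (\<lambda>p. a * 1 p) = (\<lambda>p. a * X 1 p)"
    using assms smooth_S2_one unfolding derivation_def by blast
  ultimately show ?thesis by (simp add: zero_fun_def)
qed

text \<open>Integrating the derivative of the homogeneous extension along the segment from \<open>p\<close> to \<open>q\<close> gives the
  coefficients. The segment avoids the origin only if \<open>q\<close> is not antipodal to \<open>p\<close>, so everything is multiplied
  by a cutoff \<open>\<beta>\<close> that vanishes outside a cap around \<open>p\<close>.\<close>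

lemma S2_hadamard:
  assumes f: "f \<in> smooth_S2"
  obtains \<beta> h where "\<beta> \<in> smooth_S2" "\<beta> p \<noteq> 0" "\<And>i::3. h i \<in> smooth_S2"
    "\<And>i. h i p = \<beta> p * S2_D i f p"
    "\<And>q. \<beta> q * (f q - f p) = (\<Sum>i\<in>UNIV. (S2_coord i q - S2_coord i p) * h i q)"
proof -
  define P where "P = Rep_S2 p"
  define F where "F = S2_extend f"
  have F: "smooth_on F (- {0})" unfolding F_def by (rule smooth_on_S2_extend [OF f])
  define \<gamma> where "\<gamma> = (\<lambda>z::real \<times> (real^3). P + fst z *\<^sub>R (snd z - P))"
  \<comment> \<open>the parameters at which the segment runs in the open half space around \<open>p\<close>\<close>
  define W where "W = {z. 0 < P \<bullet> \<gamma> z}"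
  define V where "V = {x. 0 < P \<bullet> x}"
  define g where "g = (\<lambda>i x. integral {0..1} (\<lambda>t. frechet_derivative F (at (\<gamma> (t, x))) (axis i 1)))"
  define \<beta> where "\<beta> = (\<lambda>x. flat_exp (P \<bullet> x - 1 / 2))"
  have PP: "P \<bullet> P = 1" by (simp add: P_def)
  have W: "open W" unfolding W_def \<gamma>_def by (intro open_Collect_less continuous_intros)
  have V: "open V" unfolding V_def by (intro open_Collect_less continuous_intros)
  have VW: "{0..1} \<times> V \<subseteq> W"
  proof clarify
    fix t :: real and x assume t: "t \<in> {0..1}" and x: "x \<in> V"
    have "P \<bullet> \<gamma> (t, x) = (1 - t) + t * (P \<bullet> x)"
      by (simp add: \<gamma>_def inner_add_right inner_diff_right PP algebra_simps)
    also have "\<dots> > 0"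
      using t x by (cases "t = 0") (auto simp: V_def intro!: add_nonneg_pos mult_pos_pos)
    finally show "(t, x) \<in> W" by (simp add: W_def)
  qed
  have nz: "\<gamma> z \<in> - {0}" if "z \<in> W" for z using that by (auto simp: W_def)
  have \<gamma>b: "smooth_on (\<lambda>z. \<gamma> z \<bullet> b) W" for b
  proof -
    have "smooth_on (\<lambda>z. P \<bullet> b + fst z * (snd z \<bullet> b - P \<bullet> b)) W"
      using W by (intro smooth_on_add smooth_on_mult smooth_on_diff smooth_on_const smooth_on_linear
          bounded_linear_fst bounded_linear_compose [OF bounded_linear_inner_left bounded_linear_snd])
    then show ?thesis by (simp add: \<gamma>_def inner_add_left inner_diff_left)
  qed
  have gs: "smooth_on (g i) V" for i
    unfolding g_def
    by (rule smooth_on_integral_parameter [OF _ V VW, where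
          F = "\<lambda>z. frechet_derivative F (at (\<gamma> z)) (axis i 1)"])
       (rule smooth_on_compose [OF smooth_on_derivative [OF F] W nz \<gamma>b])
  have \<beta>s: "smooth_on \<beta> UNIV"
    unfolding \<beta>_def
    by (rule smooth_on_compose_real [OF smooth_on_flat_exp, where G = "\<lambda>x. P \<bullet> x - 1 / 2"])
       (auto intro: smooth_on_diff [OF smooth_on_linear [OF bounded_linear_inner_right] smooth_on_const])
  have taylor: "F x - F P = (\<Sum>i\<in>UNIV. (x $ i - P $ i) * g i x)" if x: "x \<in> V" for x
  proof -
    let ?D = "\<lambda>t i. frechet_derivative F (at (\<gamma> (t, x))) (axis i 1)"
    have inW: "(t, x) \<in> W" if "t \<in> {0..1}" for t using VW x that by blast
    have "((\<lambda>t. \<Sum>i\<in>UNIV. (x $ i - P $ i) * ?D t i) has_integral (F (\<gamma> (1, x)) - F (\<gamma> (0, x)))) {0..1}"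
    proof (rule fundamental_theorem_of_calculus)
      fix t :: real assume t: "t \<in> {0..1}"
      let ?d = "frechet_derivative F (at (\<gamma> (t, x)))"
      have dF: "(F has_derivative ?d) (at (\<gamma> (t, x)))"
        by (rule smooth_on_has_derivative [OF F nz [OF inW [OF t]]])
      then have lin: "linear ?d" by (rule has_derivative_linear)
      have "((\<lambda>t. \<gamma> (t, x)) has_derivative (\<lambda>s. s *\<^sub>R (x - P))) (at t)"
        unfolding \<gamma>_def by (auto intro!: derivative_eq_intros)
      from has_derivative_compose [OF this dF]
      have "((\<lambda>t. F (\<gamma> (t, x))) has_derivative (\<lambda>s. s *\<^sub>R ?d (x - P))) (at t)"
        using lin by (simp add: linear_cmul)
      moreover have "?d (x - P) = (\<Sum>i\<in>UNIV. (x $ i - P $ i) * ?D t i)"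
      proof -
        have "?d (x - P) = ?d (\<Sum>i\<in>UNIV. (x - P) $ i *\<^sub>R axis i 1)"
          by (simp only: basis_expansion scalar_mult_eq_scaleR [symmetric])
        then show ?thesis using lin by (simp add: linear_sum linear_cmul)
      qed
      ultimately have "((\<lambda>t. F (\<gamma> (t, x))) has_vector_derivative (\<Sum>i\<in>UNIV. (x $ i - P $ i) * ?D t i)) (at t)"
        by (simp add: has_vector_derivative_def)
      then show "((\<lambda>t. F (\<gamma> (t, x))) has_vector_derivative (\<Sum>i\<in>UNIV. (x $ i - P $ i) * ?D t i))
          (at t within {0..1})"
        by (rule has_vector_derivative_at_within)
    qed simp
    moreover have "(\<lambda>t. ?D t i) integrable_on {0..1}" for i
    proof -
      have "continuous_on W (\<lambda>z. frechet_derivative F (at (\<gamma> z)) (axis i 1))"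
        by (rule smooth_on_imp_continuous_on,
            rule smooth_on_compose [OF smooth_on_derivative [OF F] W nz \<gamma>b])
      moreover have "continuous_on {0..1} (\<lambda>t. (t, x))" by (intro continuous_intros)
      ultimately have "continuous_on {0..1} (\<lambda>t. ?D t i)"
        by (rule continuous_on_compose2) (use inW in auto)
      then show ?thesis by (rule integrable_continuous_interval)
    qed
    then have "((\<lambda>t. \<Sum>i\<in>UNIV. (x $ i - P $ i) * ?D t i) has_integral
        (\<Sum>i\<in>UNIV. (x $ i - P $ i) * g i x)) {0..1}"
      unfolding g_def by (intro has_integral_sum has_integral_mult_right integrable_integral) auto
    ultimately have "F (\<gamma> (1, x)) - F (\<gamma> (0, x)) = (\<Sum>i\<in>UNIV. (x $ i - P $ i) * g i x)"
      by (rule has_integral_unique)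
    then show ?thesis by (simp add: \<gamma>_def)
  qed
  define h where "h = (\<lambda>i q. \<beta> (Rep_S2 q) * (if P \<bullet> Rep_S2 q > 0 then g i (Rep_S2 q) else 0))"
  have \<beta>0: "\<beta> x = 0" if "P \<bullet> x < 1 / 2" for x
    using that by (simp add: \<beta>_def flat_exp_def)
  have hs: "h i \<in> smooth_S2" for i
    unfolding smooth_S2_def
  proof (intro CollectI allI)
    fix q
    show "\<exists>U G. Rep_S2 q \<in> U \<and> smooth_on G U \<and> (\<forall>r. Rep_S2 r \<in> U \<longrightarrow> h i r = G (Rep_S2 r))"
    proof (cases "P \<bullet> Rep_S2 q > 0")
      case True
      have "smooth_on (\<lambda>x. \<beta> x * g i x) V"
        by (intro smooth_on_mult gs smooth_on_subset [OF \<beta>s V]) auto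
      then show ?thesis
        using True by (intro exI [of _ V] exI [of _ "\<lambda>x. \<beta> x * g i x"]) (auto simp: V_def h_def)
    next
      case False
      have "open {x. P \<bullet> x < 1 / 2}" by (intro open_Collect_less continuous_intros)
      then show ?thesis
        using False \<beta>0
        by (intro exI [of _ "{x. P \<bullet> x < 1 / 2}"] exI [of _ "\<lambda>x. 0"])
           (auto simp: h_def intro: smooth_on_const)
    qed
  qed
  show thesis
  proof (rule that [of "\<lambda>q. \<beta> (Rep_S2 q)" h])
    show "(\<lambda>q. \<beta> (Rep_S2 q)) \<in> smooth_S2" by (rule smooth_S2I [OF \<beta>s]) auto
    show "\<beta> (Rep_S2 p) \<noteq> 0" by (simp add: \<beta>_def P_def flat_exp_def)
    show "h i \<in> smooth_S2" for i by (rule hs)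
    show "h i p = \<beta> (Rep_S2 p) * S2_D i f p" for i
      by (simp add: h_def P_def g_def \<gamma>_def S2_D_eq F_def)
    show "\<beta> (Rep_S2 q) * (f q - f p) = (\<Sum>i\<in>UNIV. (S2_coord i q - S2_coord i p) * h i q)" for q
    proof (cases "P \<bullet> Rep_S2 q > 0")
      case True
      then have "f q - f p = (\<Sum>i\<in>UNIV. (S2_coord i q - S2_coord i p) * g i (Rep_S2 q))"
        using taylor [of "Rep_S2 q"] by (simp add: V_def F_def P_def S2_coord_def)
      then show ?thesis using True by (simp add: h_def sum_distrib_left mult.left_commute)
    next
      case False
      then have "\<beta> (Rep_S2 q) = 0" using \<beta>0 by simp
      then show ?thesis by (simp add: h_def)
    qed
  qed
qed

text \<open>Apply \<open>X\<close> to both sides of the formula of \<open>S2_hadamard\<close> and evaluate at \<open>p\<close>: all terms in which \<open>X\<close> does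
  not hit the factor vanishing at \<open>p\<close> drop out, and \<open>\<beta> p\<close> cancels. As a consequence, identities between
  derivations need to be checked on the three coordinates only.\<close>

theorem derivation_eq:
  assumes X: "derivation X" and f: "f \<in> smooth_S2"
  shows "X f = (\<lambda>p. \<Sum>i\<in>UNIV. X (S2_coord i) p * S2_D i f p)"
proof
  fix p
  obtain \<beta> h where \<beta>: "\<beta> \<in> smooth_S2" "\<beta> p \<noteq> 0" and h: "\<And>i::3. h i \<in> smooth_S2"
    and hp: "\<And>i. h i p = \<beta> p * S2_D i f p"
    and eq: "\<And>q. \<beta> q * (f q - f p) = (\<Sum>i\<in>UNIV. (S2_coord i q - S2_coord i p) * h i q)"
    by (rule S2_hadamard [OF f, of p], rule that)
  have add: "X (u + v) = X u + X v" and mult: "X (u * v) = u * X v + v * X u"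
    if "u \<in> smooth_S2" "v \<in> smooth_S2" for u v
    using X that unfolding derivation_def by blast+
  have X0: "X (u - (\<lambda>q. a)) = X u" if "u \<in> smooth_S2" for u a
    using add [of u "\<lambda>q. - a"] that derivation_const [OF X, of "- a"]
    by (simp add: plus_fun_def fun_diff_def zero_fun_def)
  have "\<beta> * (f - (\<lambda>q. f p)) = (S2_coord 1 - (\<lambda>q. S2_coord 1 p)) * h 1
      + (S2_coord 2 - (\<lambda>q. S2_coord 2 p)) * h 2 + (S2_coord 3 - (\<lambda>q. S2_coord 3 p)) * h 3"
    by (simp add: fun_eq_iff eq sum_3)
  then have "X (\<beta> * (f - (\<lambda>q. f p))) p = X ((S2_coord 1 - (\<lambda>q. S2_coord 1 p)) * h 1
      + (S2_coord 2 - (\<lambda>q. S2_coord 2 p)) * h 2 + (S2_coord 3 - (\<lambda>q. S2_coord 3 p)) * h 3) p"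
    by simp
  then have "\<beta> p * X f p = X (S2_coord 1) p * h 1 p + X (S2_coord 2) p * h 2 p + X (S2_coord 3) p * h 3 p"
    using \<beta> f h by (simp add: add mult X0 mult.commute)
  then have "\<beta> p * X f p = \<beta> p * (\<Sum>i\<in>UNIV. X (S2_coord i) p * S2_D i f p)"
    by (simp add: hp sum_3 algebra_simps)
  then show "X f p = (\<Sum>i\<in>UNIV. X (S2_coord i) p * S2_D i f p)" using \<beta>(2) by simp
qed

text \<open>The homogeneous extension then has derivative zero on the complement of the origin, which is connected.\<close>

lemma S2_D_zero_imp_const:
  assumes f: "f \<in> smooth_S2" and D: "\<And>i. S2_D i f = 0"
  shows "f p = f q"
proof -
  have der: "(S2_extend f has_derivative (\<lambda>v. 0)) (at x)" if "x \<in> - {0}" for x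
  proof -
    define q where "q = Abs_S2 (x /\<^sub>R norm x)"
    have q: "Rep_S2 q = x /\<^sub>R norm x" using that by (simp add: q_def Rep_Abs_normalize)
    have "S2_grad f q = 0" using D by (simp add: vec_eq_iff S2_D_def fun_eq_iff)
    then have "(S2_extend f has_derivative (\<lambda>v. 0)) (at (x /\<^sub>R norm x))"
      using S2_extend_has_derivative [OF f, of q] q by simp
    moreover have "((\<lambda>y. y /\<^sub>R norm x) has_derivative (\<lambda>v. v /\<^sub>R norm x)) (at x)"
      by (auto intro!: derivative_eq_intros)
    ultimately have "((\<lambda>y. S2_extend f (y /\<^sub>R norm x)) has_derivative (\<lambda>v. 0)) (at x)"
      using has_derivative_compose by blast
    moreover have "S2_extend f (y /\<^sub>R norm x) = S2_extend f y" for y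
    proof -
      have "(y /\<^sub>R norm x) /\<^sub>R norm (y /\<^sub>R norm x) = y /\<^sub>R norm y" using that by simp
      then show ?thesis by (simp only: S2_extend_def)
    qed
    ultimately show ?thesis by simp
  qed
  have "connected (- {0::real^3})"
    by (rule connected_punctured_universe) simp
  then have "S2_extend f (Rep_S2 p) = S2_extend f (Rep_S2 q)"
  proof -
    have "continuous_on (- {0}) (S2_extend f)"
      by (rule smooth_on_imp_continuous_on [OF smooth_on_S2_extend [OF f]])
    then have "S2_extend f constant_on - {0}"
      using \<open>connected (- {0::real^3})\<close> der
      by (intro has_derivative_zero_connected_constant_on [where K = "{}"])
         (auto simp: has_derivative_at_withinI open_Compl)
    then obtain a where "\<And>x. x \<in> - {0} \<Longrightarrow> S2_extend f x = a" by (auto simp: constant_on_def)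
    then show ?thesis by (metis ComplI Rep_S2_nonzero singletonD)
  qed
  then show ?thesis by simp
qed

section \<open>Vector calculus on the sphere\<close>

abbreviation x1 :: "S2 \<Rightarrow> real" where "x1 \<equiv> S2_coord 1"
abbreviation x2 :: "S2 \<Rightarrow> real" where "x2 \<equiv> S2_coord 2"
abbreviation x3 :: "S2 \<Rightarrow> real" where "x3 \<equiv> S2_coord 3"

lemma derivationD:
  assumes "derivation X"
  shows "f \<in> smooth_S2 \<Longrightarrow> X f \<in> smooth_S2"
    and "f \<in> smooth_S2 \<Longrightarrow> g \<in> smooth_S2 \<Longrightarrow> X (f + g) = X f + X g"
    and "f \<in> smooth_S2 \<Longrightarrow> g \<in> smooth_S2 \<Longrightarrow> X (f * g) = f * X g + g * X f"
    and "f \<in> smooth_S2 \<Longrightarrow> X (\<lambda>p. a * f p) = (\<lambda>p. a * X f p)"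
  using assms by (auto simp: derivation_def)

lemma derivation_uminus: "derivation X \<Longrightarrow> f \<in> smooth_S2 \<Longrightarrow> X (- f) = - X f"
  using derivationD(4) [of X f "- 1"] by (simp add: fun_Compl_def)

lemma derivation_minus:
  "derivation X \<Longrightarrow> f \<in> smooth_S2 \<Longrightarrow> g \<in> smooth_S2 \<Longrightarrow> X (f - g) = X f - X g"
  using derivationD(2) [of X f "- g"] derivation_uminus [of X g] by (simp add: fun_eq_iff)

lemma derivation_eqI:
  assumes "derivation X" "derivation Y" "\<And>i. X (S2_coord i) = Y (S2_coord i)" "f \<in> smooth_S2"
  shows "X f = Y f"
  using derivation_eq [OF assms(1,4)] derivation_eq [OF assms(2,4)] assms(3) by simp

lemma derivation_add:
  "derivation X \<Longrightarrow> derivation Y \<Longrightarrow> derivation (\<lambda>f. X f + Y f)"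
  by (auto simp: derivation_def fun_eq_iff algebra_simps)

lemma derivation_diff:
  "derivation X \<Longrightarrow> derivation Y \<Longrightarrow> derivation (\<lambda>f. X f - Y f)"
  by (auto simp: derivation_def fun_eq_iff algebra_simps)

lemma derivation_mult:
  "derivation X \<Longrightarrow> g \<in> smooth_S2 \<Longrightarrow> derivation (\<lambda>f. g * X f)"
  by (auto simp: derivation_def fun_eq_iff algebra_simps)

lemma derivation_commutator:
  assumes X: "derivation X" and Y: "derivation Y"
  shows "derivation (\<lambda>f. X (Y f) - Y (X f))"
  unfolding derivation_def
  by (simp add: derivationD [OF X] derivationD [OF Y] derivation_minus [OF X] derivation_minus [OF Y])
     (simp add: fun_eq_iff algebra_simps)

text \<open>Apply \<open>X\<close> to the equation of the sphere.\<close>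

lemma derivation_tangent:
  assumes X: "derivation X"
  shows "x1 p * X x1 p + x2 p * X x2 p + x3 p * X x3 p = 0"
proof -
  have "x1 * x1 + x2 * x2 + x3 * x3 = (\<lambda>p. 1)"
    using S2_coord_sq by (simp add: fun_eq_iff power2_eq_square)
  then have "X (x1 * x1 + x2 * x2 + x3 * x3) p = 0"
    using derivation_const [OF X, of 1] by simp
  then show ?thesis by (simp add: derivationD [OF X])
qed

subsection \<open>Commutators of the partial derivatives\<close>

text \<open>Both sides are derivations, hence it suffices to compare them on the coordinates.\<close>

lemma S2_D_commute:
  assumes f: "f \<in> smooth_S2"
  shows "S2_D i (S2_D j f) p = S2_D j (S2_D i f) p + S2_coord i p * S2_D j f p - S2_coord j p * S2_D i f p"
proof -
  have "(\<lambda>f. S2_D i (S2_D j f) - S2_D j (S2_D i f)) f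
      = (\<lambda>f. S2_coord i * S2_D j f - S2_coord j * S2_D i f) f"
  proof (rule derivation_eqI [OF _ _ _ f])
    show "derivation (\<lambda>f. S2_D i (S2_D j f) - S2_D j (S2_D i f))"
      by (intro derivation_commutator derivation_S2_D)
    show "derivation (\<lambda>f. S2_coord i * S2_D j f - S2_coord j * S2_D i f)"
      by (intro derivation_diff derivation_mult derivation_S2_D S2_coord_smooth)
    fix k
    have dd: "S2_D i (S2_D j (S2_coord k)) p
        = - (S2_coord j p * S2_D i (S2_coord k) p + S2_coord k p * S2_D i (S2_coord j) p)" for i j p
    proof -
      have "S2_D j (S2_coord k) = (\<lambda>p. if j = k then 1 else 0) - S2_coord j * S2_coord k"
        by (simp add: S2_D_coord fun_eq_iff)
      then have "S2_D i (S2_D j (S2_coord k))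
          = S2_D i ((\<lambda>p. if j = k then 1 else 0) - S2_coord j * S2_coord k)" by simp
      then show ?thesis by simp
    qed
    show "S2_D i (S2_D j (S2_coord k)) - S2_D j (S2_D i (S2_coord k))
        = S2_coord i * S2_D j (S2_coord k) - S2_coord j * S2_D i (S2_coord k)"
      by (rule ext, simp only: minus_apply times_fun_apply dd, simp add: S2_D_coord algebra_simps)
  qed
  from fun_cong [OF this, of p] show ?thesis by simp
qed

text \<open>The infinitesimal rotation about the third axis, which turns out to be the modular field.\<close>

definition S2_rot :: "(S2 \<Rightarrow> real) \<Rightarrow> S2 \<Rightarrow> real" where
  "S2_rot f = x1 * S2_D 2 f - x2 * S2_D 1 f"

lemma derivation_rot: "derivation S2_rot"
  unfolding S2_rot_def by (intro derivation_diff derivation_mult derivation_S2_D S2_coord_smooth)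

lemma S2_rot_smooth [simp]: "f \<in> smooth_S2 \<Longrightarrow> S2_rot f \<in> smooth_S2"
  by (simp add: S2_rot_def)

lemma S2_rot_coord: "S2_rot x1 = - x2" "S2_rot x2 = x1" "S2_rot x3 = 0"
  by (auto simp: S2_rot_def S2_D_coord fun_eq_iff algebra_simps)

lemma S2_rot_D3:
  assumes f: "f \<in> smooth_S2"
  shows "S2_rot (S2_D 3 f) = S2_D 3 (S2_rot f)"
proof
  fix p
  show "S2_rot (S2_D 3 f) p = S2_D 3 (S2_rot f) p"
    using S2_D_commute [OF f, of 2 3 p] S2_D_commute [OF f, of 1 3 p]
    by (simp add: f S2_rot_def S2_D_coord) (simp add: algebra_simps)
qed

text \<open>Away from the poles, the gradient of the height and the rotation form an orthogonal frame whose vectors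
  both have squared length \<open>1 - x3\<^sup>2\<close>. Multiplication by this factor makes the expansion valid on the whole
  sphere.\<close>

lemma derivation_decompose:
  assumes X: "derivation X" and f: "f \<in> smooth_S2"
  shows "(1 - (x3 p)\<^sup>2) * X f p = X x3 p * S2_D 3 f p + (x1 * X x2 - x2 * X x1) p * S2_rot f p"
proof -
  have "X f p = X x1 p * S2_D 1 f p + X x2 p * S2_D 2 f p + X x3 p * S2_D 3 f p"
    by (subst derivation_eq [OF X f]) (simp add: sum_3)
  then show ?thesis
    using derivation_tangent [OF X, of p] S2_D_tangent [OF f, of p] S2_coord_sq [of p]
    by (simp add: S2_rot_def) algebra
qed

text \<open>The surface divergence, written in ambient coordinates; for tangent fields it is the divergence with
  respect to the area form, see \<open>lie_derivative_area\<close>.\<close>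

definition S2_div :: "((S2 \<Rightarrow> real) \<Rightarrow> S2 \<Rightarrow> real) \<Rightarrow> S2 \<Rightarrow> real" where
  "S2_div X = S2_D 1 (X x1) + S2_D 2 (X x2) + S2_D 3 (X x3)"

lemma S2_div_smooth: "derivation X \<Longrightarrow> S2_div X \<in> smooth_S2"
  by (simp add: S2_div_def derivationD)

text \<open>The derivative of the tangency relation \<open>derivation_tangent\<close>.\<close>

lemma derivation_tangent_D:
  assumes X: "derivation X"
  shows "x1 p * S2_D i (X x1) p + x2 p * S2_D i (X x2) p + x3 p * S2_D i (X x3) p = - X (S2_coord i) p"
proof -
  have "x1 * X x1 + x2 * X x2 + x3 * X x3 = (\<lambda>p. 0)"
    using derivation_tangent [OF X] by (simp add: fun_eq_iff)
  then have D: "S2_D i (x1 * X x1 + x2 * X x2 + x3 * X x3) p = 0" for i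
    by simp
  have "i = 1 \<or> i = 2 \<or> i = 3" using UNIV_3 by auto
  then show ?thesis
  proof (elim disjE)
    assume i: "i = 1"
    show ?thesis using D [of 1] derivation_tangent [OF X, of p]
      unfolding i by (simp add: derivationD [OF X] S2_D_coord) algebra
  next
    assume i: "i = 2"
    show ?thesis using D [of 2] derivation_tangent [OF X, of p]
      unfolding i by (simp add: derivationD [OF X] S2_D_coord) algebra
  next
    assume i: "i = 3"
    show ?thesis using D [of 3] derivation_tangent [OF X, of p]
      unfolding i by (simp add: derivationD [OF X] S2_D_coord) algebra
  qed
qed

lemma S2_div_decompose:
  assumes X: "derivation X"
  shows "(1 - (x3 p)\<^sup>2) * S2_div X p = S2_D 3 (X x3) p + S2_rot (x1 * X x2 - x2 * X x1) p"
  using derivation_tangent_D [OF X, of p 1] derivation_tangent_D [OF X, of p 2]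
    derivation_tangent_D [OF X, of p 3] S2_D_tangent [OF derivationD(1) [OF X S2_coord_smooth], of p 1]
    S2_D_tangent [OF derivationD(1) [OF X S2_coord_smooth], of p 2]
    S2_D_tangent [OF derivationD(1) [OF X S2_coord_smooth], of p 3]
    S2_coord_sq [of p] derivation_tangent [OF X, of p]
  by (simp add: S2_div_def S2_rot_def derivationD [OF X] S2_D_coord) algebra

subsection \<open>The bracket of the standard Poisson structure\<close>

definition S2_bracket :: "(S2 \<Rightarrow> real) \<Rightarrow> (S2 \<Rightarrow> real) \<Rightarrow> S2 \<Rightarrow> real" where
  "S2_bracket f g = x1 * (S2_D 2 f * S2_D 3 g - S2_D 3 f * S2_D 2 g)
     + x2 * (S2_D 3 f * S2_D 1 g - S2_D 1 f * S2_D 3 g)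
     + x3 * (S2_D 1 f * S2_D 2 g - S2_D 2 f * S2_D 1 g)"

lemma std_poisson_eq_bracket:
  "f \<in> smooth_S2 \<Longrightarrow> g \<in> smooth_S2 \<Longrightarrow> std_poisson [f, g] = S2_bracket f g"
  by (simp add: std_poisson_def smooth_args_def S2_bracket_def fun_eq_iff cross3_def inner_vec_def
      sum_3 S2_D_def S2_coord_def)

lemma S2_bracket_smooth [simp]: "f \<in> smooth_S2 \<Longrightarrow> g \<in> smooth_S2 \<Longrightarrow> S2_bracket f g \<in> smooth_S2"
  by (simp add: S2_bracket_def)

lemma S2_bracket_antisym: "S2_bracket g f = - S2_bracket f g"
  by (simp add: S2_bracket_def fun_eq_iff algebra_simps)

lemma derivation_bracket: "f \<in> smooth_S2 \<Longrightarrow> derivation (S2_bracket f)"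
  by (auto simp: derivation_def S2_bracket_def fun_eq_iff algebra_simps)

lemma derivation_bracket_left: "g \<in> smooth_S2 \<Longrightarrow> derivation (\<lambda>f. S2_bracket f g)"
  by (auto simp: derivation_def S2_bracket_def fun_eq_iff algebra_simps)

lemma S2_bracket_coord:
  assumes "f \<in> smooth_S2"
  shows "S2_bracket f x1 = x2 * S2_D 3 f - x3 * S2_D 2 f"
    and "S2_bracket f x2 = x3 * S2_D 1 f - x1 * S2_D 3 f"
    and "S2_bracket f x3 = S2_rot f"
  by (simp_all add: fun_eq_iff S2_bracket_def S2_D_coord S2_rot_def) algebra+

lemma S2_bracket_coords: "S2_bracket x1 x2 = x3" "S2_bracket x2 x3 = x1" "S2_bracket x3 x1 = x2"
  by (auto simp: S2_bracket_coord S2_D_coord S2_rot_def fun_eq_iff algebra_simps)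

text \<open>The bracket in the frame of \<open>derivation_decompose\<close>.\<close>

lemma S2_bracket_decompose:
  assumes "f \<in> smooth_S2" "g \<in> smooth_S2"
  shows "(1 - (x3 p)\<^sup>2) * S2_bracket f g p = S2_rot f p * S2_D 3 g p - S2_D 3 f p * S2_rot g p"
  using S2_D_tangent [OF assms(1), of p] S2_D_tangent [OF assms(2), of p] S2_coord_sq [of p]
  by (simp add: S2_bracket_def S2_rot_def) algebra

text \<open>A bivector on a plane is a multiple of any nonzero one. In coordinates, the matrix of \<open>P\<close> is the cross
  product with a vector, tangency in each slot forces this vector to be normal to the sphere, and the
  factor is its normal component.\<close>

lemma biderivation_eq:
  assumes P1: "\<And>g. g \<in> smooth_S2 \<Longrightarrow> derivation (\<lambda>f. P f g)"
    and P2: "\<And>f. f \<in> smooth_S2 \<Longrightarrow> derivation (P f)"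
    and anti: "\<And>f g. f \<in> smooth_S2 \<Longrightarrow> g \<in> smooth_S2 \<Longrightarrow> P g f = - P f g"
    and f: "f \<in> smooth_S2" and g: "g \<in> smooth_S2"
  shows "P f g = (x1 * P x2 x3 + x2 * P x3 x1 + x3 * P x1 x2) * S2_bracket f g"
proof
  fix p
  define a where "a = P x2 x3 p"
  define b where "b = P x3 x1 p"
  define c where "c = P x1 x2 p"
  have anti': "P x3 x2 p = - a" "P x1 x3 p = - b" "P x2 x1 p = - c"
    using anti [of x2 x3] anti [of x3 x1] anti [of x1 x2] by (simp_all add: a_def b_def c_def)
  have diag: "P x1 x1 p = 0" "P x2 x2 p = 0" "P x3 x3 p = 0"
    using fun_cong [OF anti [of x1 x1], of p] fun_cong [OF anti [of x2 x2], of p]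
      fun_cong [OF anti [of x3 x3], of p] by simp_all
  have Pf: "P f g p = P x1 g p * S2_D 1 f p + P x2 g p * S2_D 2 f p + P x3 g p * S2_D 3 f p"
    by (subst derivation_eq [OF P1 [OF g] f]) (simp add: sum_3)
  have "P (S2_coord i) g p = P (S2_coord i) x1 p * S2_D 1 g p + P (S2_coord i) x2 p * S2_D 2 g p
      + P (S2_coord i) x3 p * S2_D 3 g p" for i
    by (subst derivation_eq [OF P2 [OF S2_coord_smooth] g]) (simp add: sum_3)
  from Pf this [of 1] this [of 2] this [of 3] have "P f g p = a * (S2_D 2 f p * S2_D 3 g p - S2_D 3 f p * S2_D 2 g p)
     + b * (S2_D 3 f p * S2_D 1 g p - S2_D 1 f p * S2_D 3 g p)
     + c * (S2_D 1 f p * S2_D 2 g p - S2_D 2 f p * S2_D 1 g p)"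
    by (simp add: anti' diag flip: a_def b_def c_def) (simp add: algebra_simps)
  moreover have "x3 p * b = x2 p * c" "x1 p * c = x3 p * a" "x2 p * a = x1 p * b"
    using derivation_tangent [OF P2, of x1 p] derivation_tangent [OF P2, of x2 p]
      derivation_tangent [OF P2, of x3 p]
    by (simp_all add: anti' diag flip: a_def b_def c_def)
  ultimately show "P f g p = ((x1 * P x2 x3 + x2 * P x3 x1 + x3 * P x1 x2) * S2_bracket f g) p"
    using S2_coord_sq [of p]
    by (simp add: S2_bracket_def flip: a_def b_def c_def) algebra
qed

text \<open>The left-hand side is an antisymmetric biderivation, so \<open>biderivation_eq\<close> makes it a multiple of the
  bracket, and the factor is found by evaluation on pairs of coordinates.\<close>

lemma lie_derivative_bracket:
  assumes X: "derivation X" and f: "f \<in> smooth_S2" and g: "g \<in> smooth_S2"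
  shows "X (S2_bracket f g) - S2_bracket (X f) g - S2_bracket f (X g) = - S2_div X * S2_bracket f g"
proof -
  define P where "P = (\<lambda>f g. X (S2_bracket f g) - S2_bracket (X f) g - S2_bracket f (X g))"
  note Xs = derivationD(1) [OF X]
  have "P f g = (x1 * P x2 x3 + x2 * P x3 x1 + x3 * P x1 x2) * S2_bracket f g"
  proof (rule biderivation_eq [OF _ _ _ f g])
    fix g assume g: "g \<in> smooth_S2"
    show "derivation (\<lambda>f. P f g)"
      unfolding P_def
      by (intro derivation_diff [OF derivation_commutator [OF X derivation_bracket_left]]
          derivation_bracket_left g Xs)
  next
    fix f assume f: "f \<in> smooth_S2"
    have "derivation (\<lambda>g. (X (S2_bracket f g) - S2_bracket f (X g)) - S2_bracket (X f) g)"
      by (intro derivation_diff [OF derivation_commutator [OF X derivation_bracket]]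
          derivation_bracket f Xs)
    moreover have "P f = (\<lambda>g. (X (S2_bracket f g) - S2_bracket f (X g)) - S2_bracket (X f) g)"
      by (simp add: P_def fun_eq_iff)
    ultimately show "derivation (P f)" by simp
  next
    fix f g assume "f \<in> smooth_S2" "g \<in> smooth_S2"
    then show "P g f = - P f g"
      unfolding P_def S2_bracket_antisym [of f] S2_bracket_antisym [of "X f"]
      by (simp add: derivation_uminus [OF X])
  qed
  moreover have "x1 * P x2 x3 + x2 * P x3 x1 + x3 * P x1 x2 = - S2_div X"
  proof
    fix p
    have b: "S2_bracket x1 g = - S2_bracket g x1" "S2_bracket x2 g = - S2_bracket g x2"
      "S2_bracket x3 g = - S2_bracket g x3" for g by (rule S2_bracket_antisym)+
    have "P x2 x3 p = - x1 p * S2_div X p"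
    proof -
      have "P x2 x3 p + x1 p * S2_div X p = X x1 p
          + (x1 p * S2_D 1 (X x1) p + x2 p * S2_D 1 (X x2) p + x3 p * S2_D 1 (X x3) p)"
        unfolding P_def S2_bracket_coords
        by (simp add: b(2) [of "X _"] S2_bracket_coord Xs S2_div_def S2_rot_def algebra_simps)
      then show ?thesis by (simp add: derivation_tangent_D [OF X])
    qed
    moreover have "P x3 x1 p = - x2 p * S2_div X p"
    proof -
      have "P x3 x1 p + x2 p * S2_div X p = X x2 p
          + (x1 p * S2_D 2 (X x1) p + x2 p * S2_D 2 (X x2) p + x3 p * S2_D 2 (X x3) p)"
        unfolding P_def S2_bracket_coords
        by (simp add: b(3) [of "X _"] S2_bracket_coord Xs S2_div_def S2_rot_def algebra_simps)
      then show ?thesis by (simp add: derivation_tangent_D [OF X])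
    qed
    moreover have "P x1 x2 p = - x3 p * S2_div X p"
    proof -
      have "P x1 x2 p + x3 p * S2_div X p = X x3 p
          + (x1 p * S2_D 3 (X x1) p + x2 p * S2_D 3 (X x2) p + x3 p * S2_D 3 (X x3) p)"
        unfolding P_def S2_bracket_coords
        by (simp add: b(1) [of "X _"] S2_bracket_coord Xs S2_div_def S2_rot_def algebra_simps)
      then show ?thesis by (simp add: derivation_tangent_D [OF X])
    qed
    ultimately show "(x1 * P x2 x3 + x2 * P x3 x1 + x3 * P x1 x2) p = (- S2_div X) p"
      using S2_coord_sq [of p] by simp algebra
  qed
  ultimately show ?thesis by (simp add: P_def)
qed

lemma S2_div_bracket:
  assumes f: "f \<in> smooth_S2"
  shows "S2_div (S2_bracket f) = 0"
proof
  fix p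
  show "S2_div (S2_bracket f) p = 0 p"
    using S2_D_commute [OF f, of 1 2 p] S2_D_commute [OF f, of 1 3 p] S2_D_commute [OF f, of 2 3 p]
    by (simp add: f S2_div_def S2_bracket_coord S2_rot_def S2_D_coord) (simp add: algebra_simps)
qed

text \<open>Hamiltonian fields are free of divergence, hence act as derivations of the bracket.\<close>

lemma S2_bracket_jacobi:
  assumes "f \<in> smooth_S2" "g \<in> smooth_S2" "h \<in> smooth_S2"
  shows "S2_bracket f (S2_bracket g h) = S2_bracket (S2_bracket f g) h + S2_bracket g (S2_bracket f h)"
  using lie_derivative_bracket [OF derivation_bracket [OF assms(1)] assms(2,3)]
  by (simp add: S2_div_bracket [OF assms(1)] algebra_simps)

section \<open>Rotation-invariant functions\<close>

subsection \<open>Cancellation\<close>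

text \<open>On the circle, differentiate \<open>(c - x3) f = 0\<close> along the gradient of the height: the term with the derivative
  of \<open>f\<close> disappears and \<open>(1 - c\<^sup>2) f\<close> remains.\<close>

lemma cancel_height:
  assumes c: "\<bar>c\<bar> < 1" and f: "f \<in> smooth_S2" and z: "\<And>p. (c - x3 p) * f p = 0"
  shows "f = 0"
proof
  fix p
  have "((\<lambda>p. c) - x3) * f = (\<lambda>p. 0)" using z by (simp add: fun_eq_iff)
  then have "S2_D 3 (((\<lambda>p. c) - x3) * f) p = 0" by simp
  then have "(c - x3 p) * S2_D 3 f p = (1 - (x3 p)\<^sup>2) * f p"
    using f by (simp add: S2_D_coord power2_eq_square algebra_simps)
  moreover have "c\<^sup>2 < 1" using c by (simp add: abs_square_less_1)
  ultimately show "f p = 0 p" using z [of p] by (cases "x3 p = c") auto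
qed

lemma pole_iff: "(x3 p)\<^sup>2 = 1 \<longleftrightarrow> x1 p = 0 \<and> x2 p = 0"
proof -
  have "(x3 p)\<^sup>2 = 1 \<longleftrightarrow> (x1 p)\<^sup>2 + (x2 p)\<^sup>2 = 0" using S2_coord_sq [of p] by linarith
  then show ?thesis by (simp add: sum_power2_eq_zero_iff)
qed

text \<open>The factor vanishes to second order at the poles, so there a second derivative isolates \<open>f\<close>.\<close>

lemma cancel_poles:
  assumes f: "f \<in> smooth_S2" and z: "\<And>p. (1 - (x3 p)\<^sup>2) * f p = 0"
  shows "f = 0"
proof
  fix p
  have "(1 - x3 * x3) * f = (\<lambda>p. 0)" using z by (simp add: fun_eq_iff power2_eq_square)
  then have D: "S2_D 1 (S2_D 1 ((1 - x3 * x3) * f)) p = 0" by simp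
  have e: "S2_D 1 x3 = - (x1 * x3)" "S2_D 1 x1 = 1 - x1 * x1"
    by (simp_all add: S2_D_coord fun_eq_iff)
  have two: "(2 :: S2 \<Rightarrow> real) = (\<lambda>p. 2)" by (simp add: fun_eq_iff)
  have two: "(2 :: S2 \<Rightarrow> real) \<in> smooth_S2" "S2_D 1 2 = 0" unfolding two by simp_all
  show "f p = 0 p"
  proof (cases "(x3 p)\<^sup>2 = 1")
    case True
    then have "x1 p = 0" "x2 p = 0" using pole_iff by auto
    then show ?thesis
      using D f True by (simp add: e two power2_eq_square)
  next
    case False
    then show ?thesis using z [of p] by simp
  qed
qed

subsection \<open>The flow of rotations\<close>

lemma smooth_on_sin: "smooth_on (sin :: real \<Rightarrow> real) UNIV"
  and smooth_on_cos: "smooth_on (cos :: real \<Rightarrow> real) UNIV"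
proof -
  let ?S = "{\<lambda>t::real. a * sin t + b * cos t | a b. True}"
  have S: "\<exists>G'. (\<forall>x\<in>UNIV. (G has_derivative G' x) (at x)) \<and> (\<forall>v. (\<lambda>x. G' x v) \<in> ?S)"
    if GS: "G \<in> ?S" for G
  proof -
    obtain a b where G: "G = (\<lambda>t::real. a * sin t + b * cos t)" using GS by blast
    have "(G has_derivative (\<lambda>v. (- b * v) * sin t + (a * v) * cos t)) (at t)" for t
      unfolding G by (auto intro!: derivative_eq_intros simp: algebra_simps)
    then show ?thesis by (intro exI [of _ "\<lambda>t v. (- b * v) * sin t + (a * v) * cos t"]) blast
  qed
  have "(sin :: real \<Rightarrow> real) \<in> ?S" by (intro CollectI exI [of _ 1] exI [of _ 0]) auto
  then show "smooth_on (sin :: real \<Rightarrow> real) UNIV" by (rule smooth_on_coinduct [OF _ open_UNIV S])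
  have "(cos :: real \<Rightarrow> real) \<in> ?S" by (intro CollectI exI [of _ 0] exI [of _ 1]) auto
  then show "smooth_on (cos :: real \<Rightarrow> real) UNIV" by (rule smooth_on_coinduct [OF _ open_UNIV S])
qed

definition rot_vec :: "real \<Rightarrow> real^3 \<Rightarrow> real^3" where
  "rot_vec t x = vector [cos t * x $ 1 - sin t * x $ 2, sin t * x $ 1 + cos t * x $ 2, x $ 3]"

definition S2_rotate :: "real \<Rightarrow> S2 \<Rightarrow> S2" where
  "S2_rotate t p = Abs_S2 (rot_vec t (Rep_S2 p))"

lemma norm_rot_vec: "norm (rot_vec t x) = norm x"
proof -
  have "(cos t * a - sin t * b)\<^sup>2 + (sin t * a + cos t * b)\<^sup>2 = a\<^sup>2 + b\<^sup>2" for a b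
    using sin_cos_squared_add [of t] by algebra
  then show ?thesis by (simp add: norm_vec_def L2_set_def sum_3 rot_vec_def)
qed

lemma Rep_rotate: "Rep_S2 (S2_rotate t p) = rot_vec t (Rep_S2 p)"
  by (simp add: S2_rotate_def Abs_S2_inverse norm_rot_vec)

lemma S2_eqI: "(\<And>i. S2_coord i p = S2_coord i q) \<Longrightarrow> p = q"
  by (metis Rep_S2_inject S2_coord_def vec_eq_iff)

lemma S2_coord_rotate:
  "x1 (S2_rotate t p) = cos t * x1 p - sin t * x2 p"
  "x2 (S2_rotate t p) = sin t * x1 p + cos t * x2 p"
  "x3 (S2_rotate t p) = x3 p"
  by (simp_all add: S2_coord_def Rep_rotate rot_vec_def)

lemma S2_eqI3: "x1 p = x1 q \<Longrightarrow> x2 p = x2 q \<Longrightarrow> x3 p = x3 q \<Longrightarrow> p = q"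
  by (rule S2_eqI) (use forall_3 [of "\<lambda>i. S2_coord i p = S2_coord i q"] in blast)

lemma S2_rotate_add: "S2_rotate t (S2_rotate s p) = S2_rotate (t + s) p"
  by (rule S2_eqI3) (simp_all add: S2_coord_rotate sin_add cos_add algebra_simps)

lemma S2_rotate_0 [simp]: "S2_rotate 0 p = p" and S2_rotate_2pi [simp]: "S2_rotate (2 * pi) p = p"
  by (rule S2_eqI3; simp add: S2_coord_rotate)+

lemma S2_rotate_has_derivative:
  assumes f: "f \<in> smooth_S2"
  shows "((\<lambda>t. f (S2_rotate t p)) has_real_derivative S2_rot f (S2_rotate t p)) (at t)"
proof -
  define v :: "real^3" where "v = vector [- x2 (S2_rotate t p), x1 (S2_rotate t p), 0]"
  have "((\<lambda>t. rot_vec t (Rep_S2 p)) has_vector_derivative v) (at t)"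
    unfolding rot_vec_def v_def S2_coord_rotate
    by (rule vector3_has_vector_derivative) (auto intro!: derivative_eq_intros simp: S2_coord_def)
  from S2_chain_rule [OF f Rep_rotate this]
  show ?thesis
    by (simp add: v_def S2_rot_def inner_vec_def sum_3 S2_D_def S2_coord_rotate algebra_simps)
qed

lemma rot_zero_imp_invariant:
  assumes f: "f \<in> smooth_S2" and R: "S2_rot f = 0"
  shows "f (S2_rotate t p) = f p"
  using DERIV_isconst_all [of "\<lambda>t. f (S2_rotate t p)" t 0] S2_rotate_has_derivative [OF f] R by simp

text \<open>Along an orbit, \<open>f\<close> is affine in the angle and periodic, hence constant. So a function that is both
  invariant and in the image of the rotation is zero.\<close>

lemma rot_square_zero:
  assumes f: "f \<in> smooth_S2" and R: "S2_rot (S2_rot f) = 0"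
  shows "S2_rot f = 0"
proof
  fix p
  have "((\<lambda>t. f (S2_rotate t p) - t * S2_rot f p) has_real_derivative 0) (at t)" for t
    using S2_rotate_has_derivative [OF f, of p t] rot_zero_imp_invariant [OF _ R] f
    by (auto intro!: derivative_eq_intros)
  then have "f (S2_rotate (2 * pi) p) - 2 * pi * S2_rot f p = f (S2_rotate 0 p) - 0 * S2_rot f p"
    by (intro DERIV_isconst_all) blast
  then show "S2_rot f p = 0 p" by simp
qed

text \<open>With weight \<open>1\<close> this is the mean over the orbit up to a factor; with weight \<open>t\<close> it inverts the rotation up
  to the same factor and the mean.\<close>

definition rot_integral :: "(real \<Rightarrow> real) \<Rightarrow> (S2 \<Rightarrow> real) \<Rightarrow> S2 \<Rightarrow> real" where
  "rot_integral w f p = integral {0..2 * pi} (\<lambda>t. w t * f (S2_rotate t p))"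

lemma smooth_on_rot_vec:
  assumes "smooth_on \<theta> U" "\<And>i. smooth_on (\<lambda>u. \<gamma> u $ i) U"
  shows "b \<in> Basis \<Longrightarrow> smooth_on (\<lambda>u. rot_vec (\<theta> u) (\<gamma> u) \<bullet> b) U"
proof -
  have "smooth_on (\<lambda>u. rot_vec (\<theta> u) (\<gamma> u) $ i) U" for i
  proof -
    have "i = 1 \<or> i = 2 \<or> i = 3" using UNIV_3 by auto
    then show ?thesis
      unfolding rot_vec_def
      by (auto intro!: smooth_on_add smooth_on_diff smooth_on_mult assms
          smooth_on_compose_real [OF smooth_on_sin assms(1)] smooth_on_compose_real [OF smooth_on_cos assms(1)])
  qed
  then show "b \<in> Basis \<Longrightarrow> smooth_on (\<lambda>u. rot_vec (\<theta> u) (\<gamma> u) \<bullet> b) U"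
    by (auto simp: Basis_vec_def inner_axis)
qed

lemma smooth_on_fst: "open U \<Longrightarrow> smooth_on (\<lambda>z::real \<times> 'a::real_normed_vector. fst z) U"
  by (simp add: smooth_on_linear bounded_linear_fst)

lemma smooth_on_vec_nth: "open U \<Longrightarrow> smooth_on (\<lambda>x::real^3. x $ i) U"
  by (simp add: smooth_on_linear bounded_linear_vec_nth)

lemma smooth_on_snd_nth: "open U \<Longrightarrow> smooth_on (\<lambda>z::real \<times> (real^3). snd z $ i) U"
  by (intro smooth_on_linear bounded_linear_compose [OF bounded_linear_vec_nth bounded_linear_snd])

lemma rot_integral_smooth:
  assumes w: "smooth_on w UNIV" and f: "f \<in> smooth_S2"
  shows "rot_integral w f \<in> smooth_S2"
proof -
  let ?W = "{z::real \<times> (real^3). snd z \<noteq> 0}"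
  have W: "open ?W" by (intro open_Collect_neq continuous_intros)
  have nz: "rot_vec t x \<in> - {0}" if "x \<noteq> 0" for t x
    using that norm_rot_vec [of t x] by (metis ComplI norm_eq_zero singletonD)
  have "smooth_on (\<lambda>z. w (fst z) * S2_extend f (rot_vec (fst z) (snd z))) ?W"
    by (intro smooth_on_mult smooth_on_compose_real [OF w] smooth_on_fst W UNIV_I
        smooth_on_compose [OF smooth_on_S2_extend [OF f]] smooth_on_rot_vec smooth_on_snd_nth nz) auto
  then have "smooth_on (\<lambda>x. integral {0..2 * pi} (\<lambda>t. w (fst (t, x)) *
      S2_extend f (rot_vec (fst (t, x)) (snd (t, x))))) (- {0})"
    by (rule smooth_on_integral_parameter) auto
  then show ?thesis
    by (rule smooth_S2I) (simp_all add: rot_integral_def flip: Rep_rotate)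
qed

text \<open>Rotating the base point shifts the angle, so the derivative passes under the integral onto \<open>f\<close>.\<close>

lemma rot_rot_integral:
  assumes w: "smooth_on w UNIV" and f: "f \<in> smooth_S2"
  shows "S2_rot (rot_integral w f) = rot_integral w (S2_rot f)"
proof
  fix p
  define F where "F = (\<lambda>z::real \<times> real. w (fst z) * f (S2_rotate (fst z + snd z) p))"
  have sF: "smooth_on F UNIV"
  proof -
    have nz: "rot_vec t (Rep_S2 p) \<in> - {0}" for t
      using norm_rot_vec [of t "Rep_S2 p"] by auto
    have "smooth_on (\<lambda>z::real \<times> real. w (fst z) * S2_extend f (rot_vec (fst z + snd z) (Rep_S2 p))) UNIV"
      by (intro smooth_on_mult smooth_on_compose_real [OF w] smooth_on_fst UNIV_I open_UNIV
          smooth_on_compose [OF smooth_on_S2_extend [OF f]] smooth_on_rot_vec nz smooth_on_const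
          smooth_on_linear bounded_linear_add bounded_linear_fst bounded_linear_snd)
    then show ?thesis by (simp add: F_def flip: Rep_rotate)
  qed
  have D: "frechet_derivative F (at (t, 0)) (0, 1) = w t * S2_rot f (S2_rotate t p)" for t
  proof -
    have "(F has_derivative frechet_derivative F (at (t, 0))) (at (t, 0))"
      by (rule smooth_on_has_derivative [OF sF UNIV_I])
    moreover have "((\<lambda>s::real. (t, s)) has_derivative (\<lambda>s. (0, s))) (at 0)"
      by (auto intro!: derivative_eq_intros)
    ultimately have "((\<lambda>s. F (t, s)) has_derivative (\<lambda>s. frechet_derivative F (at (t, 0)) (0, s))) (at 0)"
      using has_derivative_compose by blast
    moreover have "((\<lambda>s. F (t, s)) has_derivative (\<lambda>s. w t * S2_rot f (S2_rotate t p) * s)) (at 0)"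
    proof -
      have "((\<lambda>s. f (S2_rotate (t + s) p)) has_real_derivative S2_rot f (S2_rotate (t + 0) p)) (at 0)"
        using S2_rotate_has_derivative [OF f, of p t]
          DERIV_shift [of "\<lambda>t. f (S2_rotate t p)" "S2_rot f (S2_rotate t p)" 0 t]
        by (simp add: add.commute)
      then show ?thesis
        by (auto simp: F_def has_field_derivative_def [symmetric] intro!: derivative_eq_intros)
    qed
    ultimately have "(\<lambda>s. frechet_derivative F (at (t, 0)) (0, s)) = (\<lambda>s. w t * S2_rot f (S2_rotate t p) * s)"
      by (rule has_derivative_unique)
    from fun_cong [OF this, of 1] show ?thesis by simp
  qed
  have "((\<lambda>s. integral {0..2 * pi} (\<lambda>t. F (t, s))) has_derivative
          (\<lambda>v. integral {0..2 * pi} (\<lambda>t. frechet_derivative F (at (t, 0)) (0, v)))) (at 0)"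
    by (rule has_derivative_integral_parameter [OF sF open_UNIV]) auto
  moreover have "(\<lambda>s. integral {0..2 * pi} (\<lambda>t. F (t, s))) = (\<lambda>s. rot_integral w f (S2_rotate s p))"
    by (simp add: rot_integral_def F_def S2_rotate_add fun_eq_iff)
  ultimately have "((\<lambda>s. rot_integral w f (S2_rotate s p)) has_derivative
      (\<lambda>v. integral {0..2 * pi} (\<lambda>t. frechet_derivative F (at (t, 0)) (0, v)))) (at 0)"
    by simp
  moreover have "((\<lambda>s. rot_integral w f (S2_rotate s p)) has_derivative
      (\<lambda>v. S2_rot (rot_integral w f) (S2_rotate 0 p) * v)) (at 0)"
    using S2_rotate_has_derivative [OF rot_integral_smooth [OF w f], of p 0]
    by (simp add: has_field_derivative_def)
  ultimately have "(\<lambda>v. integral {0..2 * pi} (\<lambda>t. frechet_derivative F (at (t, 0)) (0, v)))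
      = (\<lambda>v. S2_rot (rot_integral w f) (S2_rotate 0 p) * v)"
    by (rule has_derivative_unique)
  from fun_cong [OF this, of 1]
  show "S2_rot (rot_integral w f) p = rot_integral w (S2_rot f) p"
    by (simp add: D rot_integral_def)
qed

text \<open>Integration by parts of \<open>t \<mapsto> t (S2_rot h)\<close> over a full orbit gives \<open>2 \<pi> h\<close> minus the integral of \<open>h\<close>, so \<open>g\<close>
  below solves \<open>S2_rot g = h - mean\<close>; the mean is invariant.\<close>

theorem rot_decomposition:
  assumes h: "h \<in> smooth_S2"
  obtains g where "g \<in> smooth_S2" "S2_rot (h - S2_rot g) = 0"
proof -
  define g where "g = (\<lambda>p. 1 / (2 * pi) * rot_integral (\<lambda>t. t) h p)"
  define A where "A = rot_integral (\<lambda>t. 1) h"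
  have w: "smooth_on (\<lambda>t::real. t) UNIV" "smooth_on (\<lambda>t::real. 1) UNIV"
    by (simp_all add: smooth_on_ident smooth_on_const)
  have cont: "continuous_on S (\<lambda>t. f (S2_rotate t p))" if "f \<in> smooth_S2" for f p S
    using S2_rotate_has_derivative [OF that] DERIV_isCont
    by (blast intro: continuous_at_imp_continuous_on)
  have A: "A \<in> smooth_S2" unfolding A_def by (rule rot_integral_smooth [OF w(2) h])
  have gs: "g \<in> smooth_S2" unfolding g_def by (intro smooth_S2_scale rot_integral_smooth [OF w(1) h])
  have "S2_rot A p = 0" for p
  proof -
    have "(S2_rot h \<circ> (\<lambda>t. S2_rotate t p) has_integral (h (S2_rotate (2 * pi) p) - h (S2_rotate 0 p))) {0..2 * pi}"
      using S2_rotate_has_derivative [OF h]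
      by (intro fundamental_theorem_of_calculus)
         (auto simp: has_real_derivative_iff_has_vector_derivative [symmetric] has_field_derivative_at_within)
    then show ?thesis
      using rot_rot_integral [OF w(2) h] by (simp add: A_def rot_integral_def o_def integral_unique)
  qed
  then have RA: "S2_rot A = 0" by (simp add: fun_eq_iff)
  have "S2_rot g p = h p - 1 / (2 * pi) * A p" for p
  proof -
    have "((\<lambda>t. h (S2_rotate t p) + t * S2_rot h (S2_rotate t p)) has_integral
        (2 * pi * h (S2_rotate (2 * pi) p) - 0 * h (S2_rotate 0 p))) {0..2 * pi}"
    proof (rule fundamental_theorem_of_calculus)
      fix t
      have "((\<lambda>t. t * h (S2_rotate t p)) has_real_derivative h (S2_rotate t p) + t * S2_rot h (S2_rotate t p)) (at t)"
        using S2_rotate_has_derivative [OF h] by (auto intro!: derivative_eq_intros)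
      then show "((\<lambda>t. t * h (S2_rotate t p)) has_vector_derivative h (S2_rotate t p) + t * S2_rot h (S2_rotate t p))
          (at t within {0..2 * pi})"
        by (simp add: has_real_derivative_iff_has_vector_derivative [symmetric] has_field_derivative_at_within)
    qed simp
    then have "integral {0..2 * pi} (\<lambda>t. h (S2_rotate t p) + t * S2_rot h (S2_rotate t p)) = 2 * pi * h p"
      by (simp add: integral_unique)
    moreover have "integral {0..2 * pi} (\<lambda>t. h (S2_rotate t p) + t * S2_rot h (S2_rotate t p))
        = A p + rot_integral (\<lambda>t. t) (S2_rot h) p"
      unfolding A_def rot_integral_def
      by (subst integral_add)
         (auto intro!: integrable_continuous_interval continuous_intros cont simp: h)
    moreover have "S2_rot g = (\<lambda>p. 1 / (2 * pi) * S2_rot (rot_integral (\<lambda>t. t) h) p)"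
      unfolding g_def by (rule derivationD(4) [OF derivation_rot rot_integral_smooth [OF w(1) h]])
    then have "S2_rot g p = 1 / (2 * pi) * rot_integral (\<lambda>t. t) (S2_rot h) p"
      by (simp add: rot_rot_integral [OF w(1) h])
    ultimately show ?thesis by (simp add: field_simps)
  qed
  then have e: "h - S2_rot g = (\<lambda>p. 1 / (2 * pi) * A p)" by (simp add: fun_eq_iff)
  have "S2_rot (h - S2_rot g) = (\<lambda>p. 1 / (2 * pi) * S2_rot A p)"
    unfolding e by (rule derivationD(4) [OF derivation_rot A])
  then have "S2_rot (h - S2_rot g) = 0" by (simp add: RA fun_eq_iff)
  then show thesis using gs that by blast
qed

subsection \<open>Invariant functions are functions of the height\<close>

text \<open>The values along the meridian, parametrised by the height.\<close>

definition profile :: "(S2 \<Rightarrow> real) \<Rightarrow> real \<Rightarrow> real" where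
  "profile f s = S2_extend f (vector [sqrt (1 - s\<^sup>2), 0, s])"

lemma invariant_eq_profile:
  assumes f: "f \<in> smooth_S2" and R: "S2_rot f = 0"
  shows "f p = profile f (x3 p)"
proof -
  define r where "r = sqrt (1 - (x3 p)\<^sup>2)"
  have r: "r \<ge> 0" "r\<^sup>2 = (x1 p)\<^sup>2 + (x2 p)\<^sup>2"
  proof -
    have "1 - (x3 p)\<^sup>2 = (x1 p)\<^sup>2 + (x2 p)\<^sup>2" using S2_coord_sq [of p] by simp
    then show "r \<ge> 0" "r\<^sup>2 = (x1 p)\<^sup>2 + (x2 p)\<^sup>2" by (simp_all add: r_def)
  qed
  obtain t where t: "x1 p = r * cos t" "x2 p = r * sin t"
  proof (cases "r = 0")
    case True
    then have "x1 p = 0" "x2 p = 0" using r by (auto simp: sum_power2_eq_zero_iff)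
    then show ?thesis using that [of 0] True by simp
  next
    case False
    have "(x1 p / r)\<^sup>2 + (x2 p / r)\<^sup>2 = ((x1 p)\<^sup>2 + (x2 p)\<^sup>2) / r\<^sup>2"
      by (simp add: power_divide add_divide_distrib)
    also have "\<dots> = 1" using False by (simp flip: r(2))
    finally have "(x1 p / r)\<^sup>2 + (x2 p / r)\<^sup>2 = 1" .
    then obtain t where "x1 p / r = cos t" "x2 p / r = sin t" by (metis sincos_total_2pi)
    then show ?thesis using that [of t] False by (simp add: field_simps)
  qed
  have "norm (vector [r, 0, x3 p] :: real^3) = 1"
    using r S2_coord_sq [of p] by (simp add: norm_vec_def L2_set_def sum_3)
  then have q: "Rep_S2 (Abs_S2 (vector [r, 0, x3 p])) = vector [r, 0, x3 p]"
    by (simp add: Abs_S2_inverse)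
  then have "x1 (Abs_S2 (vector [r, 0, x3 p])) = r" "x2 (Abs_S2 (vector [r, 0, x3 p])) = 0"
    "x3 (Abs_S2 (vector [r, 0, x3 p])) = x3 p"
    by (simp_all add: S2_coord_def)
  then have "S2_rotate t (Abs_S2 (vector [r, 0, x3 p])) = p"
    by (intro S2_eqI3) (simp_all add: S2_coord_rotate t)
  then have "f p = f (Abs_S2 (vector [r, 0, x3 p]))"
    using rot_zero_imp_invariant [OF f R] by metis
  then show ?thesis
    using S2_extend_Rep [of f "Abs_S2 (vector [r, 0, x3 p])", unfolded q]
    by (simp add: profile_def r_def)
qed

subsection \<open>Integration and division in the height variable\<close>

lemma smooth_on_of_derivative:
  assumes "open U" "\<And>s. s \<in> U \<Longrightarrow> (F has_real_derivative G s) (at s)" "smooth_on G U"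
  shows "smooth_on F U"
proof -
  have "Ck_on (Suc k) F U" for k
  proof (rule Ck_on_SucI [OF assms(1)])
    show "(F has_derivative (\<lambda>v. G s * v)) (at s)" if "s \<in> U" for s
      using assms(2) [OF that] by (simp add: has_field_derivative_def)
    show "Ck_on k (\<lambda>s. G s * v) U" for v
      using assms(3) by (intro Ck_on_mult [OF assms(1)] Ck_on_const) (simp add: smooth_on_def)
  qed
  then show ?thesis using Ck_on_Suc_imp assms(1) unfolding smooth_on_def by blast
qed

text \<open>The quotient is the mean of the derivative over the interval from \<open>c\<close> to \<open>s\<close>.\<close>

lemma smooth_on_hadamard_real:
  fixes H :: "real \<Rightarrow> real"
  assumes H: "smooth_on H {a<..<b}" and c: "c \<in> {a<..<b}"
  obtains Q where "smooth_on Q {a<..<b}" "\<And>s. s \<in> {a<..<b} \<Longrightarrow> H s - H c = (s - c) * Q s"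
proof -
  define D where "D = (\<lambda>s. frechet_derivative H (at s) 1)"
  define W where "W = {z::real \<times> real. c + fst z * (snd z - c) \<in> {a<..<b}}"
  have D: "smooth_on D {a<..<b}" unfolding D_def by (rule smooth_on_derivative [OF H])
  have HD: "(H has_real_derivative D s) (at s)" if "s \<in> {a<..<b}" for s
  proof -
    have d: "(H has_derivative frechet_derivative H (at s)) (at s)"
      by (rule smooth_on_has_derivative [OF H that])
    have "frechet_derivative H (at s) v = D s * v" for v
    proof -
      have "frechet_derivative H (at s) (v *\<^sub>R 1) = v *\<^sub>R frechet_derivative H (at s) 1"
        by (rule linear_cmul [OF has_derivative_linear [OF d]])
      then show ?thesis
        unfolding D_def real_scaleR_def mult_1_right by (rule trans) (rule mult.commute)
    qed
    then have "frechet_derivative H (at s) = (\<lambda>v. D s * v)" by (rule ext)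
    then show ?thesis using d by (simp add: has_field_derivative_def)
  qed
  have W: "open W"
    unfolding W_def greaterThanLessThan_iff
    by (intro open_Collect_conj open_Collect_less continuous_intros)
  have inW: "(t, s) \<in> W" if "t \<in> {0..1}" "s \<in> {a<..<b}" for t s
  proof -
    have "c + t * (s - c) = (1 - t) * c + t * s" by (simp add: algebra_simps)
    also have "\<dots> \<in> {a<..<b}"
      using convexD [OF convex_real_interval(8) [of a b] c that(2), of "1 - t" t] that(1) by simp
    finally show ?thesis by (simp add: W_def)
  qed
  have DW: "smooth_on (\<lambda>z. D (c + fst z * (snd z - c))) W"
  proof (rule smooth_on_compose_real [OF D])
    show "smooth_on (\<lambda>z. c + fst z * (snd z - c)) W"
      by (intro smooth_on_add smooth_on_mult smooth_on_const smooth_on_fst W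
          smooth_on_diff [OF smooth_on_linear [OF bounded_linear_snd] smooth_on_const])
  qed (simp add: W_def)
  define Q where "Q = (\<lambda>s. integral {0..1} (\<lambda>t. D (c + fst (t, s) * (snd (t, s) - c))))"
  have Qs: "smooth_on Q {a<..<b}"
    unfolding Q_def by (rule smooth_on_integral_parameter [OF DW]) (use inW in auto)
  have "H s - H c = (s - c) * Q s" if s: "s \<in> {a<..<b}" for s
  proof -
    have "((\<lambda>t. (s - c) * D (c + t * (s - c))) has_integral
        (H (c + 1 * (s - c)) - H (c + 0 * (s - c)))) {0..1}"
    proof (rule fundamental_theorem_of_calculus)
      fix t :: real assume t: "t \<in> {0..1}"
      have "(H has_real_derivative D (c + t * (s - c))) (at (c + t * (s - c)))"
        using inW [OF t s] by (intro HD) (simp add: W_def)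
      moreover have "((\<lambda>t. c + t * (s - c)) has_real_derivative (s - c)) (at t)"
        by (auto intro!: derivative_eq_intros)
      ultimately have "((\<lambda>t. H (c + t * (s - c))) has_real_derivative D (c + t * (s - c)) * (s - c)) (at t)"
        by (rule DERIV_chain2)
      then show "((\<lambda>t. H (c + t * (s - c))) has_vector_derivative (s - c) * D (c + t * (s - c))) (at t within {0..1})"
        by (simp add: has_real_derivative_iff_has_vector_derivative [symmetric] mult.commute
            has_field_derivative_at_within)
    qed simp
    from integral_unique [OF this] show ?thesis by (simp add: Q_def)
  qed
  then show thesis using Qs that by blast
qed

lemma norm_meridian: "s \<in> {-1..1} \<Longrightarrow> norm (vector [sqrt (1 - s\<^sup>2), 0, s] :: real^3) = 1"
  by (auto simp: norm_vec_def L2_set_def sum_3 abs_square_le_1 abs_le_iff)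

lemma continuous_on_vector3:
  assumes "continuous_on S a" "continuous_on S b" "continuous_on S c"
  shows "continuous_on S (\<lambda>t. vector [a t, b t, c t] :: real^3)"
proof -
  have "continuous_on S (\<lambda>t. \<chi> i. (vector [a t, b t, c t] :: real^3) $ i)"
  proof (rule continuous_on_vec_lambda)
    fix i :: 3
    have "i = 1 \<or> i = 2 \<or> i = 3" using UNIV_3 by auto
    then show "continuous_on S (\<lambda>t. (vector [a t, b t, c t] :: real^3) $ i)" using assms by auto
  qed
  then show ?thesis by simp
qed

lemma smooth_on_vector3:
  assumes "smooth_on a U" "smooth_on b U" "smooth_on c U" "e \<in> Basis"
  shows "smooth_on (\<lambda>t. (vector [a t, b t, c t] :: real^3) \<bullet> e) U"
proof -
  have "smooth_on (\<lambda>t. (vector [a t, b t, c t] :: real^3) $ i) U" for i :: 3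
  proof -
    have "i = 1 \<or> i = 2 \<or> i = 3" using UNIV_3 by auto
    then show ?thesis using assms by auto
  qed
  then show ?thesis using assms(4) by (auto simp: Basis_vec_def inner_axis)
qed

lemma profile_continuous:
  assumes f: "f \<in> smooth_S2"
  shows "continuous_on {-1..1} (profile f)"
proof -
  have "continuous_on (- {0}) (S2_extend f)"
    by (rule smooth_on_imp_continuous_on [OF smooth_on_S2_extend [OF f]])
  moreover have "continuous_on {-1..1} (\<lambda>s::real. vector [sqrt (1 - s\<^sup>2), 0, s] :: real^3)"
    by (intro continuous_on_vector3 continuous_intros)
  moreover have "(\<lambda>s::real. vector [sqrt (1 - s\<^sup>2), 0, s] :: real^3) ` {-1..1} \<subseteq> - {0}"
  proof (intro image_subsetI ComplI)
    fix s :: real assume "s \<in> {-1..1}" "(vector [sqrt (1 - s\<^sup>2), 0, s] :: real^3) \<in> {0}"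
    then show False using norm_meridian [of s] by simp
  qed
  ultimately show ?thesis
    unfolding profile_def [abs_def] by (rule continuous_on_compose2)
qed

lemma profile_smooth:
  assumes f: "f \<in> smooth_S2"
  shows "smooth_on (profile f) {-1<..<1}"
  unfolding profile_def [abs_def]
proof (rule smooth_on_compose [OF smooth_on_S2_extend [OF f]])
  fix s :: real assume s: "s \<in> {-1<..<1}"
  have "norm (vector [sqrt (1 - s\<^sup>2), 0, s] :: real^3) = 1" by (rule norm_meridian) (use s in auto)
  then show "(vector [sqrt (1 - s\<^sup>2), 0, s] :: real^3) \<in> - {0}"
    by (metis ComplI norm_zero singletonD zero_neq_one)
next
  fix e :: "real^3" assume "e \<in> Basis"
  then show "smooth_on (\<lambda>s. (vector [sqrt (1 - s\<^sup>2), 0, s] :: real^3) \<bullet> e) {-1<..<1}"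
    by (intro smooth_on_vector3 smooth_on_sqrt smooth_on_diff smooth_on_power2 smooth_on_const
        smooth_on_ident) (auto simp: abs_square_less_1 abs_less_iff)
qed auto

lemma height_range: "x3 p \<in> {-1..1}"
proof -
  have "(x3 p)\<^sup>2 \<le> 1"
    using S2_coord_sq [of p] zero_le_power2 [of "x1 p"] zero_le_power2 [of "x2 p"] by linarith
  then show ?thesis by (simp add: abs_square_le_1 abs_le_iff)
qed

lemma height_interior: "x3 p \<in> {-1<..<1} \<longleftrightarrow> (x3 p)\<^sup>2 \<noteq> 1"
  using height_range [of p] by (auto simp: power2_eq_1_iff)

lemma smooth_on_height:
  assumes "smooth_on F V"
  shows "smooth_on (\<lambda>x::real^3. F (x $ 3)) {x. x $ 3 \<in> V}"
proof -
  have "open {x::real^3. x $ 3 \<in> V}"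
    using open_vimage_vec_nth [OF smooth_on_imp_open [OF assms], of 3] by (simp add: vimage_def)
  then show ?thesis
    by (intro smooth_on_compose_real [OF assms] smooth_on_vec_nth) auto
qed

text \<open>Away from the circle one can divide, and near the circle the quotient is a smooth function of the height
  by \<open>smooth_on_hadamard_real\<close>.\<close>

theorem invariant_divide_height:
  assumes f: "f \<in> smooth_S2" and R: "S2_rot f = 0" and c: "\<bar>c\<bar> < 1"
  obtains a q where "q \<in> smooth_S2" "S2_rot q = 0" "\<And>p. f p = a + (c - x3 p) * q p"
proof -
  have cI: "c \<in> {-1<..<1}" using c by auto
  obtain Q where Q: "smooth_on Q {-1<..<1}"
    and eq: "\<And>s. s \<in> {-1<..<1} \<Longrightarrow> profile f s - profile f c = (s - c) * Q s"
    by (rule smooth_on_hadamard_real [OF profile_smooth [OF f] cI], rule that)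
  define q where "q = (\<lambda>p. if x3 p = c then - Q c else (f p - profile f c) / (c - x3 p))"
  have qQ: "q p = - Q (x3 p)" if "x3 p \<in> {-1<..<1}" for p
    using eq [OF that] by (simp add: q_def invariant_eq_profile [OF f R] field_simps)
  have qs: "q \<in> smooth_S2"
    unfolding smooth_S2_def
  proof (intro CollectI allI)
    fix p
    show "\<exists>U F. Rep_S2 p \<in> U \<and> smooth_on F U \<and> (\<forall>q'. Rep_S2 q' \<in> U \<longrightarrow> q q' = F (Rep_S2 q'))"
    proof (cases "x3 p = c")
      case True
      have "smooth_on (\<lambda>x::real^3. 0 - Q (x $ 3)) {x. x $ 3 \<in> {-1<..<1}}"
        using smooth_on_height [OF Q] by (intro smooth_on_diff smooth_on_const smooth_on_imp_open)
      then show ?thesis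
        using True cI qQ
        by (intro exI [of _ "{x. x $ 3 \<in> {-1<..<1}}"] exI [of _ "\<lambda>x. 0 - Q (x $ 3)"])
           (auto simp: S2_coord_def)
    next
      case False
      let ?U = "{x::real^3. x \<noteq> 0 \<and> x $ 3 \<noteq> c}"
      have U: "open ?U" by (intro open_Collect_conj open_Collect_neq continuous_intros)
      have "smooth_on (\<lambda>x. (S2_extend f x - profile f c) / (c - x $ 3)) ?U"
        by (intro smooth_on_divide smooth_on_diff smooth_on_const U smooth_on_vec_nth
            smooth_on_subset [OF smooth_on_S2_extend [OF f]]) auto
      then show ?thesis
        using False
        by (intro exI [of _ ?U] exI [of _ "\<lambda>x. (S2_extend f x - profile f c) / (c - x $ 3)"])
           (auto simp: S2_coord_def q_def)
    qed
  qed
  have fq: "f p = profile f c + (c - x3 p) * q p" for p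
    using invariant_eq_profile [OF f R, of p] by (simp add: q_def)
  have "f = (\<lambda>p. profile f c) + ((\<lambda>p. c) - x3) * q" using fq by (simp add: fun_eq_iff)
  then have "S2_rot f = S2_rot ((\<lambda>p. profile f c) + ((\<lambda>p. c) - x3) * q)" by simp
  then have "(c - x3 p) * S2_rot q p = 0" for p
    using R qs
    by (simp add: derivationD [OF derivation_rot] derivation_minus [OF derivation_rot]
        derivation_const [OF derivation_rot] S2_rot_coord fun_eq_iff)
  then have "S2_rot q = 0" by (intro cancel_height [OF c]) (simp_all add: qs)
  then show thesis using qs fq that by blast
qed

lemma S2_D_function_of_height:
  assumes "\<And>q. f q = F (x3 q)" and F: "(F has_real_derivative d) (at (x3 p))"
  shows "S2_D i f p = d * S2_D i x3 p"
proof -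
  have e: "S2_extend f = (\<lambda>x. F (S2_extend x3 x))" by (simp add: S2_extend_def assms(1) fun_eq_iff)
  have "((\<lambda>x. F (S2_extend x3 x)) has_derivative (\<lambda>v. d * (S2_grad x3 p \<bullet> v))) (at (Rep_S2 p))"
    using F by (intro has_derivative_compose [OF S2_extend_has_derivative [OF S2_coord_smooth], where g = F])
      (simp add: has_field_derivative_def)
  then have "S2_grad f p = d *\<^sub>R S2_grad x3 p"
    unfolding e [symmetric] by (intro S2_grad_eqI) simp
  then show ?thesis by (simp add: S2_D_def)
qed

text \<open>The primitive \<open>w\<close> of the profile is a smooth function of the height between the poles. Near the pole of
  sign \<open>\<sigma>\<close>, use \<open>x1\<close> and \<open>x2\<close> as coordinates and integrate along the radius: with \<open>r\<^sup>2 = x1\<^sup>2 + x2\<^sup>2\<close>, the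
  substitution \<open>s = \<sigma> sqrt (1 - t\<^sup>2 r\<^sup>2)\<close> turns the integral of the profile from the height to the pole into \<open>\<sigma> r\<^sup>2\<close> times
  an integral over \<open>t\<close> that depends smoothly on the point. Since \<open>r\<^sup>2 = 1 - x3\<^sup>2\<close>, this yields smoothness at
  the poles together with the factorisation.\<close>

theorem invariant_primitive:
  assumes f: "f \<in> smooth_S2" and R: "S2_rot f = 0"
  obtains W g a b where "W \<in> smooth_S2" "g \<in> smooth_S2" "S2_rot W = 0"
    "\<And>p. S2_D 3 W p = (1 - (x3 p)\<^sup>2) * f p"
    "\<And>p. W p = (1 - (x3 p)\<^sup>2) * g p + a * x3 p + b"
proof -
  define H where "H = profile f"
  define w where "w = (\<lambda>s. integral {-1..s} H)"
  have Hc: "continuous_on {-1..1} H" unfolding H_def by (rule profile_continuous [OF f])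
  have fH: "f p = H (x3 p)" for p unfolding H_def by (rule invariant_eq_profile [OF f R])
  have wc: "continuous_on {-1..1} w"
    unfolding w_def by (rule indefinite_integral_continuous_1 [OF integrable_continuous_interval [OF Hc]])
  have wd: "(w has_real_derivative H s) (at s)" if "s \<in> {-1<..<1}" for s
  proof -
    have "(w has_real_derivative H s) (at s within {-1..1})"
      unfolding w_def by (rule integral_has_real_derivative [OF Hc]) (use that in simp)
    moreover have "at s within {-1..1} = at s" using that by (intro at_within_Icc_at) auto
    ultimately show ?thesis by simp
  qed
  have ws: "smooth_on w {-1<..<1}"
    by (rule smooth_on_of_derivative [OF _ wd]) (auto simp: H_def profile_smooth [OF f])
  \<comment> \<open>the affine function \<open>a s + b\<close> interpolates \<open>w\<close> at the two poles\<close>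
  define a where "a = (w 1 - w (- 1)) / 2"
  define b where "b = (w 1 + w (- 1)) / 2"
  \<comment> \<open>the point of the hemisphere of sign \<open>\<sigma>\<close> above \<open>t\<close> times the first two coordinates\<close>
  define \<gamma> where "\<gamma> = (\<lambda>\<sigma> (z::real \<times> (real^3)). vector [fst z * snd z $ 1, fst z * snd z $ 2,
      \<sigma> * sqrt (1 - (fst z)\<^sup>2 * ((snd z $ 1)\<^sup>2 + (snd z $ 2)\<^sup>2))] :: real^3)"
  define K where "K = (\<lambda>\<sigma> z. fst z * (S2_extend f (\<gamma> \<sigma> z) /
      sqrt (1 - (fst z)\<^sup>2 * ((snd z $ 1)\<^sup>2 + (snd z $ 2)\<^sup>2))))"
  define W where "W = {z::real \<times> (real^3). (fst z)\<^sup>2 * ((snd z $ 1)\<^sup>2 + (snd z $ 2)\<^sup>2) < 1}"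
  define V where "V = {x::real^3. (x $ 1)\<^sup>2 + (x $ 2)\<^sup>2 < 1}"
  have Wo: "open W" unfolding W_def by (intro open_Collect_less continuous_intros)
  have Vo: "open V" unfolding V_def by (intro open_Collect_less continuous_intros)
  have VW: "{0..1} \<times> V \<subseteq> W"
  proof clarify
    fix t :: real and x assume t: "t \<in> {0..1}" and x: "x \<in> V"
    have "t\<^sup>2 * ((x $ 1)\<^sup>2 + (x $ 2)\<^sup>2) \<le> 1 * ((x $ 1)\<^sup>2 + (x $ 2)\<^sup>2)"
      using t by (intro mult_right_mono) (auto simp: power_le_one)
    then show "(t, x) \<in> W" using x by (simp add: V_def W_def)
  qed
  have \<gamma>norm: "norm (\<gamma> \<sigma> z) = 1" if "\<sigma> \<in> {-1, 1}" "z \<in> W" for \<sigma> z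
    using that by (auto simp: \<gamma>_def W_def norm_vec_def L2_set_def sum_3 power_mult_distrib algebra_simps)
  have Ks: "smooth_on (K \<sigma>) W" if \<sigma>: "\<sigma> \<in> {-1, 1}" for \<sigma>
  proof -
    have sq: "smooth_on (\<lambda>z. sqrt (1 - (fst z)\<^sup>2 * ((snd z $ 1)\<^sup>2 + (snd z $ 2)\<^sup>2))) W"
      by (intro smooth_on_sqrt smooth_on_diff smooth_on_const smooth_on_mult smooth_on_add
          smooth_on_power2 smooth_on_fst smooth_on_snd_nth Wo) (auto simp: W_def)
    have "smooth_on (\<lambda>z. S2_extend f (\<gamma> \<sigma> z)) W"
    proof (rule smooth_on_compose [OF smooth_on_S2_extend [OF f] Wo])
      show "\<gamma> \<sigma> z \<in> - {0}" if "z \<in> W" for z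
        using \<gamma>norm [OF \<sigma> that] by auto
      show "smooth_on (\<lambda>z. \<gamma> \<sigma> z \<bullet> e) W" if "e \<in> Basis" for e
        unfolding \<gamma>_def
        by (intro smooth_on_vector3 smooth_on_mult smooth_on_const sq smooth_on_fst smooth_on_snd_nth
            Wo that)
    qed
    then show ?thesis
      unfolding K_def by (intro smooth_on_mult smooth_on_divide smooth_on_fst sq Wo) (auto simp: W_def)
  qed
  define N where "N = (\<lambda>\<sigma> x. integral {0..1} (\<lambda>t. K \<sigma> (t, x)))"
  have Ns: "smooth_on (N \<sigma>) V" if "\<sigma> \<in> {-1, 1}" for \<sigma>
    unfolding N_def by (rule smooth_on_integral_parameter [OF Ks [OF that] Vo VW])
  have wN: "w (x3 p) = w \<sigma> - \<sigma> * (1 - (x3 p)\<^sup>2) * N \<sigma> (Rep_S2 p)"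
    if \<sigma>: "\<sigma> \<in> {-1, 1}" and p: "\<sigma> * x3 p > 0" for \<sigma> p
  proof -
    define r where "r = (x1 p)\<^sup>2 + (x2 p)\<^sup>2"
    have r: "r = 1 - (x3 p)\<^sup>2" using S2_coord_sq [of p] by (simp add: r_def)
    have r1: "0 \<le> r" "r < 1" using p by (auto simp: r_def) (auto simp: r_def [symmetric] r)
    define s where "s = (\<lambda>t. \<sigma> * sqrt (1 - t\<^sup>2 * r))"
    have tr: "t\<^sup>2 * r < 1" if "t \<in> {0..1}" for t
    proof -
      have "t\<^sup>2 * r \<le> 1 * r" using that r1 by (intro mult_right_mono) (auto simp: power_le_one)
      then show ?thesis using r1 by simp
    qed
    have s2: "(s t)\<^sup>2 = 1 - t\<^sup>2 * r" if "t \<in> {0..1}" for t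
      using \<sigma> tr [OF that] by (auto simp: s_def)
    have srange: "s t \<in> {-1..1}" if "t \<in> {0..1}" for t
    proof -
      have "(s t)\<^sup>2 \<le> 1" using s2 [OF that] r1 by simp
      then show ?thesis by (simp add: abs_square_le_1 abs_le_iff)
    qed
    have K: "K \<sigma> (t, Rep_S2 p) = t * (H (s t) / sqrt (1 - t\<^sup>2 * r))" if t: "t \<in> {0..1}" for t
    proof -
      have z: "(t, Rep_S2 p) \<in> W" using tr [OF t] by (simp add: W_def r_def S2_coord_def)
      have q: "Rep_S2 (Abs_S2 (\<gamma> \<sigma> (t, Rep_S2 p))) = \<gamma> \<sigma> (t, Rep_S2 p)"
        by (simp add: Abs_S2_inverse \<gamma>norm [OF \<sigma> z])
      have "S2_extend f (\<gamma> \<sigma> (t, Rep_S2 p)) = H (x3 (Abs_S2 (\<gamma> \<sigma> (t, Rep_S2 p))))"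
        using S2_extend_Rep [of f "Abs_S2 (\<gamma> \<sigma> (t, Rep_S2 p))"] q fH by simp
      also have "x3 (Abs_S2 (\<gamma> \<sigma> (t, Rep_S2 p))) = s t"
        unfolding S2_coord_def q by (simp add: \<gamma>_def s_def r_def S2_coord_def)
      finally show ?thesis by (simp add: K_def r_def S2_coord_def)
    qed
    show ?thesis
    proof (cases "r = 0")
      case True
      then have "(x3 p)\<^sup>2 = 1" using r by simp
      then have "x3 p = \<sigma>" using \<sigma> p by (auto simp: power2_eq_1_iff)
      then show ?thesis using \<open>(x3 p)\<^sup>2 = 1\<close> by simp
    next
      case False
      have "((\<lambda>t. - \<sigma> * r * K \<sigma> (t, Rep_S2 p)) has_integral (w (s 1) - w (s 0))) {0..1}"
      proof (rule fundamental_theorem_of_calculus_interior)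
        have "continuous_on {0..1} s" unfolding s_def by (intro continuous_intros)
        then show "continuous_on {0..1} (\<lambda>t. w (s t))"
          using srange by (intro continuous_on_compose2 [OF wc]) auto
        fix t :: real assume t: "t \<in> {0<..<1}"
        then have t': "t \<in> {0..1}" by simp
        have "(s t)\<^sup>2 < 1" using s2 [OF t'] t r1 False by simp
        then have "s t \<in> {-1<..<1}" by (simp add: abs_square_less_1 abs_less_iff)
        then have "(w has_real_derivative H (s t)) (at (s t))" by (rule wd)
        moreover have "(s has_real_derivative (- \<sigma> * r * (t / sqrt (1 - t\<^sup>2 * r)))) (at t)"
          unfolding s_def using tr [OF t']
          by (auto intro!: derivative_eq_intros simp: field_simps)
        ultimately have "((\<lambda>t. w (s t)) has_real_derivative
            H (s t) * (- \<sigma> * r * (t / sqrt (1 - t\<^sup>2 * r)))) (at t)"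
          by (rule DERIV_chain2)
        then show "((\<lambda>t. w (s t)) has_vector_derivative - \<sigma> * r * K \<sigma> (t, Rep_S2 p)) (at t)"
          by (simp add: has_real_derivative_iff_has_vector_derivative [symmetric] K [OF t'] mult_ac)
      qed simp
      from integral_unique [OF this] have "w (s 1) - w (s 0) = - \<sigma> * r * N \<sigma> (Rep_S2 p)"
        by (simp add: N_def)
      moreover have "s 0 = \<sigma>" by (simp add: s_def)
      moreover have "s 1 = x3 p" using \<sigma> p by (auto simp: s_def r)
      ultimately show ?thesis by (simp add: r)
    qed
  qed
  \<comment> \<open>the quotient \<open>g\<close> near the pole of sign \<open>\<sigma>\<close>, with the factor \<open>1 - \<sigma> x3\<close> cancelled\<close>
  define G where "G = (\<lambda>\<sigma> (x::real^3). \<sigma> * (a / (1 + \<sigma> * x $ 3) - N \<sigma> x))"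
  define g where "g = (\<lambda>p. if x3 p \<in> {-1<..<1} then (w (x3 p) - a * x3 p - b) / (1 - (x3 p)\<^sup>2)
      else G (x3 p) (Rep_S2 p))"
  have gG: "g p = G \<sigma> (Rep_S2 p)" if \<sigma>: "\<sigma> \<in> {-1, 1}" and p: "\<sigma> * x3 p > 0" for \<sigma> p
  proof (cases "x3 p \<in> {-1<..<1}")
    case True
    then have nz: "1 - (x3 p)\<^sup>2 \<noteq> 0" using height_interior [of p] by simp
    have fac: "1 - (x3 p)\<^sup>2 = (1 + \<sigma> * x3 p) * (1 - \<sigma> * x3 p)"
      using \<sigma> by (auto simp: power2_eq_square algebra_simps)
    then have nz': "1 + \<sigma> * x3 p \<noteq> 0" using nz by auto
    have ab: "w \<sigma> - a * x3 p - b = a * \<sigma> * (1 - \<sigma> * x3 p)"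
      using \<sigma> by (auto simp: a_def b_def field_simps)
    have "w (x3 p) - a * x3 p - b = (1 - (x3 p)\<^sup>2) * G \<sigma> (Rep_S2 p)"
    proof -
      have "(1 - (x3 p)\<^sup>2) * G \<sigma> (Rep_S2 p) = \<sigma> * ((1 + \<sigma> * x3 p) * (1 - \<sigma> * x3 p) * (a / (1 + \<sigma> * x3 p)))
          - \<sigma> * (1 - (x3 p)\<^sup>2) * N \<sigma> (Rep_S2 p)"
        by (simp add: G_def S2_coord_def [symmetric] fac algebra_simps)
      also have "(1 + \<sigma> * x3 p) * (1 - \<sigma> * x3 p) * (a / (1 + \<sigma> * x3 p)) = (1 - \<sigma> * x3 p) * a"
        using nz' by simp
      finally show ?thesis using wN [OF \<sigma> p] ab by (simp add: algebra_simps)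
    qed
    then show ?thesis using True nz by (simp add: g_def)
  next
    case False
    then have "x3 p = 1 \<or> x3 p = -1" using height_range [of p] by auto
    then have "x3 p = \<sigma>" using \<sigma> p by auto
    then show ?thesis using False \<sigma> by (auto simp: g_def)
  qed
  have gs: "g \<in> smooth_S2"
    unfolding smooth_S2_def
  proof (intro CollectI allI)
    fix p
    show "\<exists>U F. Rep_S2 p \<in> U \<and> smooth_on F U \<and> (\<forall>q. Rep_S2 q \<in> U \<longrightarrow> g q = F (Rep_S2 q))"
    proof (cases "x3 p \<in> {-1<..<1}")
      case True
      let ?F = "\<lambda>s. (w s - a * s - b) / (1 - s\<^sup>2)"
      have "smooth_on ?F {-1<..<1}"
        by (intro smooth_on_divide smooth_on_diff smooth_on_mult smooth_on_const smooth_on_power2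
            smooth_on_ident ws) (auto simp: power2_eq_1_iff)
      then show ?thesis
        using True smooth_on_height [of ?F "{-1<..<1}"]
        by (intro exI [of _ "{x. x $ 3 \<in> {-1<..<1}}"] exI [of _ "\<lambda>x. ?F (x $ 3)"])
           (simp add: g_def S2_coord_def)
    next
      case False
      define \<sigma> where "\<sigma> = x3 p"
      have \<sigma>: "\<sigma> \<in> {-1, 1}" using False height_range [of p] by (auto simp: \<sigma>_def)
      let ?U = "{x\<in>V. \<sigma> * x $ 3 > 0}"
      have "?U = V \<inter> {x. \<sigma> * x $ 3 > 0}" by blast
      then have U: "open ?U"
        using Vo by (auto intro!: open_Int open_Collect_less continuous_intros)
      have "smooth_on (G \<sigma>) ?U"
        unfolding G_def
        by (intro smooth_on_divide smooth_on_diff smooth_on_add smooth_on_mult smooth_on_const U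
            smooth_on_vec_nth smooth_on_subset [OF Ns [OF \<sigma>]]) auto
      moreover have "Rep_S2 p \<in> ?U"
      proof -
        have "(x1 p)\<^sup>2 + (x2 p)\<^sup>2 = 0" using \<sigma> S2_coord_sq [of p] by (auto simp: \<sigma>_def)
        then show ?thesis using \<sigma> by (auto simp: V_def S2_coord_def \<sigma>_def)
      qed
      ultimately show ?thesis
        using gG [OF \<sigma>] by (intro exI [of _ ?U] exI [of _ "G \<sigma>"]) (auto simp: S2_coord_def)
    qed
  qed
  define F where "F = (\<lambda>p. w (x3 p))"
  have Feq: "F p = (1 - (x3 p)\<^sup>2) * g p + a * x3 p + b" for p
  proof (cases "x3 p \<in> {-1<..<1}")
    case True
    then show ?thesis using height_interior [of p] by (simp add: F_def g_def)
  next
    case False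
    then have "x3 p = 1 \<or> x3 p = -1" using height_range [of p] by auto
    then show ?thesis by (auto simp: F_def a_def b_def field_simps)
  qed
  have "F = (1 - x3 * x3) * g + (\<lambda>p. a * x3 p) + (\<lambda>p. b)"
    using Feq by (simp add: fun_eq_iff power2_eq_square)
  then have Fs: "F \<in> smooth_S2" using gs by simp
  have D: "S2_D i F p = f p * S2_D i x3 p" if "x3 p \<in> {-1<..<1}" for i p
    using S2_D_function_of_height [of F w, OF _ wd [OF that]] fH [of p] by (simp add: F_def)
  have pole: "x1 p = 0" "x2 p = 0" "(x3 p)\<^sup>2 = 1" if "x3 p \<notin> {-1<..<1}" for p
    using that pole_iff [of p] height_interior [of p] by auto
  have "S2_D 3 F p = (1 - (x3 p)\<^sup>2) * f p" for p
  proof (cases "x3 p \<in> {-1<..<1}")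
    case True
    then show ?thesis using D [of p 3] by (simp add: S2_D_coord power2_eq_square)
  next
    case False
    note p = pole [OF False]
    have "x3 p \<noteq> 0" using p(3) by auto
    then show ?thesis using S2_D_tangent [OF Fs, of p] p by simp
  qed
  moreover have "S2_rot F p = 0" for p
  proof (cases "x3 p \<in> {-1<..<1}")
    case True
    then show ?thesis using D [of p 1] D [of p 2] by (simp add: S2_rot_def S2_D_coord)
  next
    case False
    then show ?thesis using pole [OF False] by (simp add: S2_rot_def)
  qed
  then have "S2_rot F = 0" by (simp add: fun_eq_iff)
  ultimately show thesis using Fs gs Feq that by blast
qed

subsection \<open>Invariant functions vanishing at the poles\<close>

lemma meridian_point:
  assumes "s \<in> {-1..1}"
  obtains p where "x1 p = sqrt (1 - s\<^sup>2)" "x2 p = 0" "x3 p = s"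
proof -
  have "Rep_S2 (Abs_S2 (vector [sqrt (1 - s\<^sup>2), 0, s])) = vector [sqrt (1 - s\<^sup>2), 0, s]"
    using norm_meridian [OF assms] by (simp add: Abs_S2_inverse)
  then show thesis
    using that [of "Abs_S2 (vector [sqrt (1 - s\<^sup>2), 0, s])"] by (simp add: S2_coord_def)
qed

lemma D3_rot_zero_imp_const:
  assumes f: "f \<in> smooth_S2" and "S2_D 3 f = 0" "S2_rot f = 0"
  shows "f p = f q"
proof (rule S2_D_zero_imp_const [OF f])
  show "S2_D i f = 0" for i
    using derivation_decompose [OF derivation_S2_D f, of _ i] assms(2,3) f
    by (intro cancel_poles) simp_all
qed

lemma poleD:
  assumes "(x3 p)\<^sup>2 = 1"
  shows "x1 p = 0" "x2 p = 0" "x3 p \<noteq> 0"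
  using assms pole_iff [of p] by auto

lemma S2_D3_pole:
  assumes f: "f \<in> smooth_S2" and p: "(x3 p)\<^sup>2 = 1"
  shows "S2_D 3 f p = 0"
proof -
  have "x1 p = 0" "x2 p = 0" "x3 p \<noteq> 0" using poleD [OF p] by auto
  then show ?thesis using S2_D_tangent [OF f, of p] by simp
qed

lemma rot_poles_mult:
  assumes "g \<in> smooth_S2"
  shows "S2_rot ((1 - x3 * x3) * g) = (1 - x3 * x3) * S2_rot g"
  using assms derivation_const [OF derivation_rot, of 1]
  by (simp add: derivationD [OF derivation_rot] derivation_minus [OF derivation_rot] S2_rot_coord
      one_fun_def)

text \<open>The primitive supplied by \<open>invariant_primitive\<close> differs from \<open>G\<close> by a constant. It has equal values at the
  poles, so its affine part is constant.\<close>

lemma primitive_vanishing_at_poles: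
  assumes k: "k \<in> smooth_S2" "S2_rot k = 0"
    and G: "G \<in> smooth_S2" "S2_rot G = 0" "\<And>p. S2_D 3 G p = (1 - (x3 p)\<^sup>2) * k p"
    and poles: "\<And>p. (x3 p)\<^sup>2 = 1 \<Longrightarrow> G p = 0"
  obtains g where "g \<in> smooth_S2" "S2_rot g = 0" "\<And>p. G p = (1 - (x3 p)\<^sup>2) * g p"
proof -
  obtain W g a b where W: "W \<in> smooth_S2" "g \<in> smooth_S2" "S2_rot W = 0"
    "\<And>p. S2_D 3 W p = (1 - (x3 p)\<^sup>2) * k p"
    "\<And>p. W p = (1 - (x3 p)\<^sup>2) * g p + a * x3 p + b"
    by (rule invariant_primitive [OF k], rule that)
  obtain n where n: "x3 n = 1" by (rule meridian_point [of 1]) auto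
  obtain s where s: "x3 s = - 1" by (rule meridian_point [of "-1"]) auto
  have const: "(G - W) p = (G - W) n" for p
  proof (rule D3_rot_zero_imp_const)
    show "G - W \<in> smooth_S2" using G(1) W(1) by simp
    show "S2_D 3 (G - W) = 0" using G(1) W(1) by (simp add: G(3) W(4) fun_eq_iff)
    show "S2_rot (G - W) = 0"
      using G(1,2) W(1,3) by (simp add: derivation_minus [OF derivation_rot])
  qed
  have "W n = W s" using const [of s] poles [of n] poles [of s] n s by simp
  then have a: "a = 0" using W(5) [of n] W(5) [of s] n s by simp
  have Gg: "G p = (1 - (x3 p)\<^sup>2) * g p" for p
    using const [of p] poles [of n] n W(5) [of n] W(5) [of p] a by simp
  then have "G = (1 - x3 * x3) * g" by (simp add: fun_eq_iff power2_eq_square)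
  then have "(1 - x3 * x3) * S2_rot g = 0" using G(2) rot_poles_mult [OF W(2)] by simp
  then have "S2_rot g = 0"
    using W(2) by (intro cancel_poles) (auto simp: fun_eq_iff power2_eq_square)
  then show thesis using W(2) Gg that by blast
qed

text \<open>On invariant functions, the Laplacian \<open>L\<close> satisfies \<open>(1 - x3\<^sup>2) L = S2_D 3 (S2_D 3 G)\<close>. Thus \<open>S2_D 3 G\<close>, which
  vanishes at the poles, is a primitive of \<open>L\<close> in the height and hence divisible by \<open>1 - x3\<^sup>2\<close>. The quotient has \<open>G\<close>
  as primitive, and the same argument applies once more.\<close>

theorem invariant_divide_poles:
  assumes G: "G \<in> smooth_S2" "S2_rot G = 0" and poles: "\<And>p. (x3 p)\<^sup>2 = 1 \<Longrightarrow> G p = 0"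
  obtains g where "g \<in> smooth_S2" "S2_rot g = 0" "\<And>p. G p = (1 - (x3 p)\<^sup>2) * g p"
proof -
  \<comment> \<open>the gradient field of \<open>G\<close>\<close>
  define X where "X = (\<lambda>f. S2_D 1 G * S2_D 1 f + S2_D 2 G * S2_D 2 f + S2_D 3 G * S2_D 3 f)"
  have X: "derivation X"
    unfolding X_def by (intro derivation_add derivation_mult derivation_S2_D S2_D_smooth G)
  have Xi: "X x1 = S2_D 1 G" "X x2 = S2_D 2 G" "X x3 = S2_D 3 G"
  proof -
    have "S2_D 1 G p * x1 p + S2_D 2 G p * x2 p + S2_D 3 G p * x3 p = 0" for p
      using S2_D_tangent [OF G(1), of p] by (simp add: mult.commute)
    note t = this
    have "X x1 p = S2_D 1 G p - x1 p * (S2_D 1 G p * x1 p + S2_D 2 G p * x2 p + S2_D 3 G p * x3 p)"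
      "X x2 p = S2_D 2 G p - x2 p * (S2_D 1 G p * x1 p + S2_D 2 G p * x2 p + S2_D 3 G p * x3 p)"
      "X x3 p = S2_D 3 G p - x3 p * (S2_D 1 G p * x1 p + S2_D 2 G p * x2 p + S2_D 3 G p * x3 p)" for p
      by (simp_all add: X_def S2_D_coord algebra_simps)
    then show "X x1 = S2_D 1 G" "X x2 = S2_D 2 G" "X x3 = S2_D 3 G"
      by (simp_all add: t fun_eq_iff)
  qed
  define L where "L = S2_div X"
  have L: "L \<in> smooth_S2" unfolding L_def by (rule S2_div_smooth [OF X])
  have DDG: "S2_D 3 (S2_D 3 G) p = (1 - (x3 p)\<^sup>2) * L p" for p
    using S2_div_decompose [OF X, of p] G(2) derivation_const [OF derivation_rot, of 0]
    unfolding L_def Xi S2_rot_def [symmetric] by (simp add: zero_fun_def)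
  have R0: "S2_rot 0 = 0" using derivation_const [OF derivation_rot, of 0] by (simp add: zero_fun_def)
  have RDG: "S2_rot (S2_D 3 G) = 0" using S2_rot_D3 [OF G(1)] G(2) by simp
  have "S2_D 3 (S2_D 3 G) = (1 - x3 * x3) * L" using DDG by (simp add: fun_eq_iff power2_eq_square)
  moreover have "S2_rot (S2_D 3 (S2_D 3 G)) = 0"
    using S2_rot_D3 [of "S2_D 3 G"] RDG G(1) by simp
  ultimately have "(1 - x3 * x3) * S2_rot L = 0" using rot_poles_mult [OF L] by simp
  then have RL: "S2_rot L = 0"
    using L by (intro cancel_poles) (auto simp: fun_eq_iff power2_eq_square)
  obtain g where g: "g \<in> smooth_S2" "S2_rot g = 0" "\<And>p. S2_D 3 G p = (1 - (x3 p)\<^sup>2) * g p"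
    by (rule primitive_vanishing_at_poles [OF L RL S2_D_smooth [OF G(1)] RDG DDG S2_D3_pole [OF G(1)]])
       (assumption, rule that)
  show thesis
    by (rule primitive_vanishing_at_poles [OF g(1,2) G g(3) poles]) (assumption, rule that)
qed

section \<open>The twisted divergence\<close>

lemma S2_div_mult:
  assumes X: "derivation X" and g: "g \<in> smooth_S2"
  shows "S2_div (\<lambda>f. g * X f) = X g + g * S2_div X"
proof -
  have "X g = X x1 * S2_D 1 g + X x2 * S2_D 2 g + X x3 * S2_D 3 g"
    by (subst derivation_eq [OF X g]) (simp add: sum_3 fun_eq_iff)
  then show ?thesis
    using g by (simp add: S2_div_def derivationD [OF X] fun_eq_iff algebra_simps)
qed

lemma S2_div_D3: "S2_div (S2_D 3) = (\<lambda>p. - 2 * x3 p)"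
proof
  fix p
  have e: "S2_D 3 x1 = - (x3 * x1)" "S2_D 3 x2 = - (x3 * x2)" "S2_D 3 x3 = 1 - x3 * x3"
    by (simp_all add: S2_D_coord fun_eq_iff)
  have "S2_div (S2_D 3) p = - 4 * x3 p + 2 * x3 p * ((x1 p)\<^sup>2 + (x2 p)\<^sup>2 + (x3 p)\<^sup>2)"
    unfolding S2_div_def e by (simp add: S2_D_coord power2_eq_square algebra_simps)
  then show "S2_div (S2_D 3) p = - 2 * x3 p" by (simp add: S2_coord_sq)
qed

lemma S2_div_rot: "S2_div S2_rot = 0"
  by (simp add: S2_div_def S2_rot_coord S2_D_coord fun_eq_iff)

lemma S2_div_add: "derivation X \<Longrightarrow> derivation Y \<Longrightarrow> S2_div (\<lambda>f. X f + Y f) = S2_div X + S2_div Y"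
  by (simp add: S2_div_def derivationD)

lemma S2_div_diff: "derivation X \<Longrightarrow> derivation Y \<Longrightarrow> S2_div (\<lambda>f. X f - Y f) = S2_div X - S2_div Y"
  by (simp add: S2_div_def derivationD)

text \<open>Up to the identification of bivector fields with functions, this is the Poisson differential on vector
  fields, see \<open>poisson_diff_1\<close>. Off the circle it is \<open>(c - x3)\<^sup>2\<close> times the divergence of
  \<open>X / (c - x3)\<close>.\<close>

definition twisted_div :: "real \<Rightarrow> ((S2 \<Rightarrow> real) \<Rightarrow> S2 \<Rightarrow> real) \<Rightarrow> S2 \<Rightarrow> real" where
  "twisted_div c X = (\<lambda>p. X x3 p + (c - x3 p) * S2_div X p)"

lemma twisted_div_decompose:
  assumes v: "v \<in> smooth_S2" and m: "m \<in> smooth_S2"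
  shows "twisted_div c (\<lambda>f. v * S2_D 3 f + m * S2_rot f) p
    = (1 - (x3 p)\<^sup>2) * v p + (c - x3 p) * (S2_D 3 v p - 2 * x3 p * v p) + (c - x3 p) * S2_rot m p"
proof -
  have "S2_div (\<lambda>f. v * S2_D 3 f + m * S2_rot f) p = S2_D 3 v p - 2 * x3 p * v p + S2_rot m p"
    using v m
    by (simp add: S2_div_add derivation_mult derivation_S2_D derivation_rot S2_div_mult S2_div_D3 S2_div_rot)
  then show ?thesis
    unfolding twisted_div_def by (simp add: S2_D_coord S2_rot_coord power2_eq_square) (simp add: algebra_simps)
qed

lemma rot_height_mult:
  assumes "g \<in> smooth_S2"
  shows "S2_rot (((\<lambda>p. c) - x3) * g) = ((\<lambda>p. c) - x3) * S2_rot g"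
  using assms derivation_const [OF derivation_rot, of c]
  by (simp add: derivationD [OF derivation_rot] derivation_minus [OF derivation_rot] S2_rot_coord)

text \<open>Expand \<open>h = h0 + q0 \<phi> + r \<phi>\<^sup>2\<close> with \<open>\<phi> = c - x3\<close>. The required height component \<open>G = (1 - x3\<^sup>2) g\<close>
  is \<open>\<phi> W + \<alpha> \<phi> + \<beta>\<close>, where \<open>W\<close> is a primitive of \<open>r\<close>: the first summand produces \<open>r \<phi>\<^sup>2\<close>, the second solves
  the homogeneous equation, and the constant \<open>\<beta>\<close> produces itself. The term \<open>q0 \<phi>\<close> cannot be produced, and
  \<open>\<alpha>\<close> and \<open>\<beta>\<close> are used up by the two conditions at the poles.\<close>

lemma twisted_div_invariant_solution:
  assumes c: "\<bar>c\<bar> < 1" and h: "h \<in> smooth_S2" "S2_rot h = 0"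
  obtains a b g where "g \<in> smooth_S2"
    "\<And>p. h p = a * (c - x3 p) + b
        + ((1 - (x3 p)\<^sup>2) * g p + (c - x3 p) * (S2_D 3 g p - 2 * x3 p * g p))"
proof -
  obtain h0 q where q: "q \<in> smooth_S2" "S2_rot q = 0" and hq: "\<And>p. h p = h0 + (c - x3 p) * q p"
    by (rule invariant_divide_height [OF h c], rule that)
  obtain q0 r where r: "r \<in> smooth_S2" "S2_rot r = 0" and qr: "\<And>p. q p = q0 + (c - x3 p) * r p"
    by (rule invariant_divide_height [OF q c], rule that)
  obtain W g' a' b' where W: "W \<in> smooth_S2" "g' \<in> smooth_S2" "S2_rot W = 0"
    "\<And>p. S2_D 3 W p = (1 - (x3 p)\<^sup>2) * r p"
    "\<And>p. W p = (1 - (x3 p)\<^sup>2) * g' p + a' * x3 p + b'"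
    by (rule invariant_primitive [OF r], rule that)
  \<comment> \<open>\<open>\<alpha>\<close> and \<open>\<beta>\<close> solve the linear system \<open>G = 0\<close> at the poles, where \<open>W\<close> equals \<open>b' + a'\<close> and \<open>b' - a'\<close>\<close>
  define \<alpha> where "\<alpha> = ((c - 1) * (b' + a') - (c + 1) * (b' - a')) / 2"
  define \<beta> where "\<beta> = - (c - 1) * (b' + a' + \<alpha>)"
  have \<beta>': "\<beta> = - (c + 1) * (b' - a' + \<alpha>)" by (simp add: \<alpha>_def \<beta>_def field_simps)
  define G where "G = ((\<lambda>p. c) - x3) * (W + (\<lambda>p. \<alpha>)) + (\<lambda>p. \<beta>)"
  have Gs: "G \<in> smooth_S2" using W by (simp add: G_def)
  have RG: "S2_rot G = 0"
    using W rot_height_mult [of "W + (\<lambda>p. \<alpha>)" c]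
    by (simp add: G_def derivationD(2) [OF derivation_rot] derivation_const [OF derivation_rot])
  have "G p = 0" if "(x3 p)\<^sup>2 = 1" for p
  proof -
    from that have "x3 p = 1 \<or> x3 p = - 1" by (simp add: power2_eq_1_iff)
    then show ?thesis
    proof
      assume p: "x3 p = 1"
      then have Wp: "W p = b' + a'" using W(5) [of p] by simp
      show ?thesis by (simp add: G_def \<beta>_def p Wp algebra_simps)
    next
      assume p: "x3 p = - 1"
      then have Wp: "W p = b' - a'" using W(5) [of p] by simp
      show ?thesis by (simp add: G_def \<beta>' p Wp algebra_simps)
    qed
  qed
  then obtain g where g: "g \<in> smooth_S2" "S2_rot g = 0" "\<And>p. G p = (1 - (x3 p)\<^sup>2) * g p"
    by (rule invariant_divide_poles [OF Gs RG]) (assumption, rule that)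
  \<comment> \<open>the defect of the equation; it is shown to vanish after multiplication by \<open>1 - x3\<^sup>2\<close>\<close>
  define T where "T = h - (\<lambda>p. q0 * ((\<lambda>p. c) - x3) p) - (\<lambda>p. h0 - \<beta>) - ((1 - x3 * x3) * g
      + ((\<lambda>p. c) - x3) * (S2_D 3 g - (\<lambda>p. 2 * (x3 * g) p)))"
  have Ts: "T \<in> smooth_S2"
    unfolding T_def using h g by (intro smooth_S2_diff smooth_S2_add smooth_S2_mult smooth_S2_scale) simp_all
  have "(1 - (x3 p)\<^sup>2) * T p = 0" for p
  proof -
    have Gg: "G = (1 - x3 * x3) * g" using g(3) by (simp add: fun_eq_iff power2_eq_square)
    have "S2_D 3 G p = (1 - (x3 p)\<^sup>2) * (S2_D 3 g p - 2 * x3 p * g p)"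
      unfolding Gg using g(1) by (simp add: S2_D_coord power2_eq_square algebra_simps)
    moreover have "S2_D 3 G p = - (1 - (x3 p)\<^sup>2) * (W p + \<alpha>) + (c - x3 p) * ((1 - (x3 p)\<^sup>2) * r p)"
      using W(1) by (simp add: G_def S2_D_coord W(4) power2_eq_square algebra_simps)
    moreover have "(1 - (x3 p)\<^sup>2) * g p = (c - x3 p) * (W p + \<alpha>) + \<beta>"
      using g(3) [of p] by (simp add: G_def)
    moreover have "T p = h p - q0 * (c - x3 p) - (h0 - \<beta>) - ((1 - (x3 p)\<^sup>2) * g p
        + (c - x3 p) * (S2_D 3 g p - 2 * x3 p * g p))"
      by (simp add: T_def power2_eq_square algebra_simps)
    ultimately show ?thesis using hq [of p] qr [of p] by algebra
  qed
  then have "T = 0" by (rule cancel_poles [OF Ts])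
  then have "h p = q0 * (c - x3 p) + (h0 - \<beta>)
        + ((1 - (x3 p)\<^sup>2) * g p + (c - x3 p) * (S2_D 3 g p - 2 * x3 p * g p))" for p
    by (simp add: T_def fun_eq_iff power2_eq_square algebra_simps)
  then show thesis using g(1) that by blast
qed

text \<open>The invariant part is \<open>twisted_div_invariant_solution\<close>. For the rest \<open>S2_rot g = (1 - c\<^sup>2) S2_rot k\<close>, take \<open>S2_rot k\<close> as
  coefficient of the height gradient; this produces \<open>(1 - x3\<^sup>2) S2_rot k\<close> and an error \<open>(c - x3)\<close> times an element of
  the image of the rotation. As \<open>1 - x3\<^sup>2 = (1 - c\<^sup>2) + (c - x3) (c + x3)\<close>, the total error has this form and is
  removed by a multiple \<open>m\<close> of the rotation.\<close>

theorem twisted_div_surjective: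
  assumes c: "\<bar>c\<bar> < 1" and h: "h \<in> smooth_S2"
  obtains a b X where "derivation X" "\<And>p. h p = a * (c - x3 p) + b + twisted_div c X p"
proof -
  obtain g where g: "g \<in> smooth_S2" "S2_rot (h - S2_rot g) = 0"
    by (rule rot_decomposition [OF h], rule that)
  obtain a b v where v: "v \<in> smooth_S2" and eq: "\<And>p. (h - S2_rot g) p = a * (c - x3 p) + b
        + ((1 - (x3 p)\<^sup>2) * v p + (c - x3 p) * (S2_D 3 v p - 2 * x3 p * v p))"
    by (rule twisted_div_invariant_solution [OF c _ g(2)]) (use h g in simp, rule that)
  have "c\<^sup>2 < 1" using c by (simp add: abs_square_less_1)
  then have c2: "1 - c\<^sup>2 \<noteq> 0" by simp
  define \<kappa> where "\<kappa> = 1 / (1 - c\<^sup>2)"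
  define k where "k = (\<lambda>p. \<kappa> * g p)"
  have k: "k \<in> smooth_S2" using g by (simp add: k_def)
  have Rg: "S2_rot g p = (1 - c\<^sup>2) * S2_rot k p" for p
    using c2 derivationD(4) [OF derivation_rot g(1), of \<kappa>] by (simp add: k_def \<kappa>_def)
  define m where "m = - (S2_D 3 k + ((\<lambda>p. c) - x3) * k)"
  have m: "m \<in> smooth_S2" using k by (simp add: m_def)
  define X where "X = (\<lambda>f. (v + S2_rot k) * S2_D 3 f + m * S2_rot f)"
  have X: "derivation X"
    unfolding X_def using v k m by (intro derivation_add derivation_mult derivation_S2_D derivation_rot) simp_all
  have "h p = a * (c - x3 p) + b + twisted_div c X p" for p
  proof -
    have "S2_rot m = - S2_rot (S2_D 3 k + ((\<lambda>p. c) - x3) * k)"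
      unfolding m_def using k by (intro derivation_uminus [OF derivation_rot]) simp
    then have Rm: "S2_rot m p = - (S2_D 3 (S2_rot k) p + (c - x3 p) * S2_rot k p)"
      using k rot_height_mult [OF k, of c] by (simp add: derivationD(2) [OF derivation_rot] S2_rot_D3)
    have "twisted_div c X p = (1 - (x3 p)\<^sup>2) * (v p + S2_rot k p)
        + (c - x3 p) * (S2_D 3 v p + S2_D 3 (S2_rot k) p - 2 * x3 p * (v p + S2_rot k p))
        - (c - x3 p) * (S2_D 3 (S2_rot k) p + (c - x3 p) * S2_rot k p)"
      unfolding X_def using v k m by (subst twisted_div_decompose) (simp_all add: Rm algebra_simps)
    moreover have "h p = (h - S2_rot g) p + (1 - c\<^sup>2) * S2_rot k p" using Rg by simp
    ultimately show ?thesis unfolding eq by (simp add: power2_eq_square algebra_simps)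
  qed
  then show thesis using X that by blast
qed

text \<open>Only the invariant part \<open>H\<close> of the height component matters, because the equation splits along
  \<open>rot_decomposition\<close>. Evaluation on the circle gives \<open>H = b + (c - x3) q\<close>, after which the equation reads
  \<open>(1 - x3\<^sup>2) a = (c - x3) S2_D 3 q\<close>. On the circle again, \<open>a = 0\<close>, so \<open>q\<close> is constant, and since \<open>H\<close> vanishes at both
  poles, \<open>b = 0\<close> and \<open>q = 0\<close>.\<close>

theorem twisted_div_injective:
  assumes c: "\<bar>c\<bar> < 1" and X: "derivation X"
    and eq: "\<And>p. twisted_div c X p = a * (c - x3 p) + b"
  obtains k where "a = 0" "b = 0" "k \<in> smooth_S2" "X x3 = S2_rot k"
proof -
  have c2: "1 - c\<^sup>2 \<noteq> 0"
  proof -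
    have "c\<^sup>2 < 1" using c by (simp add: abs_square_less_1)
    then show ?thesis by simp
  qed
  obtain p\<^sub>c where pc: "x3 p\<^sub>c = c" by (rule meridian_point [of c]) (use c in auto)
  obtain n where n: "x3 n = 1" by (rule meridian_point [of 1]) auto
  obtain s where s: "x3 s = - 1" by (rule meridian_point [of "-1"]) auto
  define G where "G = X x3"
  define m where "m = x1 * X x2 - x2 * X x1"
  have G: "G \<in> smooth_S2" and m: "m \<in> smooth_S2"
    using derivationD(1) [OF X] by (simp_all add: G_def m_def)
  obtain k where k: "k \<in> smooth_S2" "S2_rot (G - S2_rot k) = 0"
    by (rule rot_decomposition [OF G], rule that)
  define H where "H = G - S2_rot k"
  have H: "H \<in> smooth_S2" "S2_rot H = 0" using G k by (simp_all add: H_def)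
  have GH: "G = H + S2_rot k" by (simp add: H_def)
  have H0: "H p = 0" if "(x3 p)\<^sup>2 = 1" for p
  proof -
    have p: "x1 p = 0" "x2 p = 0" "x3 p \<noteq> 0" using poleD [OF that] by auto
    then show ?thesis using derivation_tangent [OF X, of p] by (simp add: H_def G_def S2_rot_def)
  qed
  define z where "z = 1 - x3 * x3"
  define \<phi> where "\<phi> = (\<lambda>p. c) - x3"
  have zs: "z \<in> smooth_S2" "\<phi> \<in> smooth_S2" by (simp_all add: z_def \<phi>_def)
  \<comment> \<open>the invariant part of the equation; the remaining part is \<open>S2_rot u\<close>\<close>
  define T where "T = z * (\<lambda>p. a * \<phi> p) + z * (\<lambda>p. b) - z * H - \<phi> * S2_D 3 H"
  define u where "u = z * k + \<phi> * (S2_D 3 k + m)"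
  have us: "u \<in> smooth_S2" using zs k m by (simp add: u_def)
  have Rz: "S2_rot (z * f) = z * S2_rot f" if "f \<in> smooth_S2" for f
    unfolding z_def by (rule rot_poles_mult [OF that])
  have R\<phi>: "S2_rot (\<phi> * f) = \<phi> * S2_rot f" if "f \<in> smooth_S2" for f
    unfolding \<phi>_def by (rule rot_height_mult [OF that])
  have "S2_rot 1 = 0" using derivation_const [OF derivation_rot, of 1] by (simp add: one_fun_def)
  then have "S2_rot \<phi> = 0" using R\<phi> [of 1] by simp
  note R = derivationD(2) [OF derivation_rot] derivationD(4) [OF derivation_rot]
    derivation_minus [OF derivation_rot] derivation_const [OF derivation_rot] Rz R\<phi> this
  have RT: "S2_rot T = 0"
    using zs H S2_rot_D3 [OF H(1)] by (simp add: T_def R) (simp add: fun_eq_iff)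
  have "T = S2_rot u"
  proof
    fix p
    have "S2_rot u p = z p * S2_rot k p + \<phi> p * (S2_D 3 (S2_rot k) p + S2_rot m p)"
      using zs k m S2_rot_D3 [OF k(1)] by (simp add: u_def R)
    moreover have "z p * S2_div X p = S2_D 3 G p + S2_rot m p"
      using S2_div_decompose [OF X, of p] by (simp add: G_def m_def z_def power2_eq_square)
    moreover have "S2_D 3 G p = S2_D 3 H p + S2_D 3 (S2_rot k) p"
      unfolding GH using H k by simp
    moreover have "H p + S2_rot k p + \<phi> p * S2_div X p = a * \<phi> p + b"
      using eq [of p] fun_cong [OF GH, of p] by (simp add: twisted_div_def G_def \<phi>_def)
    ultimately show "T p = S2_rot u p"
      unfolding T_def by simp algebra
  qed
  then have "T = 0" using rot_square_zero [OF us] RT by simp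
  then have E: "z p * (a * \<phi> p + b) = z p * H p + \<phi> p * S2_D 3 H p" for p
    by (simp add: T_def fun_eq_iff algebra_simps)
  obtain h q where q: "q \<in> smooth_S2" "S2_rot q = 0" and Hq: "\<And>p. H p = h + (c - x3 p) * q p"
    by (rule invariant_divide_height [OF H c], rule that)
  have b: "b = h"
  proof -
    have "(1 - c\<^sup>2) * b = (1 - c\<^sup>2) * h"
      using E [of p\<^sub>c] Hq [of p\<^sub>c] pc by (simp add: z_def \<phi>_def power2_eq_square)
    then show ?thesis using c2 by simp
  qed
  have HH: "H = (\<lambda>p. h) + \<phi> * q" using Hq by (simp add: fun_eq_iff \<phi>_def)
  have DH: "S2_D 3 H p = - z p * q p + \<phi> p * S2_D 3 q p" for p
    unfolding HH using zs q by (simp add: \<phi>_def S2_D_coord z_def algebra_simps)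
  have "z * (\<lambda>p. a) - \<phi> * S2_D 3 q = 0"
  proof (rule cancel_height [OF c])
    show "z * (\<lambda>p. a) - \<phi> * S2_D 3 q \<in> smooth_S2" using zs q by simp
    fix p
    have "z p * (a * \<phi> p + b) = z p * (b + \<phi> p * q p) + \<phi> p * (- z p * q p + \<phi> p * S2_D 3 q p)"
      using E [of p] unfolding DH by (simp add: Hq b \<phi>_def)
    then have "\<phi> p * (z p * a - \<phi> p * S2_D 3 q p) = 0" by algebra
    then show "(c - x3 p) * (z * (\<lambda>p. a) - \<phi> * S2_D 3 q) p = 0" by (simp add: \<phi>_def)
  qed
  then have za: "z p * a = \<phi> p * S2_D 3 q p" for p by (simp add: fun_eq_iff)
  have a0: "a = 0"
    using za [of p\<^sub>c] pc c2 by (simp add: z_def \<phi>_def power2_eq_square)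
  have "S2_D 3 q = 0"
    using za q by (intro cancel_height [OF c]) (simp_all add: a0 \<phi>_def)
  then have qn: "q p = q n" for p by (intro D3_rot_zero_imp_const q)
  have "b + (c - 1) * q n = 0" "b + (c + 1) * q n = 0"
    using H0 [of n] H0 [of s] Hq [of n] Hq [of s] n s qn [of s] by (simp_all add: b)
  then have "q n = 0" by algebra
  then have b0: "b = 0" using \<open>b + (c - 1) * q n = 0\<close> by simp
  have "H = 0" using Hq qn \<open>q n = 0\<close> b b0 by (simp add: fun_eq_iff)
  then have "X x3 = S2_rot k" using GH by (simp add: G_def)
  then show thesis using a0 b0 k(1) that by blast
qed

text \<open>By \<open>twisted_div_injective\<close> the height component of \<open>X\<close> is in the image of the rotation, and it is then equal to
  \<open>(c - x3) S2_rot f\<close> for some \<open>f\<close>, the height component of a Hamiltonian field. After subtraction of that field,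
  \<open>Y\<close> is tangent to the parallels and free of divergence, so \<open>Y = b S2_rot\<close> with \<open>b\<close> invariant. The part of \<open>b\<close> vanishing
  on the circle is Hamiltonian, with a primitive of the quotient by \<open>c - x3\<close> as Hamilton function.\<close>

theorem twisted_div_kernel:
  assumes c: "\<bar>c\<bar> < 1" and X: "derivation X" and eq: "\<And>p. twisted_div c X p = 0"
  obtains a f where "f \<in> smooth_S2"
    "\<And>h p. h \<in> smooth_S2 \<Longrightarrow> X h p = a * S2_rot h p + (c - x3 p) * S2_bracket f h p"
proof -
  define \<phi> where "\<phi> = (\<lambda>p. c) - x3"
  have \<phi>: "\<phi> \<in> smooth_S2" by (simp add: \<phi>_def)
  have R\<phi>: "S2_rot (\<phi> * f) = \<phi> * S2_rot f" if "f \<in> smooth_S2" for f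
    unfolding \<phi>_def by (rule rot_height_mult [OF that])
  obtain k where k: "k \<in> smooth_S2" "X x3 = S2_rot k"
    by (rule twisted_div_injective [OF c X, of 0 0]) (use eq in simp, rule that)
  define u where "u = - S2_div X"
  have u: "u \<in> smooth_S2" using S2_div_smooth [OF X] by (simp add: u_def)
  obtain f where f: "f \<in> smooth_S2" "S2_rot (u - S2_rot f) = 0"
    by (rule rot_decomposition [OF u], rule that)
  have "\<phi> * u = S2_rot k"
  proof
    fix p
    have "(c - x3 p) * S2_div X p = - S2_rot k p"
      using eq [of p] fun_cong [OF k(2), of p] by (simp add: twisted_div_def)
    then show "(\<phi> * u) p = S2_rot k p" by (simp add: \<phi>_def u_def)
  qed
  then have "\<phi> * (u - S2_rot f) = S2_rot (k - \<phi> * f)"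
    using f k \<phi> by (simp add: derivation_minus [OF derivation_rot] R\<phi> algebra_simps)
  moreover have "S2_rot (\<phi> * (u - S2_rot f)) = 0"
    using R\<phi> [of "u - S2_rot f"] f u by simp
  ultimately have "\<phi> * (u - S2_rot f) = 0"
    using rot_square_zero [of "k - \<phi> * f"] k f \<phi> by simp
  then have "u - S2_rot f = 0"
    using u f by (intro cancel_height [OF c]) (simp_all add: fun_eq_iff \<phi>_def)
  then have Xz: "X x3 = \<phi> * S2_rot f" using \<open>\<phi> * u = S2_rot k\<close> k by simp
  define B where "B = (\<lambda>h. \<phi> * S2_bracket f h)"
  have B: "derivation B" unfolding B_def by (intro derivation_mult derivation_bracket f \<phi>)
  define Y where "Y = (\<lambda>h. X h - B h)"
  have Y: "derivation Y" unfolding Y_def by (intro derivation_diff X B)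
  have Yz: "Y x3 = 0" using Xz f by (simp add: Y_def B_def S2_bracket_coord)
  have "S2_div B = - S2_rot f"
    unfolding B_def S2_div_mult [OF derivation_bracket [OF f(1)] \<phi>]
    using f derivation_minus [OF derivation_bracket [OF f(1)], of "\<lambda>p. c" x3]
    by (simp add: \<phi>_def S2_div_bracket S2_bracket_coord derivation_const [OF derivation_bracket [OF f(1)]])
  moreover have "S2_div X = - S2_rot f"
  proof -
    have "S2_div X = - u" by (simp add: u_def)
    also have "u = S2_rot f" using \<open>u - S2_rot f = 0\<close> by simp
    finally show ?thesis .
  qed
  ultimately have "S2_div Y = 0"
    unfolding Y_def by (simp add: S2_div_diff X B)
  define m where "m = x1 * Y x2 - x2 * Y x1"
  have m: "m \<in> smooth_S2" using derivationD(1) [OF Y] by (simp add: m_def)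
  have Rm: "S2_rot m = 0"
    using S2_div_decompose [OF Y] \<open>S2_div Y = 0\<close> Yz by (simp add: m_def fun_eq_iff)
  have "m p = 0" if "(x3 p)\<^sup>2 = 1" for p
    using that pole_iff [of p] by (simp add: m_def)
  then obtain b where b: "b \<in> smooth_S2" "S2_rot b = 0" "\<And>p. m p = (1 - (x3 p)\<^sup>2) * b p"
    by (rule invariant_divide_poles [OF m Rm]) (assumption, rule that)
  have Yb: "Y h = b * S2_rot h" if h: "h \<in> smooth_S2" for h
  proof -
    have "Y h - b * S2_rot h = 0"
    proof (rule cancel_poles)
      show "Y h - b * S2_rot h \<in> smooth_S2" using derivationD(1) [OF Y h] b h by simp
      show "(1 - (x3 p)\<^sup>2) * (Y h - b * S2_rot h) p = 0" for p
        using derivation_decompose [OF Y h, of p] Yz b(3) [of p]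
        by (simp add: m_def right_diff_distrib)
    qed
    then show ?thesis by simp
  qed
  obtain a q where q: "q \<in> smooth_S2" "S2_rot q = 0" and bq: "\<And>p. b p = a + (c - x3 p) * q p"
    by (rule invariant_divide_height [OF b(1,2) c], rule that)
  obtain F where F: "F \<in> smooth_S2" "S2_rot F = 0" "\<And>p. S2_D 3 F p = (1 - (x3 p)\<^sup>2) * q p"
    by (rule invariant_primitive [OF q], rule that)
  have Fh: "S2_bracket F h = - (q * S2_rot h)" if h: "h \<in> smooth_S2" for h
  proof -
    have "S2_bracket F h + q * S2_rot h = 0"
    proof (rule cancel_poles)
      show "S2_bracket F h + q * S2_rot h \<in> smooth_S2" using F q h by simp
      show "(1 - (x3 p)\<^sup>2) * (S2_bracket F h + q * S2_rot h) p = 0" for p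
        using S2_bracket_decompose [OF F(1) h, of p] F(2) F(3) [of p]
        by (simp add: distrib_left)
    qed
    then show ?thesis by (simp add: eq_neg_iff_add_eq_0)
  qed
  have "X h p = a * S2_rot h p + (c - x3 p) * S2_bracket (f - F) h p" if h: "h \<in> smooth_S2" for h p
  proof -
    have "X h p = B h p + Y h p" by (simp add: Y_def)
    also have "\<dots> = (c - x3 p) * S2_bracket f h p + (a + (c - x3 p) * q p) * S2_rot h p"
      using Yb [OF h] bq [of p] by (simp add: B_def \<phi>_def)
    also have "S2_bracket (f - F) h = S2_bracket f h - S2_bracket F h"
      using f F by (intro derivation_minus [OF derivation_bracket_left [OF h]])
    ultimately show ?thesis using Fh [OF h] by (simp add: algebra_simps)
  qed
  moreover have "f - F \<in> smooth_S2" using f F by simp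
  ultimately show thesis using that by blast
qed

lemma casimir_const:
  assumes c: "\<bar>c\<bar> < 1" and f: "f \<in> smooth_S2"
    and eq: "\<And>h p. h \<in> smooth_S2 \<Longrightarrow> (c - x3 p) * S2_bracket f h p = 0"
  shows "f p = f q"
proof (rule D3_rot_zero_imp_const [OF f])
  have B: "S2_bracket f h = 0" if "h \<in> smooth_S2" for h
    by (rule cancel_height [OF c]) (use eq that f in simp_all)
  show "S2_rot f = 0" using B [of x3] f by (simp add: S2_bracket_coord)
  then have E: "S2_D 3 f p * x2 p = 0" "S2_D 3 f p * x1 p = 0" for p
    using S2_bracket_decompose [OF f S2_coord_smooth, of p 1] S2_bracket_decompose [OF f S2_coord_smooth, of p 2]
    by (simp_all add: B S2_rot_coord)
  have "(x1 p)\<^sup>2 * S2_D 3 f p + (x2 p)\<^sup>2 * S2_D 3 f p = 0" for p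
    using E [of p] by algebra
  moreover have "(x1 p)\<^sup>2 + (x2 p)\<^sup>2 = 1 - (x3 p)\<^sup>2" for p using S2_coord_sq [of p] by simp
  ultimately show "S2_D 3 f = 0"
    using f by (intro cancel_poles) (simp_all flip: distrib_right)
qed

text \<open>On the circle the right-hand side vanishes while the rotation does not.\<close>

lemma rot_not_hamiltonian:
  assumes c: "\<bar>c\<bar> < 1" and eq: "\<And>h p. h \<in> smooth_S2 \<Longrightarrow> a * S2_rot h p = (c - x3 p) * S2_bracket f h p"
  shows "a = 0"
proof -
  obtain p where p: "x1 p = sqrt (1 - c\<^sup>2)" "x3 p = c" by (rule meridian_point [of c]) (use c in auto)
  have "c\<^sup>2 < 1" using c by (simp add: abs_square_less_1)
  then show ?thesis using eq [of x2 p] p by (simp add: S2_rot_coord)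
qed

section \<open>Multivector fields on the sphere\<close>

abbreviation mv_scale :: "real \<Rightarrow> 'm multivector \<Rightarrow> 'm multivector" where
  "mv_scale a P \<equiv> (\<lambda>Fs x. a * P Fs x)"

lemma multivector_fieldsD:
  assumes "P \<in> multivector_fields C k"
  shows "smooth_args C k Fs \<Longrightarrow> P Fs \<in> C"
    and "\<not> smooth_args C k Fs \<Longrightarrow> P Fs = 0"
    and "\<not> distinct Fs \<Longrightarrow> P Fs = 0"
    and "f \<in> C \<Longrightarrow> g \<in> C \<Longrightarrow> smooth_args C k (Fs @ f # Gs) \<Longrightarrow>
      P (Fs @ (f + g) # Gs) = P (Fs @ f # Gs) + P (Fs @ g # Gs)"
    and "f \<in> C \<Longrightarrow> g \<in> C \<Longrightarrow> smooth_args C k (Fs @ f # Gs) \<Longrightarrow>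
      P (Fs @ (f * g) # Gs) = f * P (Fs @ g # Gs) + g * P (Fs @ f # Gs)"
    and "f \<in> C \<Longrightarrow> smooth_args C k (Fs @ f # Gs) \<Longrightarrow>
      P (Fs @ (\<lambda>x. a * f x) # Gs) = (\<lambda>x. a * P (Fs @ f # Gs) x)"
  using assms unfolding multivector_fields_def by blast+

text \<open>The multivector representation of a derivation; it has to be zero on all lists that are not admissible.\<close>

definition vector_field :: "((S2 \<Rightarrow> real) \<Rightarrow> S2 \<Rightarrow> real) \<Rightarrow> S2 multivector" where
  "vector_field X = (\<lambda>Fs. if smooth_args smooth_S2 1 Fs then X (hd Fs) else 0)"

lemma vector_field_single [simp]: "f \<in> smooth_S2 \<Longrightarrow> vector_field X [f] = X f"
  by (simp add: vector_field_def smooth_args_def)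

lemma smooth_args_1: "smooth_args C 1 Fs \<longleftrightarrow> (\<exists>f\<in>C. Fs = [f])"
    "smooth_args C (Suc 0) Fs \<longleftrightarrow> (\<exists>f\<in>C. Fs = [f])"
  by (auto simp: smooth_args_def length_Suc_conv)

lemma smooth_args_2: "smooth_args C 2 Fs \<longleftrightarrow> (\<exists>f\<in>C. \<exists>g\<in>C. Fs = [f, g])"
  by (auto simp: smooth_args_def length_Suc_conv numeral_2_eq_2)

lemma smooth_args_3: "smooth_args C 3 Fs \<longleftrightarrow> (\<exists>f\<in>C. \<exists>g\<in>C. \<exists>h\<in>C. Fs = [f, g, h])"
  by (auto simp: smooth_args_def length_Suc_conv numeral_3_eq_3)

lemma vector_field_in:
  assumes X: "derivation X"
  shows "vector_field X \<in> multivector_fields smooth_S2 1"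
  unfolding multivector_fields_def
proof (intro CollectI conjI allI impI ballI)
  fix Fs Gs :: "(S2 \<Rightarrow> real) list" and f g :: "S2 \<Rightarrow> real" and a :: real
  assume f: "f \<in> smooth_S2" and g: "g \<in> smooth_S2" and "smooth_args smooth_S2 1 (Fs @ f # Gs)"
  then have e: "Fs = []" "Gs = []" by (auto simp: smooth_args_def)
  show "vector_field X (Fs @ (f + g) # Gs) = vector_field X (Fs @ f # Gs) + vector_field X (Fs @ g # Gs)"
    "vector_field X (Fs @ (f * g) # Gs) = f * vector_field X (Fs @ g # Gs) + g * vector_field X (Fs @ f # Gs)"
    "vector_field X (Fs @ (\<lambda>x. a * f x) # Gs) = (\<lambda>x. a * vector_field X (Fs @ f # Gs) x)"
    using f g by (simp_all add: e derivationD [OF X] fun_eq_iff)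
next
  fix Fs :: "(S2 \<Rightarrow> real) list"
  show "vector_field X Fs \<in> smooth_S2" if "smooth_args smooth_S2 1 Fs"
    using that derivationD(1) [OF X] by (auto simp: smooth_args_1)
  show "vector_field X Fs = 0" if "\<not> smooth_args smooth_S2 1 Fs"
    using that by (simp add: vector_field_def)
  show "vector_field X Fs = 0" if "\<not> distinct Fs"
    using that by (auto simp: vector_field_def smooth_args_1)
qed

lemma multivector_fields_1E:
  assumes P: "P \<in> multivector_fields smooth_S2 1"
  obtains X where "derivation X" "P = vector_field X"
proof
  show "derivation (\<lambda>f. P [f])"
    unfolding derivation_def
    using multivector_fieldsD(1) [OF P] multivector_fieldsD(4-6) [OF P, where Fs = "[]" and Gs = "[]"]
    by (simp add: smooth_args_def)
  show "P = vector_field (\<lambda>f. P [f])"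
    using multivector_fieldsD(2) [OF P] by (auto simp: fun_eq_iff vector_field_def smooth_args_1)
qed

definition bivector :: "(S2 \<Rightarrow> real) \<Rightarrow> S2 multivector" where
  "bivector u Fs = u * std_poisson Fs"

lemma bivector_pair [simp]:
  "f \<in> smooth_S2 \<Longrightarrow> g \<in> smooth_S2 \<Longrightarrow> bivector u [f, g] = u * S2_bracket f g"
  by (simp add: bivector_def std_poisson_eq_bracket)

lemma bivector_zero: "\<not> smooth_args smooth_S2 2 Fs \<Longrightarrow> bivector u Fs = 0"
  by (simp add: bivector_def std_poisson_def)

lemma necklace_eq_bivector: "necklace_poisson c = bivector ((\<lambda>p. c) - x3)"
  by (simp add: fun_eq_iff necklace_poisson_def bivector_def)

lemma std_eq_bivector: "std_poisson = bivector 1"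
  by (simp add: fun_eq_iff bivector_def)

lemma bivector_in:
  assumes u: "u \<in> smooth_S2"
  shows "bivector u \<in> multivector_fields smooth_S2 2"
  unfolding multivector_fields_def
proof (intro CollectI conjI allI impI ballI)
  fix Fs Gs :: "(S2 \<Rightarrow> real) list" and f g :: "S2 \<Rightarrow> real" and a :: real
  assume f: "f \<in> smooth_S2" and g: "g \<in> smooth_S2" and s: "smooth_args smooth_S2 2 (Fs @ f # Gs)"
  then consider h where "h \<in> smooth_S2" "Fs = []" "Gs = [h]" | h where "h \<in> smooth_S2" "Fs = [h]" "Gs = []"
    by (auto simp: smooth_args_2 append_eq_Cons_conv)
  then show "bivector u (Fs @ (f + g) # Gs) = bivector u (Fs @ f # Gs) + bivector u (Fs @ g # Gs)"
    "bivector u (Fs @ (f * g) # Gs) = f * bivector u (Fs @ g # Gs) + g * bivector u (Fs @ f # Gs)"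
    "bivector u (Fs @ (\<lambda>x. a * f x) # Gs) = (\<lambda>x. a * bivector u (Fs @ f # Gs) x)"
    using f g
    by (cases; simp add: derivationD [OF derivation_bracket] derivationD [OF derivation_bracket_left];
        simp add: fun_eq_iff algebra_simps)+
next
  fix Fs :: "(S2 \<Rightarrow> real) list"
  show "bivector u Fs \<in> smooth_S2" if "smooth_args smooth_S2 2 Fs"
    using that u by (auto simp: smooth_args_2)
  show "bivector u Fs = 0" if "\<not> smooth_args smooth_S2 2 Fs"
    using that by (rule bivector_zero)
  show "bivector u Fs = 0" if "\<not> distinct Fs"
  proof (cases "smooth_args smooth_S2 2 Fs")
    case True
    then obtain f g where "f \<in> smooth_S2" "Fs = [f, g]" by (auto simp: smooth_args_2)
    moreover from this have "g = f" using that by auto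
    ultimately show ?thesis by (simp add: S2_bracket_def fun_eq_iff)
  qed (rule bivector_zero)
qed

lemma multivector_fields_2E:
  assumes P: "P \<in> multivector_fields smooth_S2 2"
  obtains u where "u \<in> smooth_S2" "P = bivector u"
proof -
  have P1: "derivation (\<lambda>f. P [f, g])" if "g \<in> smooth_S2" for g
    unfolding derivation_def
    using that multivector_fieldsD(1) [OF P]
      multivector_fieldsD(4-6) [OF P, where Fs = "[]" and Gs = "[g]"]
    by (simp add: smooth_args_def)
  have P2: "derivation (\<lambda>g. P [f, g])" if "f \<in> smooth_S2" for f
    unfolding derivation_def
    using that multivector_fieldsD(1) [OF P]
      multivector_fieldsD(4-6) [OF P, where Fs = "[f]" and Gs = "[]"]
    by (simp add: smooth_args_def)
  have anti: "P [g, f] = - P [f, g]" if "f \<in> smooth_S2" "g \<in> smooth_S2" for f g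
  proof -
    have 0: "P [h, h] = 0" for h by (rule multivector_fieldsD(3) [OF P]) simp
    have "P [f + g, f + g] = P [f, f] + P [g, f] + (P [f, g] + P [g, g])"
      using that by (simp add: derivationD(2) [OF P1] derivationD(2) [OF P2])
    then have "P [g, f] + P [f, g] = 0" by (simp add: 0)
    then show ?thesis by (simp add: eq_neg_iff_add_eq_0)
  qed
  define u where "u = x1 * P [x2, x3] + x2 * P [x3, x1] + x3 * P [x1, x2]"
  have eq: "P [f, g] = u * S2_bracket f g" if "f \<in> smooth_S2" "g \<in> smooth_S2" for f g
    unfolding u_def by (rule biderivation_eq [where P = "\<lambda>f g. P [f, g]", OF P1 P2 anti that])
  have "u \<in> smooth_S2"
    unfolding u_def using multivector_fieldsD(1) [OF P] by (simp add: smooth_args_def)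
  moreover have "P = bivector u"
  proof
    fix Fs
    show "P Fs = bivector u Fs"
    proof (cases "smooth_args smooth_S2 2 Fs")
      case True
      then show ?thesis using eq by (auto simp: smooth_args_2)
    next
      case False
      then show ?thesis using multivector_fieldsD(2) [OF P] bivector_zero by simp
    qed
  qed
  ultimately show thesis using that by blast
qed

lemma multivector_fields_0: "P \<in> multivector_fields smooth_S2 0 \<longleftrightarrow> (\<exists>f\<in>smooth_S2. P = of_function f)"
proof
  assume P: "P \<in> multivector_fields smooth_S2 0"
  have "P [] \<in> smooth_S2" "P = of_function (P [])"
    using multivector_fieldsD(1,2) [OF P] by (auto simp: smooth_args_def of_function_def fun_eq_iff)
  then show "\<exists>f\<in>smooth_S2. P = of_function f" by blast
next
  assume "\<exists>f\<in>smooth_S2. P = of_function f"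
  then show "P \<in> multivector_fields smooth_S2 0"
    by (auto simp: multivector_fields_def smooth_args_def of_function_def)
qed

subsection \<open>The Schouten bracket in low degrees\<close>

lemma shuffle_perms_0: "shuffle_perms 0 (Suc 0) = {id}" "shuffle_perms (Suc 0) 0 = {id}"
  by (auto simp: shuffle_perms_def lessThan_Suc strict_mono_on_def)

lemma shuffle_perms_2_0: "shuffle_perms 2 0 = {id}"
proof (intro equalityI subsetI)
  fix \<sigma> assume "\<sigma> \<in> shuffle_perms 2 0"
  then have p: "\<sigma> permutes {..<2}" and m: "\<sigma> 0 < \<sigma> 1"
    by (auto simp: shuffle_perms_def strict_mono_on_def)
  have "\<sigma> i = i" if "\<not> i < 2" for i using permutes_not_in [OF p] that by simp
  moreover have "\<sigma> 0 < 2" "\<sigma> 1 < 2" using permutes_in_image [OF p] by auto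
  then have "\<sigma> 0 = 0" "\<sigma> 1 = 1" using m by linarith+
  ultimately have "\<sigma> i = i" for i by (cases "i = 0 \<or> i = 1") (auto simp: not_less)
  then show "\<sigma> \<in> {id}" by (auto simp: fun_eq_iff)
qed (auto simp: shuffle_perms_def permutes_id strict_mono_on_def)

lemma shuffle_perms_1_1: "shuffle_perms (Suc 0) (Suc 0) = {id, Transposition.transpose 0 1}"
proof (intro equalityI subsetI)
  fix \<sigma> :: "nat \<Rightarrow> nat" assume "\<sigma> \<in> shuffle_perms (Suc 0) (Suc 0)"
  then have p: "\<sigma> permutes {..<2}" by (auto simp: shuffle_perms_def numeral_2_eq_2)
  have o: "\<sigma> i = i" if "\<not> i < 2" for i using permutes_not_in [OF p] that by simp
  have "\<sigma> 0 < 2" "\<sigma> 1 < 2" using permutes_in_image [OF p] by auto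
  moreover have "\<sigma> 0 \<noteq> \<sigma> 1" using permutes_inj [OF p] by (metis inj_eq zero_neq_one)
  ultimately consider "\<sigma> 0 = 0" "\<sigma> 1 = 1" | "\<sigma> 0 = 1" "\<sigma> 1 = 0" by linarith
  then show "\<sigma> \<in> {id, Transposition.transpose 0 1}"
  proof cases
    case 1
    then have "\<sigma> i = i" for i using o [of i] by (cases "i = 0 \<or> i = 1") auto
    then show ?thesis by (auto simp: fun_eq_iff)
  next
    case 2
    then have "\<sigma> i = Transposition.transpose 0 1 i" for i
      using o [of i] by (cases "i = 0 \<or> i = 1") (auto simp: Transposition.transpose_def)
    then show ?thesis by (auto simp: fun_eq_iff)
  qed
next
  fix \<sigma> :: "nat \<Rightarrow> nat" assume "\<sigma> \<in> {id, Transposition.transpose 0 1}"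
  then show "\<sigma> \<in> shuffle_perms (Suc 0) (Suc 0)"
    by (auto simp: shuffle_perms_def permutes_id strict_mono_on_def intro: permutes_swap_id)
qed

lemma shuffle_perms_2_1: "shuffle_perms 2 (Suc 0) = {id, Transposition.transpose 1 2, Transposition.transpose 0 1 \<circ> Transposition.transpose 1 2}"
proof (intro equalityI subsetI)
  fix \<sigma> :: "nat \<Rightarrow> nat" assume "\<sigma> \<in> shuffle_perms 2 (Suc 0)"
  then have p: "\<sigma> permutes {..<3}" and m: "\<sigma> 0 < \<sigma> 1"
    by (auto simp: shuffle_perms_def strict_mono_on_def numeral_3_eq_3)
  have o: "\<sigma> i = i" if "\<not> i < 3" for i using permutes_not_in [OF p] that by simp
  have "\<sigma> 0 < 3" "\<sigma> 1 < 3" "\<sigma> 2 < 3" using permutes_in_image [OF p] by auto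
  moreover have "\<sigma> 0 \<noteq> \<sigma> 2" "\<sigma> 1 \<noteq> \<sigma> 2" using inj_eq [OF permutes_inj [OF p]] by auto
  ultimately consider "\<sigma> 0 = 0" "\<sigma> 1 = 1" "\<sigma> 2 = 2" | "\<sigma> 0 = 0" "\<sigma> 1 = 2" "\<sigma> 2 = 1"
    | "\<sigma> 0 = 1" "\<sigma> 1 = 2" "\<sigma> 2 = 0" using m by linarith
  then show "\<sigma> \<in> {id, Transposition.transpose 1 2, Transposition.transpose 0 1 \<circ> Transposition.transpose 1 2}"
  proof cases
    case 1
    then have "\<sigma> i = i" for i using o [of i] by (cases "i = 0 \<or> i = 1 \<or> i = 2") auto
    then show ?thesis by (auto simp: fun_eq_iff)
  next
    case 2
    then have "\<sigma> i = Transposition.transpose 1 2 i" for i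
      using o [of i] by (cases "i = 0 \<or> i = 1 \<or> i = 2") (auto simp: Transposition.transpose_def)
    then show ?thesis by (auto simp: fun_eq_iff)
  next
    case 3
    then have "\<sigma> i = (Transposition.transpose 0 1 \<circ> Transposition.transpose 1 2) i" for i
      using o [of i] by (cases "i = 0 \<or> i = 1 \<or> i = 2") (auto simp: Transposition.transpose_def)
    then show ?thesis by (auto simp: fun_eq_iff)
  qed
next
  have "Transposition.transpose 0 1 permutes {..<3::nat}" "Transposition.transpose 1 2 permutes {..<3::nat}"
    by (auto intro: permutes_swap_id)
  moreover fix \<sigma> :: "nat \<Rightarrow> nat" assume "\<sigma> \<in> {id, Transposition.transpose 1 2, Transposition.transpose 0 1 \<circ> Transposition.transpose 1 2}"
  ultimately show "\<sigma> \<in> shuffle_perms 2 (Suc 0)"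
    by (auto simp: shuffle_perms_def permutes_id strict_mono_on_def Transposition.transpose_def less_Suc_eq
        numeral_2_eq_2 numeral_3_eq_3 intro: permutes_compose)
qed

text \<open>The insertions that occur in the Poisson differential on a surface, with the shuffles written out.\<close>

lemma insertion_2_0: "insertion 2 0 P Q [f] = P [Q [], f]"
  by (simp add: insertion_def shuffle_perms_0 sign_id)

lemma insertion_1_1: "insertion (Suc 0) (Suc 0) P Q [f] = P [Q [f]]"
  by (simp add: insertion_def shuffle_perms_0 sign_id)

lemma insertion_1_2: "insertion (Suc 0) 2 P Q [f, g] = P [Q [f, g]]"
  by (simp add: insertion_def shuffle_perms_2_0 sign_id upt_rec [of 0] upt_rec [of "Suc 0"])

lemma insertion_2_1: "insertion 2 (Suc 0) P Q [f, g] = P [Q [f], g] - P [Q [g], f]"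
proof -
  let ?a = "Transposition.transpose 0 1 :: nat \<Rightarrow> nat"
  have v: "?a 0 = 1" "?a 1 = 0" by (simp_all add: Transposition.transpose_def)
  have d: "id \<noteq> ?a" using v by (metis id_apply zero_neq_one)
  have "insertion 2 (Suc 0) P Q [f, g] x = P [Q [f], g] x - P [Q [g], f] x" for x
    using d v by (simp add: insertion_def shuffle_perms_1_1 sign_id sign_swap_id)
  then show ?thesis by (simp add: fun_eq_iff)
qed

lemma insertion_2_2: "insertion 2 2 P Q [f, g, h] = P [Q [f, g], h] - P [Q [f, h], g] + P [Q [g, h], f]"
proof -
  let ?a = "Transposition.transpose 1 2 :: nat \<Rightarrow> nat" and ?b = "Transposition.transpose 0 1 \<circ> Transposition.transpose 1 2 :: nat \<Rightarrow> nat"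
  have v: "?a 0 = 0" "?a 1 = 2" "?a 2 = 1" "?b 0 = 1" "?b 1 = 2" "?b 2 = 0"
    by (simp_all add: Transposition.transpose_def)
  have d: "id \<noteq> ?a" "id \<noteq> ?b" "?a \<noteq> ?b"
    using v by (metis id_apply zero_neq_one numeral_One one_eq_numeral_iff semiring_norm(85))+
  have s: "sign ?a = - 1" "sign ?b = 1"
    by (simp_all add: sign_compose permutation_swap_id sign_swap_id)
  have u: "[0..<2] = [0, 1::nat]" "[2..<3] = [2::nat]" by (simp_all add: upt_rec)
  have "insertion 2 2 P Q [f, g, h] x = P [Q [f, g], h] x - P [Q [f, h], g] x + P [Q [g, h], f] x" for x
    using d v s by (simp add: insertion_def shuffle_perms_2_1 u sign_id del: comp_apply One_nat_def)
  then show ?thesis by (simp add: fun_eq_iff)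
qed

lemma poisson_diff_0:
  assumes u: "u \<in> smooth_S2" and f: "f \<in> smooth_S2"
  shows "poisson_diff smooth_S2 (bivector u) 0 (of_function f) = vector_field (\<lambda>h. u * S2_bracket f h)"
proof
  fix Fs
  show "poisson_diff smooth_S2 (bivector u) 0 (of_function f) Fs = vector_field (\<lambda>h. u * S2_bracket f h) Fs"
  proof (cases "smooth_args smooth_S2 1 Fs")
    case True
    then obtain h where "h \<in> smooth_S2" "Fs = [h]" by (auto simp: smooth_args_1)
    then show ?thesis
      using f True
      by (simp add: poisson_diff_def schouten_def insertion_2_0 fun_eq_iff)
         (simp add: insertion_def of_function_def)
  next
    case False
    then show ?thesis by (simp add: poisson_diff_def schouten_def vector_field_def)
  qed
qed

text \<open>By the Leibniz rule the differential is \<open>X x3\<close> times the bracket minus \<open>c - x3\<close> times the Lie derivative of the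
  bracket, which \<open>lie_derivative_bracket\<close> evaluates.\<close>

lemma poisson_diff_1:
  assumes X: "derivation X"
  shows "poisson_diff smooth_S2 (bivector ((\<lambda>p. c) - x3)) 1 (vector_field X) = bivector (twisted_div c X)"
proof
  fix Fs
  let ?\<phi> = "(\<lambda>p. c) - x3"
  show "poisson_diff smooth_S2 (bivector ?\<phi>) 1 (vector_field X) Fs = bivector (twisted_div c X) Fs"
  proof (cases "smooth_args smooth_S2 2 Fs")
    case True
    then obtain f g where fg: "f \<in> smooth_S2" "g \<in> smooth_S2" "Fs = [f, g]" by (auto simp: smooth_args_2)
    note Xf = derivationD(1) [OF X fg(1)] derivationD(1) [OF X fg(2)]
    have Xc: "X (\<lambda>p. c) = 0" by (rule derivation_const [OF X])
    have "poisson_diff smooth_S2 (bivector ?\<phi>) 1 (vector_field X) Fs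
        = ?\<phi> * S2_bracket (X f) g - ?\<phi> * S2_bracket (X g) f - X (?\<phi> * S2_bracket f g)"
      using fg True Xf
      by (simp add: poisson_diff_def schouten_def insertion_2_1 insertion_1_2 fun_eq_iff)
    also have "\<dots> = ?\<phi> * S2_bracket (X f) g + ?\<phi> * S2_bracket f (X g)
        - (?\<phi> * X (S2_bracket f g) - S2_bracket f g * X x3)"
      using fg by (simp add: derivationD(3) [OF X] derivation_minus [OF X] Xc S2_bracket_antisym [of "X g" f])
    also have "\<dots> = - (?\<phi> * (X (S2_bracket f g) - S2_bracket (X f) g - S2_bracket f (X g))) + X x3 * S2_bracket f g"
      by (simp add: algebra_simps)
    also have "\<dots> = twisted_div c X * S2_bracket f g"
      unfolding lie_derivative_bracket [OF X fg(1,2)]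
      by (simp add: twisted_div_def fun_eq_iff algebra_simps)
    finally show ?thesis using fg by simp
  next
    case False
    then show ?thesis by (simp add: poisson_diff_def schouten_def bivector_zero)
  qed
qed

text \<open>Expanding by the Leibniz rule leaves the Jacobi identity and the Pluecker relation of a two-form of rank
  two.\<close>

lemma poisson_diff_2:
  assumes u: "u \<in> smooth_S2" and v: "v \<in> smooth_S2"
  shows "poisson_diff smooth_S2 (bivector u) 2 (bivector v) = 0"
proof
  fix Fs
  show "poisson_diff smooth_S2 (bivector u) 2 (bivector v) Fs = 0 Fs"
  proof (cases "smooth_args smooth_S2 3 Fs")
    case True
    then obtain f g h where s: "f \<in> smooth_S2" "g \<in> smooth_S2" "h \<in> smooth_S2" "Fs = [f, g, h]"
      by (auto simp: smooth_args_3)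
    have J: "S2_bracket (S2_bracket f g) h - S2_bracket (S2_bracket f h) g + S2_bracket (S2_bracket g h) f = 0"
      using S2_bracket_jacobi [OF s(1,2,3)] S2_bracket_antisym [of "S2_bracket f h" g]
        S2_bracket_antisym [of "S2_bracket g h" f]
      by simp
    have L: "S2_bracket (a * b) d = a * S2_bracket b d + b * S2_bracket a d"
      if "a \<in> smooth_S2" "b \<in> smooth_S2" "d \<in> smooth_S2" for a b d
      using derivationD(3) [OF derivation_bracket_left [OF that(3)] that(1,2)] .
    have pluecker: "S2_bracket f g * S2_bracket w h - S2_bracket f h * S2_bracket w g
        + S2_bracket g h * S2_bracket w f = 0" for w
      by (simp add: S2_bracket_def fun_eq_iff algebra_simps)
    have I: "insertion 2 2 (bivector a) (bivector b) Fs = 0" if a: "a \<in> smooth_S2" and b: "b \<in> smooth_S2" for a b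
    proof -
      have "insertion 2 2 (bivector a) (bivector b) Fs
          = a * (b * (S2_bracket (S2_bracket f g) h - S2_bracket (S2_bracket f h) g + S2_bracket (S2_bracket g h) f)
            + (S2_bracket f g * S2_bracket b h - S2_bracket f h * S2_bracket b g + S2_bracket g h * S2_bracket b f))"
        unfolding s(4) insertion_2_2 using s(1-3) b by (simp add: L) (simp add: algebra_simps)
      then show ?thesis by (simp add: J pluecker)
    qed
    have "insertion 2 2 (bivector u) (bivector v) Fs x = 0" "insertion 2 2 (bivector v) (bivector u) Fs x = 0" for x
      using I [OF u v] I [OF v u] by simp_all
    then show ?thesis by (simp add: poisson_diff_def schouten_def fun_eq_iff)
  next
    case False
    then show ?thesis by (simp add: poisson_diff_def schouten_def)
  qed
qed

subsection \<open>The modular vector field\<close>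

lemma std_area_eq:
  "std_area P Q = x1 * (P [x2] * Q [x3] - P [x3] * Q [x2])
    + x2 * (P [x3] * Q [x1] - P [x1] * Q [x3]) + x3 * (P [x1] * Q [x2] - P [x2] * Q [x1])"
  by (simp add: fun_eq_iff std_area_def S2_vector_def cross3_def inner_vec_def sum_3 S2_coord_def)

lemma schouten_vector_fields:
  assumes "derivation X" "derivation Y" "f \<in> smooth_S2"
  shows "schouten smooth_S2 (Suc 0) (Suc 0) (vector_field X) (vector_field Y) [f] = X (Y f) - Y (X f)"
  using assms insertion_1_1 [of "vector_field X" "vector_field Y" f]
    insertion_1_1 [of "vector_field Y" "vector_field X" f]
  by (simp add: schouten_def smooth_args_def fun_eq_iff derivationD(1))

text \<open>Let \<open>M\<close> be the matrix of the derivatives of the components of \<open>X\<close>. The Lie derivative is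
  \<open>det (X, Y, Z) + det (x, M Y, Z) + det (x, Y, M Z)\<close>. The first term is zero because three tangent vectors are linearly
  dependent. Adding \<open>det (M x, Y, Z)\<close>, which is zero because \<open>M x = 0\<close>, the others become the trace of \<open>M\<close> times
  \<open>det (x, Y, Z)\<close>.\<close>

lemma lie_derivative_area:
  assumes X: "derivation X" and Y: "derivation Y" and Z: "derivation Z"
  shows "lie_derivative smooth_S2 (vector_field X) std_area (vector_field Y) (vector_field Z)
    = S2_div X * std_area (vector_field Y) (vector_field Z)"
proof
  fix p
  note sm = derivationD(1) [OF X] derivationD(1) [OF Y] derivationD(1) [OF Z]
  define w where "w = std_area (vector_field Y) (vector_field Z)"
  have w: "w = x1 * (Y x2 * Z x3 - Y x3 * Z x2) + x2 * (Y x3 * Z x1 - Y x1 * Z x3)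
      + x3 * (Y x1 * Z x2 - Y x2 * Z x1)"
    by (simp add: w_def std_area_eq)
  have ws: "w \<in> smooth_S2" unfolding w by (simp add: sm)
  let ?d = "\<lambda>i j. S2_D j (X (S2_coord i)) p"
  have YX: "Y (X (S2_coord i)) p = Y x1 p * ?d i 1 + Y x2 p * ?d i 2 + Y x3 p * ?d i 3" for i
    by (subst derivation_eq [OF Y sm(1) [OF S2_coord_smooth]]) (simp add: sum_3)
  have ZX: "Z (X (S2_coord i)) p = Z x1 p * ?d i 1 + Z x2 p * ?d i 2 + Z x3 p * ?d i 3" for i
    by (subst derivation_eq [OF Z sm(1) [OF S2_coord_smooth]]) (simp add: sum_3)
  have tan: "x1 p * ?d i 1 + x2 p * ?d i 2 + x3 p * ?d i 3 = 0" for i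
    by (rule S2_D_tangent) (simp add: sm)
  define det where "det = X x1 p * (Y x2 p * Z x3 p - Y x3 p * Z x2 p)
      + X x2 p * (Y x3 p * Z x1 p - Y x1 p * Z x3 p)
      + X x3 p * (Y x1 p * Z x2 p - Y x2 p * Z x1 p)"
  have "x1 p * det = 0" "x2 p * det = 0" "x3 p * det = 0"
    unfolding det_def
    using derivation_tangent [OF X, of p] derivation_tangent [OF Y, of p] derivation_tangent [OF Z, of p]
    by algebra+
  then have "((x1 p)\<^sup>2 + (x2 p)\<^sup>2 + (x3 p)\<^sup>2) * det = 0" by algebra
  then have det: "det = 0" by (simp add: S2_coord_sq)
  let ?V = "vector_field X" and ?W = "vector_field Y" and ?U = "vector_field Z"
  have "lie_derivative smooth_S2 ?V std_area ?W ?U p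
      = X w p - std_area (schouten smooth_S2 1 1 ?V ?W) ?U p - std_area ?W (schouten smooth_S2 1 1 ?V ?U) p"
    using ws by (simp add: lie_derivative_def w_def [symmetric])
  also have "\<dots> = det
      + (x1 p * (Y (X x2) p * Z x3 p - Y (X x3) p * Z x2 p)
        + x2 p * (Y (X x3) p * Z x1 p - Y (X x1) p * Z x3 p)
        + x3 p * (Y (X x1) p * Z x2 p - Y (X x2) p * Z x1 p))
      + (x1 p * (Y x2 p * Z (X x3) p - Y x3 p * Z (X x2) p)
        + x2 p * (Y x3 p * Z (X x1) p - Y x1 p * Z (X x3) p)
        + x3 p * (Y x1 p * Z (X x2) p - Y x2 p * Z (X x1) p))"
    unfolding w
    by (simp add: std_area_eq schouten_vector_fields X Y Z derivationD [OF X] derivation_minus [OF X] sm)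
       (simp add: det_def algebra_simps)
  also have "\<dots> = (?d 1 1 + ?d 2 2 + ?d 3 3) * w p
      - ((x1 p * ?d 1 1 + x2 p * ?d 1 2 + x3 p * ?d 1 3) * (Y x2 p * Z x3 p - Y x3 p * Z x2 p)
      + (x1 p * ?d 2 1 + x2 p * ?d 2 2 + x3 p * ?d 2 3) * (Y x3 p * Z x1 p - Y x1 p * Z x3 p)
      + (x1 p * ?d 3 1 + x2 p * ?d 3 2 + x3 p * ?d 3 3) * (Y x1 p * Z x2 p - Y x2 p * Z x1 p))"
    unfolding YX ZX det w by (simp add: algebra_simps)
  also have "\<dots> = S2_div X p * w p" unfolding tan by (simp add: S2_div_def)
  finally show "lie_derivative smooth_S2 ?V std_area ?W ?U p
      = (S2_div X * std_area (vector_field Y) (vector_field Z)) p"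
    by (simp add: w_def)
qed

text \<open>The divergence is determined uniquely since the area form takes the values \<open>x1\<close>, \<open>x2\<close>, \<open>x3\<close>, which have no
  common zero, on suitable pairs of Hamiltonian fields.\<close>

lemma divergence_vector_field:
  assumes X: "derivation X"
  shows "divergence smooth_S2 std_area (vector_field X) = S2_div X"
  unfolding divergence_def
proof (rule the_equality)
  show "S2_div X \<in> smooth_S2 \<and> (\<forall>Y\<in>multivector_fields smooth_S2 1. \<forall>Z\<in>multivector_fields smooth_S2 1.
      lie_derivative smooth_S2 (vector_field X) std_area Y Z = S2_div X * std_area Y Z)"
    using S2_div_smooth [OF X] lie_derivative_area [OF X] multivector_fields_1E by metis
next
  fix h assume h: "h \<in> smooth_S2 \<and> (\<forall>Y\<in>multivector_fields smooth_S2 1. \<forall>Z\<in>multivector_fields smooth_S2 1.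
      lie_derivative smooth_S2 (vector_field X) std_area Y Z = h * std_area Y Z)"
  have eq: "h * std_area (vector_field Y) (vector_field Z) = S2_div X * std_area (vector_field Y) (vector_field Z)"
    if "derivation Y" "derivation Z" for Y Z
    using h that lie_derivative_area [OF X that] vector_field_in by metis
  show "h = S2_div X"
  proof
    fix p
    have a: "std_area (vector_field (\<lambda>g. S2_bracket g f)) (vector_field (\<lambda>h. S2_bracket h g)) = S2_bracket f g"
      if "f \<in> smooth_S2" "g \<in> smooth_S2" for f g
    proof -
      have "hamiltonian_field smooth_S2 std_poisson f = vector_field (\<lambda>g. S2_bracket g f)" if "f \<in> smooth_S2" for f
        using that by (auto simp: fun_eq_iff hamiltonian_field_def vector_field_def smooth_args_1 std_poisson_eq_bracket)
      then show ?thesis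
        using std_area_hamiltonian [OF that] that by (simp add: std_poisson_eq_bracket)
    qed
    have "h p * S2_bracket f g p = S2_div X p * S2_bracket f g p" if "f \<in> smooth_S2" "g \<in> smooth_S2" for f g
      using fun_cong [OF eq [OF derivation_bracket_left derivation_bracket_left], OF that, of p] a [OF that] by simp
    from this [of x2 x3] this [of x3 x1] this [of x1 x2]
    have "h p * x1 p = S2_div X p * x1 p" "h p * x2 p = S2_div X p * x2 p"
      "h p * x3 p = S2_div X p * x3 p" unfolding S2_bracket_coords by simp_all
    then have "h p * ((x1 p)\<^sup>2 + (x2 p)\<^sup>2 + (x3 p)\<^sup>2) = S2_div X p * ((x1 p)\<^sup>2 + (x2 p)\<^sup>2 + (x3 p)\<^sup>2)"
      by algebra
    then show "h p = S2_div X p" by (simp add: S2_coord_sq)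
  qed
qed

text \<open>A Hamiltonian field of the standard structure is free of divergence, so after multiplication by \<open>c - x3\<close> the
  divergence is the derivative of that factor along the field.\<close>

lemma modular_field_necklace:
  "modular_field smooth_S2 (necklace_poisson c) std_area = vector_field S2_rot"
proof
  fix Fs
  let ?\<phi> = "(\<lambda>p. c) - x3"
  show "modular_field smooth_S2 (necklace_poisson c) std_area Fs = vector_field S2_rot Fs"
  proof (cases "smooth_args smooth_S2 1 Fs")
    case True
    then obtain f where f: "f \<in> smooth_S2" "Fs = [f]" by (auto simp: smooth_args_1)
    define X where "X = (\<lambda>g. S2_bracket g f)"
    have X: "derivation X" unfolding X_def by (rule derivation_bracket_left [OF f(1)])
    have \<phi>: "?\<phi> \<in> smooth_S2" by simp
    have "hamiltonian_field smooth_S2 (necklace_poisson c) f = vector_field (\<lambda>g. ?\<phi> * X g)"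
      using f by (auto simp: fun_eq_iff hamiltonian_field_def vector_field_def smooth_args_1 necklace_eq_bivector X_def)
    then have "modular_field smooth_S2 (necklace_poisson c) std_area Fs = S2_div (\<lambda>g. ?\<phi> * X g)"
      using True f divergence_vector_field [OF derivation_mult [OF X \<phi>]] by (simp add: modular_field_def)
    also have "\<dots> = X ?\<phi> + ?\<phi> * S2_div X" by (rule S2_div_mult [OF X \<phi>])
    also have "S2_div X = 0"
    proof -
      have "X g = - S2_bracket f g" for g unfolding X_def by (rule S2_bracket_antisym)
      then have "S2_div X = - S2_div (S2_bracket f)" using f by (simp add: S2_div_def)
      then show ?thesis by (simp add: S2_div_bracket [OF f(1)])
    qed
    also have "X ?\<phi> = - X x3" by (simp add: derivation_minus [OF X] derivation_const [OF X])
    also have "X x3 = - S2_rot f"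
      unfolding X_def using S2_bracket_antisym [of x3 f] f by (simp add: S2_bracket_coord)
    finally show ?thesis using f by simp
  next
    case False
    then show ?thesis by (simp add: modular_field_def vector_field_def)
  qed
qed

section \<open>Bases of cohomology spaces\<close>

text \<open>Closure under the pointwise operations, on which \<open>class_add\<close> and \<open>class_scale\<close> are built.\<close>

definition mv_subspace :: "'m multivector set \<Rightarrow> bool" where
  "mv_subspace S \<longleftrightarrow> 0 \<in> S \<and> (\<forall>P\<in>S. \<forall>Q\<in>S. P + Q \<in> S) \<and> (\<forall>a. \<forall>P\<in>S. mv_scale a P \<in> S)"

lemma mv_subspaceD:
  assumes "mv_subspace S"
  shows "0 \<in> S" "P \<in> S \<Longrightarrow> Q \<in> S \<Longrightarrow> P + Q \<in> S" "P \<in> S \<Longrightarrow> mv_scale a P \<in> S"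
  using assms by (auto simp: mv_subspace_def)

lemma mv_subspace_uminus: "mv_subspace S \<Longrightarrow> P \<in> S \<Longrightarrow> - P \<in> S"
  using mv_subspaceD(3) [of S P "- 1"] by (simp add: fun_Compl_def)

lemma mv_subspace_diff: "mv_subspace S \<Longrightarrow> P \<in> S \<Longrightarrow> Q \<in> S \<Longrightarrow> P - Q \<in> S"
  using mv_subspaceD(2) [of S P "- Q"] mv_subspace_uminus [of S Q] by simp

context
  fixes C :: "('m \<Rightarrow> real) set" and \<pi> :: "'m multivector" and k :: nat
  assumes Z: "mv_subspace (poisson_cocycles C \<pi> k)" and B: "mv_subspace (poisson_coboundaries C \<pi> k)"
begin

abbreviation (input) "cocycles \<equiv> poisson_cocycles C \<pi> k"
abbreviation (input) "coboundaries \<equiv> poisson_coboundaries C \<pi> k"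
abbreviation (input) "coclass \<equiv> poisson_class C \<pi> k"

lemma poisson_class_eq_iff:
  assumes "P \<in> cocycles" "Q \<in> cocycles"
  shows "coclass P = coclass Q \<longleftrightarrow> P - Q \<in> coboundaries"
proof
  assume "coclass P = coclass Q"
  moreover have "Q \<in> coclass Q"
    using assms(2) mv_subspaceD(1) [OF B] by (simp add: poisson_class_def cohomologous_def)
  ultimately show "P - Q \<in> coboundaries"
    by (auto simp: poisson_class_def cohomologous_def)
next
  assume PQ: "P - Q \<in> coboundaries"
  have "P - R \<in> coboundaries \<longleftrightarrow> Q - R \<in> coboundaries" for R
    using mv_subspaceD(2) [OF B PQ, of "Q - R"] mv_subspace_diff [OF B _ PQ, of "P - R"] by auto
  then show "coclass P = coclass Q"
    using assms by (auto simp: poisson_class_def cohomologous_def)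
qed

lemma poisson_class_mem:
  "P \<in> cocycles \<Longrightarrow> Q \<in> coclass P \<longleftrightarrow>
    Q \<in> cocycles \<and> P - Q \<in> coboundaries"
  by (auto simp: poisson_class_def cohomologous_def)

lemma poisson_class_self: "P \<in> cocycles \<Longrightarrow> P \<in> coclass P"
  using mv_subspaceD(1) [OF B] by (simp add: poisson_class_mem)

lemma class_scale_class:
  assumes P: "P \<in> cocycles"
  shows "class_scale C \<pi> k a (coclass P) = coclass (mv_scale a P)"
proof -
  have "coclass (mv_scale a Q) = coclass (mv_scale a P)"
    if "Q \<in> coclass P" for Q
  proof -
    have Q: "Q \<in> cocycles" "P - Q \<in> coboundaries"
      using that P by (auto simp: poisson_class_mem)
    have "mv_scale (- a) (P - Q) = mv_scale a Q - mv_scale a P" by (simp add: fun_eq_iff algebra_simps)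
    then have "mv_scale a Q - mv_scale a P \<in> coboundaries"
      using mv_subspaceD(3) [OF B Q(2), of "- a"] by simp
    then show ?thesis
      using poisson_class_eq_iff [OF mv_subspaceD(3) [OF Z Q(1)] mv_subspaceD(3) [OF Z P]] by blast
  qed
  then show ?thesis using poisson_class_self [OF P] unfolding class_scale_def by blast
qed

lemma class_add_class:
  assumes P: "P \<in> cocycles" and Q: "Q \<in> cocycles"
  shows "class_add C \<pi> k (coclass P) (coclass Q) = coclass (P + Q)"
proof -
  have "coclass (P' + Q') = coclass (P + Q)"
    if "P' \<in> coclass P" "Q' \<in> coclass Q" for P' Q'
  proof -
    have P': "P' \<in> cocycles" "P - P' \<in> coboundaries"
      and Q': "Q' \<in> cocycles" "Q - Q' \<in> coboundaries"
      using that P Q by (auto simp: poisson_class_mem)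
    have e: "(P + Q) - (P' + Q') = (P - P') + (Q - Q')" by simp
    have "(P + Q) - (P' + Q') \<in> coboundaries"
      unfolding e by (rule mv_subspaceD(2) [OF B P'(2) Q'(2)])
    then show ?thesis
      using poisson_class_eq_iff [OF mv_subspaceD(2) [OF Z P Q] mv_subspaceD(2) [OF Z P'(1) Q'(1)]] by simp
  qed
  then show ?thesis
    using poisson_class_self [OF P] poisson_class_self [OF Q] unfolding class_add_def by blast
qed

lemma poisson_cohomology_eq: "poisson_cohomology C \<pi> k = coclass ` cocycles"
  by (auto simp: poisson_cohomology_def quotient_def poisson_class_def)

text \<open>This reduces a claim about classes to two claims about representatives: every cocycle is cohomologous to a
  multiple of \<open>E\<close>, and only the zero multiple of \<open>E\<close> is a coboundary.\<close>

lemma bij_betw_span_one: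
  assumes E: "E \<in> cocycles"
    and surj: "\<And>P. P \<in> cocycles \<Longrightarrow> \<exists>a. P - mv_scale a E \<in> coboundaries"
    and inj: "\<And>a. mv_scale a E \<in> coboundaries \<Longrightarrow> a = 0"
  shows "bij_betw (\<lambda>a. class_scale C \<pi> k a (coclass E)) UNIV (poisson_cohomology C \<pi> k)"
  unfolding class_scale_class [OF E] poisson_cohomology_eq
proof (rule bij_betw_imageI)
  note aE = mv_subspaceD(3) [OF Z E]
  show "inj (\<lambda>a. coclass (mv_scale a E))"
  proof (rule injI)
    fix a b
    assume "coclass (mv_scale a E) = coclass (mv_scale b E)"
    then have "mv_scale a E - mv_scale b E \<in> coboundaries"
      using poisson_class_eq_iff [OF aE aE] by blast
    moreover have "mv_scale a E - mv_scale b E = mv_scale (a - b) E"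
      by (simp add: fun_eq_iff algebra_simps)
    ultimately show "a = b" using inj [of "a - b"] by simp
  qed
  show "range (\<lambda>a. coclass (mv_scale a E)) = coclass ` cocycles"
  proof (intro equalityI subsetI)
    fix K assume "K \<in> coclass ` cocycles"
    then obtain P where P: "P \<in> cocycles" "K = coclass P" by blast
    then obtain a where "P - mv_scale a E \<in> coboundaries" using surj by blast
    then have "K = coclass (mv_scale a E)"
      using poisson_class_eq_iff [OF P(1) aE] P(2) by blast
    then show "K \<in> range (\<lambda>a. coclass (mv_scale a E))" by blast
  qed (use aE in blast)
qed

lemma bij_betw_span_two:
  assumes E: "E \<in> cocycles" and F: "F \<in> cocycles"
    and surj: "\<And>P. P \<in> cocycles \<Longrightarrow>
      \<exists>a b. P - (mv_scale a E + mv_scale b F) \<in> coboundaries"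
    and inj: "\<And>a b. mv_scale a E + mv_scale b F \<in> coboundaries \<Longrightarrow> a = 0 \<and> b = 0"
  shows "bij_betw (\<lambda>(a, b). class_add C \<pi> k (class_scale C \<pi> k a (coclass E))
      (class_scale C \<pi> k b (coclass F))) UNIV (poisson_cohomology C \<pi> k)"
proof -
  note aE = mv_subspaceD(3) [OF Z E] and bF = mv_subspaceD(3) [OF Z F]
  note abEF = mv_subspaceD(2) [OF Z aE bF]
  let ?L = "\<lambda>(a, b). mv_scale a E + mv_scale b F"
  have "inj (\<lambda>ab. coclass (?L ab))"
  proof (rule injI, clarify)
    fix a b a' b'
    assume "coclass (mv_scale a E + mv_scale b F)
        = coclass (mv_scale a' E + mv_scale b' F)"
    then have "(mv_scale a E + mv_scale b F) - (mv_scale a' E + mv_scale b' F) \<in> coboundaries"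
      using poisson_class_eq_iff [OF abEF abEF] by blast
    moreover have "(mv_scale a E + mv_scale b F) - (mv_scale a' E + mv_scale b' F)
        = mv_scale (a - a') E + mv_scale (b - b') F"
      by (simp add: fun_eq_iff algebra_simps)
    ultimately show "a = a' \<and> b = b'" using inj [of "a - a'" "b - b'"] by simp
  qed
  moreover have "range (\<lambda>ab. coclass (?L ab)) = coclass ` cocycles"
  proof (intro equalityI subsetI)
    fix K assume "K \<in> coclass ` cocycles"
    then obtain P where P: "P \<in> cocycles" "K = coclass P" by blast
    then obtain a b where "P - (mv_scale a E + mv_scale b F) \<in> coboundaries"
      using surj by blast
    then have "K = coclass (?L (a, b))"
      using poisson_class_eq_iff [OF P(1) abEF] P(2) by simp
    then show "K \<in> range (\<lambda>ab. coclass (?L ab))" by blast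
  qed (use abEF in auto)
  ultimately have "bij_betw (\<lambda>ab. coclass (?L ab)) UNIV (poisson_cohomology C \<pi> k)"
    unfolding poisson_cohomology_eq by (rule bij_betw_imageI)
  then show ?thesis
    by (simp add: class_scale_class [OF E] class_scale_class [OF F] class_add_class [OF aE bF] split_def)
qed

end

section \<open>Cocycles and coboundaries of the necklace structures\<close>

lemma derivation_zero: "derivation (\<lambda>f. 0)"
  by (simp add: derivation_def fun_eq_iff)

lemma derivation_scale: "derivation X \<Longrightarrow> derivation (\<lambda>f p. a * X f p)"
  using derivation_mult [of X "\<lambda>p. a"] by (simp add: times_fun_def)

lemma vector_field_add: "vector_field X + vector_field Y = vector_field (\<lambda>f. X f + Y f)"
  by (auto simp: fun_eq_iff vector_field_def)

lemma vector_field_diff: "vector_field X - vector_field Y = vector_field (\<lambda>f. X f - Y f)"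
  by (auto simp: fun_eq_iff vector_field_def)

lemma vector_field_scale: "mv_scale a (vector_field X) = vector_field (\<lambda>f p. a * X f p)"
  by (auto simp: fun_eq_iff vector_field_def)

lemma vector_field_zero: "vector_field (\<lambda>f. 0) = 0"
  by (auto simp: fun_eq_iff vector_field_def)

lemma vector_field_eqD: "vector_field X = vector_field Y \<Longrightarrow> f \<in> smooth_S2 \<Longrightarrow> X f = Y f"
  using vector_field_single by metis

lemma vector_field_cong:
  "(\<And>f. f \<in> smooth_S2 \<Longrightarrow> X f = Y f) \<Longrightarrow> vector_field X = vector_field Y"
  by (auto simp: fun_eq_iff vector_field_def smooth_args_1)

lemma bivector_add: "bivector u + bivector v = bivector (u + v)"
  by (simp add: fun_eq_iff bivector_def algebra_simps)

lemma bivector_diff: "bivector u - bivector v = bivector (u - v)"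
  by (simp add: fun_eq_iff bivector_def algebra_simps)

lemma bivector_scale: "mv_scale a (bivector u) = bivector (\<lambda>p. a * u p)"
  by (simp add: fun_eq_iff bivector_def)

lemma bivector_inject: "bivector u = bivector v \<longleftrightarrow> u = v"
proof
  assume eq: "bivector u = bivector v"
  have uv: "u p * S2_bracket f g p = v p * S2_bracket f g p" if "f \<in> smooth_S2" "g \<in> smooth_S2" for f g p
    using that bivector_pair [OF that, of u] bivector_pair [OF that, of v] eq by (metis times_fun_apply)
  show "u = v"
  proof
    fix p
    have "u p * x1 p = v p * x1 p" "u p * x2 p = v p * x2 p" "u p * x3 p = v p * x3 p"
      using uv [of x2 x3 p] uv [of x3 x1 p] uv [of x1 x2 p] unfolding S2_bracket_coords by simp_all
    then have "u p * ((x1 p)\<^sup>2 + (x2 p)\<^sup>2 + (x3 p)\<^sup>2) = v p * ((x1 p)\<^sup>2 + (x2 p)\<^sup>2 + (x3 p)\<^sup>2)"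
      by algebra
    then show "u p = v p" by (simp add: S2_coord_sq)
  qed
qed simp

lemma twisted_div_add:
  "derivation X \<Longrightarrow> derivation Y \<Longrightarrow> twisted_div c (\<lambda>f. X f + Y f) = twisted_div c X + twisted_div c Y"
  by (simp add: twisted_div_def S2_div_add fun_eq_iff algebra_simps)

lemma twisted_div_scale:
  assumes "derivation X"
  shows "twisted_div c (\<lambda>f p. a * X f p) = (\<lambda>p. a * twisted_div c X p)"
  by (simp add: twisted_div_def S2_div_def derivationD(1) [OF assms] fun_eq_iff algebra_simps)

lemma twisted_div_zero: "twisted_div c (\<lambda>f. 0) = 0"
  by (simp add: twisted_div_def S2_div_def fun_eq_iff)

lemma twisted_div_rot: "twisted_div c S2_rot = 0"
  by (simp add: twisted_div_def S2_div_rot S2_rot_coord fun_eq_iff)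

context
  fixes c :: real
  assumes c: "\<bar>c\<bar> < 1"
begin

abbreviation (input) "necklace_Z \<equiv> poisson_cocycles smooth_S2 (necklace_poisson c)"
abbreviation (input) "necklace_B \<equiv> poisson_coboundaries smooth_S2 (necklace_poisson c)"

text \<open>The Casimir functions are constant, see \<open>casimir_const\<close>.\<close>

lemma cocycles_0:
  "necklace_Z 0 = (\<lambda>a. of_function (\<lambda>p. a)) ` UNIV"
proof (intro equalityI subsetI)
  let ?\<phi> = "(\<lambda>p. c) - x3"
  have \<phi>: "?\<phi> \<in> smooth_S2" by simp
  fix P assume "P \<in> necklace_Z 0"
  then have P: "P \<in> multivector_fields smooth_S2 0"
    and d: "poisson_diff smooth_S2 (bivector ?\<phi>) 0 P = 0"
    by (auto simp: poisson_cocycles_def necklace_eq_bivector)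
  obtain f where f: "f \<in> smooth_S2" "P = of_function f" using P multivector_fields_0 by blast
  have "vector_field (\<lambda>h. ?\<phi> * S2_bracket f h) = vector_field (\<lambda>h. 0)"
    using d poisson_diff_0 [OF \<phi> f(1)] f(2) by (simp add: vector_field_zero)
  then have "(c - x3 p) * S2_bracket f h p = 0" if "h \<in> smooth_S2" for h p
    using fun_cong [OF vector_field_eqD [OF _ that], of "\<lambda>h. ?\<phi> * S2_bracket f h" "\<lambda>h. 0" p] by simp
  then have "f p = f q" for p q by (rule casimir_const [OF c f(1)])
  then have "f = (\<lambda>p. f undefined)" by blast
  then have "P = of_function (\<lambda>p. f undefined)"
    unfolding f(2) by (rule arg_cong [where f = of_function])
  then show "P \<in> range (\<lambda>a. of_function (\<lambda>p. a))" by blast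
next
  let ?\<phi> = "(\<lambda>p. c) - x3"
  fix P assume "P \<in> range (\<lambda>a. of_function (\<lambda>p::S2. a))"
  then obtain a where P: "P = of_function (\<lambda>p. a)" by blast
  have "S2_bracket (\<lambda>p. a) h = 0" if "h \<in> smooth_S2" for h
    by (rule derivation_const [OF derivation_bracket_left [OF that]])
  then have "vector_field (\<lambda>h. ?\<phi> * S2_bracket (\<lambda>p. a) h) = vector_field (\<lambda>h. 0)"
    by (intro vector_field_cong) simp
  then show "P \<in> necklace_Z 0"
    using poisson_diff_0 [of ?\<phi> "\<lambda>p. a"] multivector_fields_0 [of P]
    by (auto simp: P poisson_cocycles_def necklace_eq_bivector vector_field_zero)
qed

lemma cocycles_1:
  "necklace_Z 1 = {vector_field X | X. derivation X \<and> twisted_div c X = 0}"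
proof (intro equalityI subsetI)
  fix P assume "P \<in> necklace_Z 1"
  then have P: "P \<in> multivector_fields smooth_S2 1"
    and d: "poisson_diff smooth_S2 (necklace_poisson c) 1 P = 0"
    by (auto simp: poisson_cocycles_def)
  obtain X where X: "derivation X" "P = vector_field X" by (rule multivector_fields_1E [OF P])
  have "bivector (twisted_div c X) = bivector 0"
    using d poisson_diff_1 [OF X(1), of c] X(2) necklace_eq_bivector by (simp add: fun_eq_iff bivector_def)
  then show "P \<in> {vector_field X | X. derivation X \<and> twisted_div c X = 0}"
    using X by (auto simp: bivector_inject)
next
  fix P assume "P \<in> {vector_field X | X. derivation X \<and> twisted_div c X = 0}"
  then obtain X where X: "derivation X" "twisted_div c X = 0" "P = vector_field X" by blast
  have "bivector 0 = 0" by (simp add: fun_eq_iff bivector_def)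
  then show "P \<in> necklace_Z 1"
    using X vector_field_in [OF X(1)] poisson_diff_1 [OF X(1), of c]
    by (simp add: poisson_cocycles_def necklace_eq_bivector)
qed

lemma coboundaries_1:
  "necklace_B 1
    = {vector_field (\<lambda>h. ((\<lambda>p. c) - x3) * S2_bracket f h) | f. f \<in> smooth_S2}"
proof -
  have "multivector_fields smooth_S2 0 = of_function ` smooth_S2" using multivector_fields_0 by blast
  then have "necklace_B 1
      = (\<lambda>f. poisson_diff smooth_S2 (bivector ((\<lambda>p. c) - x3)) 0 (of_function f)) ` smooth_S2"
    by (simp add: poisson_coboundaries_def necklace_eq_bivector image_image)
  also have "\<dots> = (\<lambda>f. vector_field (\<lambda>h. ((\<lambda>p. c) - x3) * S2_bracket f h)) ` smooth_S2"
    by (intro image_cong refl poisson_diff_0) simp_all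
  finally show ?thesis by blast
qed

lemma cocycles_2: "necklace_Z 2 = bivector ` smooth_S2"
proof (intro equalityI subsetI)
  fix P assume "P \<in> necklace_Z 2"
  then have "P \<in> multivector_fields smooth_S2 2" by (simp add: poisson_cocycles_def)
  then show "P \<in> bivector ` smooth_S2" using multivector_fields_2E by blast
next
  fix P assume "P \<in> bivector ` smooth_S2"
  then show "P \<in> necklace_Z 2"
    using bivector_in poisson_diff_2 [of "(\<lambda>p. c) - x3"]
    by (auto simp: poisson_cocycles_def necklace_eq_bivector)
qed

lemma coboundaries_2:
  "necklace_B 2 = {bivector (twisted_div c X) | X. derivation X}"
proof -
  have "necklace_B 2
      = poisson_diff smooth_S2 (necklace_poisson c) 1 ` multivector_fields smooth_S2 1"
    by (simp add: poisson_coboundaries_def numeral_2_eq_2)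
  also have "multivector_fields smooth_S2 1 = {vector_field X | X. derivation X}"
    using multivector_fields_1E vector_field_in by blast
  also have "poisson_diff smooth_S2 (necklace_poisson c) 1 ` {vector_field X | X. derivation X}
      = {poisson_diff smooth_S2 (necklace_poisson c) 1 (vector_field X) | X. derivation X}"
    by blast
  also have "\<dots> = {bivector (twisted_div c X) | X. derivation X}"
    using poisson_diff_1 [of _ c] unfolding necklace_eq_bivector by metis
  finally show ?thesis .
qed

lemma subspace_coboundaries_0: "mv_subspace (necklace_B 0)"
  by (simp add: mv_subspace_def poisson_coboundaries_def fun_eq_iff)

lemma subspace_cocycles_0: "mv_subspace (necklace_Z 0)"
proof -
  have "(0 :: S2 multivector) = of_function (\<lambda>p. 0)" 
    "of_function (\<lambda>p::S2. a) + of_function (\<lambda>p. b) = of_function (\<lambda>p. a + b)"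
    "mv_scale a (of_function (\<lambda>p::S2. b)) = of_function (\<lambda>p. a * b)" for a b
    by (auto simp: of_function_def fun_eq_iff)
  then show ?thesis unfolding mv_subspace_def cocycles_0 by auto
qed

lemma subspace_cocycles_1: "mv_subspace (necklace_Z 1)"
  unfolding mv_subspace_def cocycles_1
proof (intro conjI ballI allI)
  let ?Z = "{vector_field X | X. derivation X \<and> twisted_div c X = 0}"
  show "0 \<in> ?Z"
    using derivation_zero twisted_div_zero vector_field_zero by (intro CollectI exI [of _ "\<lambda>f. 0"]) simp
  fix P Q assume "P \<in> ?Z" "Q \<in> ?Z"
  then obtain X Y where X: "derivation X" "twisted_div c X = 0" "P = vector_field X"
    and Y: "derivation Y" "twisted_div c Y = 0" "Q = vector_field Y" by blast
  then show "P + Q \<in> ?Z"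
    by (intro CollectI exI [of _ "\<lambda>f. X f + Y f"])
       (simp add: vector_field_add derivation_add twisted_div_add)
next
  let ?Z = "{vector_field X | X. derivation X \<and> twisted_div c X = 0}"
  fix a P assume "P \<in> ?Z"
  then obtain X where X: "derivation X" "twisted_div c X = 0" "P = vector_field X" by blast
  then show "mv_scale a P \<in> ?Z"
    by (intro CollectI exI [of _ "\<lambda>f p. a * X f p"])
       (simp add: vector_field_scale derivation_scale twisted_div_scale fun_eq_iff)
qed

lemma subspace_coboundaries_1: "mv_subspace (necklace_B 1)"
  unfolding mv_subspace_def coboundaries_1
proof (intro conjI ballI allI)
  let ?H = "\<lambda>f. vector_field (\<lambda>h. ((\<lambda>p. c) - x3) * S2_bracket f h)"
  let ?B = "{?H f | f. f \<in> smooth_S2}"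
  have "?H (\<lambda>p. 0) = 0"
    unfolding vector_field_zero [symmetric]
    by (rule vector_field_cong) (simp add: derivation_const [OF derivation_bracket_left])
  then show "0 \<in> ?B" by (intro CollectI exI [of _ "\<lambda>p. 0"]) simp
  fix P Q assume "P \<in> ?B" "Q \<in> ?B"
  then obtain f g where f: "f \<in> smooth_S2" "P = ?H f" and g: "g \<in> smooth_S2" "Q = ?H g" by blast
  have "P + Q = ?H (f + g)"
    unfolding f g vector_field_add
    by (rule vector_field_cong)
       (simp add: derivationD(2) [OF derivation_bracket_left] f g distrib_left)
  then show "P + Q \<in> ?B" using smooth_S2_add [OF f(1) g(1)] by blast
next
  let ?H = "\<lambda>f. vector_field (\<lambda>h. ((\<lambda>p. c) - x3) * S2_bracket f h)"
  let ?B = "{?H f | f. f \<in> smooth_S2}"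
  fix a P assume "P \<in> ?B"
  then obtain f where f: "f \<in> smooth_S2" "P = ?H f" by blast
  have "mv_scale a P = ?H (\<lambda>p. a * f p)"
    unfolding f vector_field_scale
    by (rule vector_field_cong)
       (simp add: derivationD(4) [OF derivation_bracket_left] f fun_eq_iff)
  then show "mv_scale a P \<in> ?B" using smooth_S2_scale [OF f(1)] by blast
qed

lemma subspace_cocycles_2: "mv_subspace (necklace_Z 2)"
proof -
  have "(0 :: S2 multivector) = bivector 0" by (simp add: bivector_def fun_eq_iff)
  then show ?thesis
    unfolding mv_subspace_def cocycles_2 by (auto simp: bivector_add bivector_scale)
qed

lemma subspace_coboundaries_2: "mv_subspace (necklace_B 2)"
  unfolding mv_subspace_def coboundaries_2
proof (intro conjI ballI allI)
  let ?B = "{bivector (twisted_div c X) | X. derivation X}"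
  have "(0 :: S2 multivector) = bivector 0" by (simp add: bivector_def fun_eq_iff)
  then show "0 \<in> ?B"
    using derivation_zero twisted_div_zero by (intro CollectI exI [of _ "\<lambda>f. 0"]) simp
  fix P Q assume "P \<in> ?B" "Q \<in> ?B"
  then obtain X Y where X: "derivation X" "P = bivector (twisted_div c X)"
    and Y: "derivation Y" "Q = bivector (twisted_div c Y)" by blast
  then show "P + Q \<in> ?B"
    by (intro CollectI exI [of _ "\<lambda>f. X f + Y f"]) (simp add: bivector_add derivation_add twisted_div_add)
next
  let ?B = "{bivector (twisted_div c X) | X. derivation X}"
  fix a P assume "P \<in> ?B"
  then obtain X where X: "derivation X" "P = bivector (twisted_div c X)" by blast
  then show "mv_scale a P \<in> ?B"
    by (intro CollectI exI [of _ "\<lambda>f p. a * X f p"])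
       (simp add: bivector_scale derivation_scale twisted_div_scale)
qed

lemma cohomology_0:
  "bij_betw (\<lambda>a. class_scale smooth_S2 (necklace_poisson c) 0 a
      (poisson_class smooth_S2 (necklace_poisson c) 0 (of_function 1)))
    UNIV (poisson_cohomology smooth_S2 (necklace_poisson c) 0)"
proof (rule bij_betw_span_one [OF subspace_cocycles_0 subspace_coboundaries_0])
  show "of_function 1 \<in> necklace_Z 0"
    unfolding cocycles_0 by (simp add: one_fun_def)
  have e: "of_function (\<lambda>p::S2. a) = mv_scale a (of_function 1)" for a
    by (auto simp: of_function_def fun_eq_iff)
  show "\<exists>a. P - mv_scale a (of_function 1) \<in> necklace_B 0"
    if "P \<in> necklace_Z 0" for P
    using that unfolding cocycles_0 by (auto simp: e poisson_coboundaries_def)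
  show "a = 0" if "mv_scale a (of_function 1) \<in> necklace_B 0" for a
  proof -
    have "mv_scale a (of_function 1) = (0 :: S2 multivector)"
      using that by (simp add: poisson_coboundaries_def)
    from fun_cong [OF fun_cong [OF this, of "[]"], of undefined] show ?thesis
      by (simp add: of_function_def)
  qed
qed

lemma cohomology_1:
  "bij_betw (\<lambda>a. class_scale smooth_S2 (necklace_poisson c) 1 a
      (poisson_class smooth_S2 (necklace_poisson c) 1 (vector_field S2_rot)))
    UNIV (poisson_cohomology smooth_S2 (necklace_poisson c) 1)"
proof (rule bij_betw_span_one [OF subspace_cocycles_1 subspace_coboundaries_1])
  let ?\<phi> = "(\<lambda>p. c) - x3"
  show "vector_field S2_rot \<in> necklace_Z 1"
    unfolding cocycles_1 using derivation_rot twisted_div_rot by blast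
  show "\<exists>a. P - mv_scale a (vector_field S2_rot) \<in> necklace_B 1"
    if P: "P \<in> necklace_Z 1" for P
  proof -
    obtain X where X: "derivation X" "twisted_div c X = 0" "P = vector_field X"
      using P unfolding cocycles_1 by blast
    then have "twisted_div c X p = 0" for p by simp
    then obtain a f where f: "f \<in> smooth_S2"
      and eq: "\<And>h p. h \<in> smooth_S2 \<Longrightarrow> X h p = a * S2_rot h p + (c - x3 p) * S2_bracket f h p"
      by (rule twisted_div_kernel [OF c X(1)]) (rule that)
    have "P - mv_scale a (vector_field S2_rot) = vector_field (\<lambda>h. ?\<phi> * S2_bracket f h)"
      unfolding X(3) vector_field_scale vector_field_diff
      by (rule vector_field_cong) (simp add: eq fun_eq_iff)
    then show ?thesis unfolding coboundaries_1 using f by blast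
  qed
  show "a = 0" if "mv_scale a (vector_field S2_rot) \<in> necklace_B 1" for a
  proof -
    from that obtain f where "mv_scale a (vector_field S2_rot) = vector_field (\<lambda>h. ?\<phi> * S2_bracket f h)"
      unfolding coboundaries_1 by blast
    then have "a * S2_rot h p = (c - x3 p) * S2_bracket f h p" if "h \<in> smooth_S2" for h p
      unfolding vector_field_scale using fun_cong [OF vector_field_eqD [OF _ that]] by fastforce
    then show "a = 0" by (rule rot_not_hamiltonian [OF c])
  qed
qed

lemma cohomology_2:
  "bij_betw (\<lambda>(a, b). class_add smooth_S2 (necklace_poisson c) 2
      (class_scale smooth_S2 (necklace_poisson c) 2 a
        (poisson_class smooth_S2 (necklace_poisson c) 2 (necklace_poisson c)))
      (class_scale smooth_S2 (necklace_poisson c) 2 b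
        (poisson_class smooth_S2 (necklace_poisson c) 2 std_poisson)))
    UNIV (poisson_cohomology smooth_S2 (necklace_poisson c) 2)"
proof (rule bij_betw_span_two [OF subspace_cocycles_2 subspace_coboundaries_2])
  show "necklace_poisson c \<in> necklace_Z 2"
    unfolding cocycles_2 unfolding necklace_eq_bivector by simp
  show "std_poisson \<in> necklace_Z 2"
    unfolding cocycles_2 unfolding std_eq_bivector by simp
  have comb: "mv_scale a (necklace_poisson c) + mv_scale b std_poisson
      = bivector (\<lambda>p. a * (c - x3 p) + b)" for a b
    by (simp add: fun_eq_iff necklace_eq_bivector bivector_def algebra_simps)
  show "\<exists>a b. P - (mv_scale a (necklace_poisson c) + mv_scale b std_poisson)
      \<in> necklace_B 2"
    if P: "P \<in> necklace_Z 2" for P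
  proof -
    obtain h where h: "h \<in> smooth_S2" "P = bivector h" using P unfolding cocycles_2 by blast
    obtain a b X where X: "derivation X" "\<And>p. h p = a * (c - x3 p) + b + twisted_div c X p"
      by (rule twisted_div_surjective [OF c h(1)], rule that)
    have "P - (mv_scale a (necklace_poisson c) + mv_scale b std_poisson) = bivector (twisted_div c X)"
      unfolding comb h(2) bivector_diff bivector_inject using X(2) by (simp add: fun_eq_iff)
    then show ?thesis unfolding coboundaries_2 using X(1) by blast
  qed
  show "a = 0 \<and> b = 0"
    if "mv_scale a (necklace_poisson c) + mv_scale b std_poisson
      \<in> necklace_B 2" for a b
  proof -
    from that obtain X where X: "derivation X" "twisted_div c X = (\<lambda>p. a * (c - x3 p) + b)"
      unfolding coboundaries_2 comb by (auto simp: bivector_inject)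
    then have "twisted_div c X p = a * (c - x3 p) + b" for p by simp
    then show ?thesis using twisted_div_injective [OF c X(1)] by blast
  qed
qed

end

theorem theorem4p3p2:
  fixes c :: real
  assumes "\<bar>c\<bar> < 1"
  defines "\<pi>\<^sub>c \<equiv> necklace_poisson c"
  shows
   "bij_betw (\<lambda>a. class_scale smooth_S2 \<pi>\<^sub>c 0 a (poisson_class smooth_S2 \<pi>\<^sub>c 0 (of_function 1)))
      UNIV (poisson_cohomology smooth_S2 \<pi>\<^sub>c 0) \<and>
    bij_betw (\<lambda>a. class_scale smooth_S2 \<pi>\<^sub>c 1 a
                    (poisson_class smooth_S2 \<pi>\<^sub>c 1 (modular_field smooth_S2 \<pi>\<^sub>c std_area)))
      UNIV (poisson_cohomology smooth_S2 \<pi>\<^sub>c 1) \<and>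
    bij_betw (\<lambda>(a, b). class_add smooth_S2 \<pi>\<^sub>c 2
                    (class_scale smooth_S2 \<pi>\<^sub>c 2 a (poisson_class smooth_S2 \<pi>\<^sub>c 2 \<pi>\<^sub>c))
                    (class_scale smooth_S2 \<pi>\<^sub>c 2 b (poisson_class smooth_S2 \<pi>\<^sub>c 2 std_poisson)))
      UNIV (poisson_cohomology smooth_S2 \<pi>\<^sub>c 2)"
  unfolding \<pi>\<^sub>c_def modular_field_necklace
  using cohomology_0 [OF assms(1)] cohomology_1 [OF assms(1)] cohomology_2 [OF assms(1)] by blast

end
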